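(* Let $d_1,\dots,d_l\ge 2$ be natural numbers. The compactum of tensorial bodies $\mathcal{BM}_\otimes(d_1,\dots,d_l)$ is contractible.
   Context: For $d\in\mathbb{N}$, $\mathbb{R}^d$ carries its standard inner product. The tensor product $\otimes_{i=1}^l\mathbb{R}^{d_i}$ carries the inner product $\langle\cdot,\cdot\rangle_H$ determined by $\langle x^1\otimes\cdots\otimes x^l,y^1\otimes\cdots\otimes y^l\rangle_H=\prod_{i=1}^l\langle x^i,y^i\rangle$. A 0-symmetric convex body is a compact convex set $P$ with nonempty interior and $P=-P$; $\mathcal{B}(d)$ is the set of these in $\mathbb{R}^d$. The polar is $P^\circ=\{y:\langle x,y\rangle\le 1\ \forall x\in P\}$ (using $\langle\cdot,\cdot\rangle_H$ in the tensor product). For $P_i\in\mathcal{B}(d_i)$, $i=1,\dots,l$, let $P_1\otimes_\pi\cdots\otimes_\pi P_l:=\mathrm{conv}\{x^1\otimes\cdots\otimes x^l: x^i\in P_i\}$ and $P_1\otimes_\epsilon\cdots\otimes_\epsilon P_l:=(P_1^\circ\otimes_\pi\cdots\otimes_\pi P_l^\circ)^\circ$. A 0-symmetric convex body $P\subset\otimes_{i=1}^l\mathbb{R}^{d_i}$ is a tensorial body if there are $P_i\in\mathcal{B}(d_i)$ with $P_1\otimes_\pi\cdots\otimes_\pi P_l\subseteq P\subseteq P_1\otimes_\epsilon\cdots\otimes_\epsilon P_l$. $\mathcal{B}_\otimes(d_1,\dots,d_l)$ is the set of all tensorial bodies in $\otimes_{i=1}^l\mathbb{R}^{d_i}$, a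 metric space with the Hausdorff distance induced by the Euclidean norm of $\langle\cdot,\cdot\rangle_H$. $GL_\otimes(d_1,\dots,d_l)$ is the group of linear isomorphisms of $\otimes_{i=1}^l\mathbb{R}^{d_i}$ sending decomposable vectors $x^1\otimes\cdots\otimes x^l$ to decomposable vectors; it acts on $\mathcal{B}_\otimes(d_1,\dots,d_l)$ by $(T,P)\mapsto T(P)$. The tensorial Banach–Mazur distance is $\delta_\otimes^{BM}(P,R)=\inf\{\lambda\ge 1:R\subseteq TP\subseteq\lambda R\text{ for some }T\in GL_\otimes(d_1,\dots,d_l)\}$. $\mathcal{BM}_\otimes(d_1,\dots,d_l)$ is the set of equivalence classes of tensorial bodies under $P\sim' R\iff\delta_\otimes^{BM}(P,R)=1$, with the metric $\log\delta_\otimes^{BM}$; it is known to be a compact metric space homeomorphic to the orbit space $\mathcal{B}_\otimes(d_1,\dots,d_l)/GL_\otimes(d_1,\dots,d_l)$ with the quotient topology. A space $X$ is contractible if there is a homotopy $X\times[0,1]\to X$ from the identity to a constant map. *)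

theory Defs
  imports "HOL-Analysis.Analysis"
begin

text \<open>
  The factors may have different dimensions, so the spaces are coordinate subspaces of Euclidean
  types. The factors are indexed by a finite type \<open>'l\<close>, and the \<open>i\<close>-th factor, of dimension
  \<open>card (K i)\<close>, is the subspace of \<open>real ^ 'k\<close> of the vectors supported in \<open>K i\<close>. A tensor is an
  array indexed by multi-indices \<open>f :: 'l \<Rightarrow> 'k\<close>, supported where \<open>f i \<in> K i\<close> for every \<open>i\<close>.
  The given inner product \<open>\<bullet>\<close> restricted to such subspaces is the standard one on the factors and
  the tensor one (lemma \<open>inner_tens\<close>) on the arrays.
\<close>

definition coord_space :: "'n set \<Rightarrow> (real ^ 'n::finite) set" where
  "coord_space S = {x. \<forall>j. j \<notin> S \<longrightarrow> x $ j = 0}"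

definition tensor_space :: "('l::finite \<Rightarrow> 'k::finite set) \<Rightarrow> (real ^ ('l \<Rightarrow> 'k)) set" where
  "tensor_space K = coord_space (Pi UNIV K)"

definition tens :: "('l \<Rightarrow> real ^ 'k) \<Rightarrow> real ^ ('l::finite \<Rightarrow> 'k::finite)" where
  "tens x = (\<chi> f. \<Prod>i\<in>UNIV. x i $ f i)"

definition decomposables :: "('l::finite \<Rightarrow> 'k::finite set) \<Rightarrow> (real ^ ('l \<Rightarrow> 'k)) set" where
  "decomposables K = {tens x | x. \<forall>i. x i \<in> coord_space (K i)}"

lemma coord_space_simps:
  shows subspace_coord_space: "subspace (coord_space S)"
    and dim_coord_space: "dim (coord_space S) = card S"
proof -
  show "subspace (coord_space S)"
    by (auto simp: coord_space_def subspace_def)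
  show "dim (coord_space S) = card S"
    using dim_substandard_cart[of S, where 'a=real]
    by (simp add: coord_space_def dim_vec_eq)
qed

lemma inner_tens: "tens x \<bullet> tens y = (\<Prod>i\<in>UNIV. x i \<bullet> y i)"
proof -
  have "(\<Prod>i\<in>UNIV. x i \<bullet> y i) = (\<Prod>i\<in>UNIV. \<Sum>j\<in>UNIV. x i $ j * y i $ j)"
    by (simp add: inner_vec_def)
  also have "\<dots> = (\<Sum>f\<in>PiE UNIV (\<lambda>_. UNIV). \<Prod>i\<in>UNIV. x i $ f i * y i $ f i)"
    by (rule prod_sum_PiE) auto
  finally show ?thesis
    by (simp add: inner_vec_def tens_def prod.distrib PiE_UNIV_domain)
qed

lemma decomposables_subset: "decomposables K \<subseteq> tensor_space K"
  by (force simp: decomposables_def tensor_space_def coord_space_def tens_def Pi_def)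

text \<open>Interior and polar are taken relative to the subspace \<open>V\<close> in which the body lives.\<close>

definition sym_convex_bodies :: "'a::real_inner set \<Rightarrow> 'a set set" where
  "sym_convex_bodies V = {P. P \<subseteq> V \<and> compact P \<and> convex P \<and>
     top_of_set V interior_of P \<noteq> {} \<and> uminus ` P = P}"

definition polar_in :: "'a::real_inner set \<Rightarrow> 'a set \<Rightarrow> 'a set" where
  "polar_in V P = {y \<in> V. \<forall>x\<in>P. x \<bullet> y \<le> 1}"

definition proj_tensor :: "('l \<Rightarrow> (real ^ 'k) set) \<Rightarrow> (real ^ ('l::finite \<Rightarrow> 'k::finite)) set" where
  "proj_tensor P = convex hull {tens x | x. \<forall>i. x i \<in> P i}"

definition inj_tensor ::
  "('l \<Rightarrow> 'k set) \<Rightarrow> ('l \<Rightarrow> (real ^ 'k) set) \<Rightarrow> (real ^ ('l::finite \<Rightarrow> 'k::finite)) set" where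
  "inj_tensor K P = polar_in (tensor_space K) (proj_tensor (\<lambda>i. polar_in (coord_space (K i)) (P i)))"

definition tensorial_bodies ::
  "('l::finite \<Rightarrow> 'k::finite set) \<Rightarrow> (real ^ ('l \<Rightarrow> 'k)) set set" where
  "tensorial_bodies K = {P \<in> sym_convex_bodies (tensor_space K).
     \<exists>Q. (\<forall>i. Q i \<in> sym_convex_bodies (coord_space (K i))) \<and>
         proj_tensor Q \<subseteq> P \<and> P \<subseteq> inj_tensor K Q}"

text \<open>
  Every linear automorphism of \<open>tensor_space K\<close> is the restriction of a linear map of the ambient
  type, and only its values on \<open>tensor_space K\<close> are used below.
\<close>

definition GL_tensor ::
  "('l::finite \<Rightarrow> 'k::finite set) \<Rightarrow> (real ^ ('l \<Rightarrow> 'k) \<Rightarrow> real ^ ('l \<Rightarrow> 'k)) set" where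
  "GL_tensor K = {T. linear T \<and> bij_betw T (tensor_space K) (tensor_space K) \<and>
     T ` decomposables K \<subseteq> decomposables K}"

definition tensor_BM_dist ::
  "('l::finite \<Rightarrow> 'k::finite set) \<Rightarrow> (real ^ ('l \<Rightarrow> 'k)) set \<Rightarrow> (real ^ ('l \<Rightarrow> 'k)) set \<Rightarrow> real" where
  "tensor_BM_dist K P R =
     Inf {c. 1 \<le> c \<and> (\<exists>T\<in>GL_tensor K. R \<subseteq> T ` P \<and> T ` P \<subseteq> (\<lambda>x. c *\<^sub>R x) ` R)}"

definition tensor_BM_rel ::
  "('l::finite \<Rightarrow> 'k::finite set) \<Rightarrow> ((real ^ ('l \<Rightarrow> 'k)) set \<times> (real ^ ('l \<Rightarrow> 'k)) set) set" where
  "tensor_BM_rel K = {(P, R). P \<in> tensorial_bodies K \<and> R \<in> tensorial_bodies K \<and>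
     tensor_BM_dist K P R = 1}"

definition BM_tensor ::
  "('l::finite \<Rightarrow> 'k::finite set) \<Rightarrow> (real ^ ('l \<Rightarrow> 'k)) set set set" where
  "BM_tensor K = tensorial_bodies K // tensor_BM_rel K"

text \<open>
  The distance of two classes does not depend on the chosen representatives. Its value outside
  \<open>BM_tensor K\<close> is set to \<open>0\<close> because \<open>Metric_space\<close> asks for nonnegativity and symmetry everywhere.
\<close>

definition BM_tensor_metric ::
  "('l::finite \<Rightarrow> 'k::finite set) \<Rightarrow>
    (real ^ ('l \<Rightarrow> 'k)) set set \<Rightarrow> (real ^ ('l \<Rightarrow> 'k)) set set \<Rightarrow> real" where
  "BM_tensor_metric K C D =
     (if C \<in> BM_tensor K \<and> D \<in> BM_tensor K
      then ln (tensor_BM_dist K (SOME P. P \<in> C) (SOME R. R \<in> D)) else 0)"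

definition BM_tensor_top ::
  "('l::finite \<Rightarrow> 'k::finite set) \<Rightarrow> (real ^ ('l \<Rightarrow> 'k)) set set topology" where
  "BM_tensor_top K = Metric_space.mtopology (BM_tensor K) (BM_tensor_metric K)"

end

theory Submission
  imports Defs
begin

text \<open>
  A tensorial body \<open>P\<close> lies between the projective and the injective tensor product of some bodies
  \<open>Q\<^sub>i\<close>. Two straight-line deformations, both equivariant under the group and Lipschitz for the
  Banach--Mazur distance, contract all classes to one. The first moves \<open>P\<close> inside itself to the convex
  hull of its decomposable elements, which is the projective tensor product of the \<open>Q\<^sub>i\<close>. The second
  moves the norm with unit ball \<open>Q\<^sub>i\<close> linearly to a Euclidean norm canonically attached to it, the
  second moment of the polar of \<open>Q\<^sub>i\<close>. It ends in a projective tensor product of ellipsoids, and these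
  form a single orbit.

  Equivariance is obtained without determining the group: a map of the group permutes the maximal
  linear subspaces of the cone of decomposable tensors. Those containing \<open>x\<^sub>1 \<otimes> \<dots> \<otimes> x\<^sub>l \<noteq> 0\<close> arise by
  letting one factor vary, so that the slices of \<open>P\<close> by them recover the \<open>Q\<^sub>i\<close>.
\<close>

subsection \<open>Symmetric convex bodies and their gauges\<close>

text \<open>The homotopy has to act on classes defined by an infimum, not on single bodies. A map of
  bodies that commutes with the group and turns \<open>R \<subseteq> S \<subseteq> c R\<close> into
  inclusions with factor \<open>c ^ k\<close> raises the Banach-Mazur distance at most to the power
  \<open>2 * k\<close>. So it respects distance 1, and an exponent that is uniform in the time
  parameter reduces joint continuity to continuity in time at each fixed body. The factors of
  \<open>P\<close> are determined only up to scalars with product 1, which is why both deformations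
  are written in terms of \<open>P\<close> alone. The interpolated gauge makes sense on decomposable
  tensors only and always yields projective products; the first deformation is the bridge from a
  general \<open>P\<close> to such a product. The second moment of the polar is attached linearly to
  the body, is homogeneous like the gauge, and its change between nested bodies is controlled by
  monotonicity of integrals alone. Dimension at least 2 keeps the maximal subspaces through a
  nonzero decomposable tensor apart, one for each factor.\<close>

lemma sym_convex_bodies_iff:
  fixes V :: "'a::euclidean_space set"
  assumes V: "subspace V"
  shows "P \<in> sym_convex_bodies V \<longleftrightarrow> P \<subseteq> V \<and> compact P \<and> convex P \<and> (\<forall>x\<in>P. - x \<in> P) \<and>
    (\<exists>r>0. \<forall>x\<in>V. norm x \<le> r \<longrightarrow> x \<in> P)" (is "?l \<longleftrightarrow> ?r")
proof
  assume ?l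
  then have P: "P \<subseteq> V" "compact P" "convex P" "uminus ` P = P"
    and i: "top_of_set V interior_of P \<noteq> {}"
    by (auto simp: sym_convex_bodies_def)
  have sym: "- x \<in> P" if "x \<in> P" for x
    using that P(4) by (metis imageI)
  obtain x0 where "x0 \<in> top_of_set V interior_of P" using i by auto
  then obtain U where U: "openin (top_of_set V) U" "x0 \<in> U" "U \<subseteq> P"
    by (auto simp: interior_of_def)
  then obtain e where e: "e > 0" "\<And>x. x \<in> V \<Longrightarrow> dist x x0 < e \<Longrightarrow> x \<in> U"
    unfolding openin_euclidean_subtopology_iff by metis
  have x0: "x0 \<in> P" "x0 \<in> V" using U P by auto
  \<comment> \<open>\<open>x\<close> is the midpoint of \<open>x0 + 2 x\<close>, which is close to
    \<open>x0\<close>, and of \<open>- x0\<close>. Symmetry thus moves the interior point to the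
    origin.\<close>
  have "x \<in> P" if "x \<in> V" "norm x \<le> e/4" for x
  proof -
    have "x0 + 2 *\<^sub>R x \<in> P"
      using that e U x0 V by (intro subsetD[OF U(3)] e(2))
        (auto simp: subspace_add subspace_scale dist_norm)
    then have "(1/2) *\<^sub>R (x0 + 2 *\<^sub>R x) + (1/2) *\<^sub>R (- x0) \<in> P"
      using P(3) sym[OF x0(1)] by (intro convexD) auto
    then show ?thesis by (simp add: algebra_simps)
  qed
  then show ?r using P sym e(1) by (intro conjI exI[of _ "e/4"]) auto
next
  assume r: ?r
  then obtain r where r0: "r > 0" "\<forall>x\<in>V. norm x \<le> r \<longrightarrow> x \<in> P" by auto
  have "0 \<in> top_of_set V interior_of P"
    unfolding interior_of_def
    using r0 V by (auto intro!: exI[of _ "V \<inter> ball 0 r"] openin_open_Int simp: subspace_0)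
  moreover have "uminus ` P = P"
    using r by (auto simp: image_iff) (metis minus_minus)
  ultimately show ?l using r by (auto simp: sym_convex_bodies_def)
qed

lemma sym_convex_bodies_inner:
  fixes V :: "'a::euclidean_space set"
  assumes "subspace V" "P \<in> sym_convex_bodies V"
  obtains r where "r > 0" "\<And>x. x \<in> V \<Longrightarrow> norm x \<le> r \<Longrightarrow> x \<in> P"
  using assms by (metis sym_convex_bodies_iff)

lemma sym_convex_bodies_bound:
  assumes "P \<in> sym_convex_bodies V"
  obtains b where "b > 0" "\<And>x. x \<in> P \<Longrightarrow> norm x \<le> b"
proof -
  have "bounded P" using assms by (simp add: sym_convex_bodies_def compact_imp_bounded)
  then show ?thesis using that by (auto simp: bounded_pos)
qed

lemma sym_convex_bodies_zero:
  fixes V :: "'a::euclidean_space set"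
  assumes "subspace V" "P \<in> sym_convex_bodies V" shows "0 \<in> P"
  using assms by (metis norm_zero subspace_0 sym_convex_bodies_inner less_imp_le)

lemma convex_scale_mem:
  assumes "convex P" "0 \<in> P" "x \<in> P" "0 \<le> c" "c \<le> 1"
  shows "c *\<^sub>R x \<in> P"
  using convexD[OF assms(1,3,2), of c "1 - c"] assms by auto

lemma convex_sym_scale_mem:
  assumes "convex P" "0 \<in> P" "\<And>x. x \<in> P \<Longrightarrow> - x \<in> P" "x \<in> P" "\<bar>c\<bar> \<le> 1"
  shows "c *\<^sub>R x \<in> P"
  using convex_scale_mem[of P x c] convex_scale_mem[of P "-x" "-c"] assms
  by (cases "c \<ge> 0") auto

text \<open>The Minkowski functional, a norm on the span of a symmetric convex body
  \<open>P\<close>. Outside that span the infimum is over the empty set and the value has no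
  meaning.\<close>

definition mgauge :: "'a::real_vector set \<Rightarrow> 'a \<Rightarrow> real" where
  "mgauge P x = Inf {s. 0 < s \<and> x /\<^sub>R s \<in> P}"

lemma mgauge_set_nonempty:
  fixes V :: "'a::euclidean_space set"
  assumes V: "subspace V" and P: "P \<in> sym_convex_bodies V" and x: "x \<in> V"
  shows "{s. 0 < s \<and> x /\<^sub>R s \<in> P} \<noteq> {}"
proof -
  obtain r where r: "r > 0" "\<And>x. x \<in> V \<Longrightarrow> norm x \<le> r \<Longrightarrow> x \<in> P"
    using sym_convex_bodies_inner[OF V P] by metis
  have "(norm x / r + 1) \<in> {s. 0 < s \<and> x /\<^sub>R s \<in> P}"
  proof -
    have p: "norm x / r + 1 > 0" using r(1) by (simp add: add_nonneg_pos)
    have "norm (x /\<^sub>R (norm x / r + 1)) \<le> r"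
      using p r(1) by (simp add: field_simps)
    then show ?thesis using p r(2) x V by (simp add: subspace_scale)
  qed
  then show ?thesis by blast
qed

text \<open>Closedness of \<open>P\<close> makes the infimum attained, so that a non-strict
  comparison becomes membership. Most properties of gauges are read off from this
  equivalence.\<close>

lemma mgauge_le_iff:
  fixes V :: "'a::euclidean_space set"
  assumes V: "subspace V" and P: "P \<in> sym_convex_bodies V" and x: "x \<in> V" and s: "s > 0"
  shows "mgauge P x \<le> s \<longleftrightarrow> x /\<^sub>R s \<in> P"
proof
  have conv: "convex P" "0 \<in> P" "closed P"
    using P sym_convex_bodies_zero[OF V P] by (auto simp: sym_convex_bodies_iff[OF V] compact_imp_closed)
  let ?S = "{s. 0 < s \<and> x /\<^sub>R s \<in> P}"
  have ne: "?S \<noteq> {}" using mgauge_set_nonempty[OF V P x] .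
  have bdd: "bdd_below ?S" by (rule bdd_belowI[of _ 0]) auto
  have up: "x /\<^sub>R s' \<in> P" if "t \<in> ?S" "t \<le> s'" for t s'
  proof -
    have "(t/s') *\<^sub>R (x /\<^sub>R t) \<in> P"
      using that by (intro convex_scale_mem[OF conv(1,2), of "x /\<^sub>R t"]) auto
    moreover have "t / s' * inverse t = inverse s'" using that by (simp add: field_simps)
    ultimately show ?thesis by (metis scaleR_scaleR)
  qed
  show "mgauge P x \<le> s" if "x /\<^sub>R s \<in> P"
    unfolding mgauge_def using that s bdd by (intro cInf_lower) auto
  show "x /\<^sub>R s \<in> P" if "mgauge P x \<le> s"
  proof -
    have *: "x /\<^sub>R (s + 1 / real (Suc n)) \<in> P" for n
    proof -
      have "1 / real (Suc n) > 0" by simp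
      then have "Inf ?S < s + 1 / real (Suc n)" using that unfolding mgauge_def by linarith
      then obtain t where t: "t \<in> ?S" "t < s + 1 / real (Suc n)"
        using cInf_lessD[OF ne] by blast
      show ?thesis using t(2) by (intro up[OF t(1)]) linarith
    qed
    have "(\<lambda>n. s + 1 / real (Suc n)) \<longlonglongrightarrow> s + 0"
      by (intro tendsto_intros LIMSEQ_Suc[OF lim_1_over_n])
    then have "(\<lambda>n. x /\<^sub>R (s + 1 / real (Suc n))) \<longlonglongrightarrow> x /\<^sub>R s"
      using s by (intro tendsto_intros) auto
    then show ?thesis by (rule closed_sequentially[OF conv(3) *])
  qed
qed

text \<open>Gauges are compared with positive numbers only, since \<open>mgauge_le_iff\<close>
  divides by \<open>s\<close>. If \<open>a\<close> and \<open>b\<close> differ, their mean is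
  positive and separates them.\<close>

lemma eq_if_le_iff:
  fixes a b :: real
  assumes "a \<ge> 0" "b \<ge> 0" "\<And>s. s > 0 \<Longrightarrow> a \<le> s \<longleftrightarrow> b \<le> s"
  shows "a = b"
  using assms(1,2) assms(3)[of "(a + b) / 2"] by (cases "a + b > 0") auto

context
  fixes V :: "'a::euclidean_space set" and P
  assumes V: "subspace V" and P: "P \<in> sym_convex_bodies V"
begin

lemma mgauge_nonneg: "x \<in> V \<Longrightarrow> mgauge P x \<ge> 0"
  unfolding mgauge_def using mgauge_set_nonempty[OF V P] by (intro cInf_greatest) auto

lemma mgauge_le_1_iff: "x \<in> V \<Longrightarrow> mgauge P x \<le> 1 \<longleftrightarrow> x \<in> P"
  using mgauge_le_iff[OF V P, of x 1] by simp

lemma mgauge_scale_pos: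
  assumes x: "x \<in> V" and c: "c > 0"
  shows "mgauge P (c *\<^sub>R x) = c * mgauge P x"
proof -
  have *: "mgauge P (c *\<^sub>R x) \<le> s \<longleftrightarrow> c * mgauge P x \<le> s" if s: "s > 0" for s
  proof -
    have "mgauge P (c *\<^sub>R x) \<le> s \<longleftrightarrow> x /\<^sub>R (s / c) \<in> P"
      using s c x V by (subst mgauge_le_iff[OF V P]) (auto simp: subspace_scale field_simps)
    also have "\<dots> \<longleftrightarrow> mgauge P x \<le> s / c"
      using s c x by (subst mgauge_le_iff[OF V P]) auto
    finally show ?thesis using c by (simp add: field_simps)
  qed
  show ?thesis using x c V * by (intro eq_if_le_iff) (auto simp: mgauge_nonneg subspace_scale)
qed

lemma mgauge_minus: "x \<in> V \<Longrightarrow> mgauge P (- x) = mgauge P x"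
  using P V unfolding mgauge_def sym_convex_bodies_iff[OF V]
  by (metis (no_types, lifting) minus_minus scaleR_minus_right)

lemma mgauge_pos:
  assumes "x \<in> V" "x \<noteq> 0" shows "mgauge P x > 0"
proof (rule ccontr)
  assume "\<not> mgauge P x > 0"
  then have z: "mgauge P x \<le> s" if "s > 0" for s using that by simp
  obtain b where b: "b > 0" "\<And>x. x \<in> P \<Longrightarrow> norm x \<le> b"
    using sym_convex_bodies_bound[OF P] by metis
  have "x /\<^sub>R (norm x / (2 * b)) \<in> P"
    using z[of "norm x / (2*b)"] assms b by (subst mgauge_le_iff[OF V P, symmetric]) auto
  then have "norm (x /\<^sub>R (norm x / (2 * b))) \<le> b" using b by blast
  then show False using b(1) assms by (simp add: field_simps)
qed

lemma mgauge_0: "mgauge P 0 = 0"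
proof -
  have "mgauge P 0 \<le> s" if "s > 0" for s
    using that mgauge_le_iff[OF V P subspace_0[OF V] that] sym_convex_bodies_zero[OF V P] by simp
  then show ?thesis using subspace_0[OF V] by (intro eq_if_le_iff) (auto simp: mgauge_nonneg)
qed

lemma mgauge_scale:
  assumes "x \<in> V" shows "mgauge P (c *\<^sub>R x) = \<bar>c\<bar> * mgauge P x"
proof -
  consider "c = 0" | "c > 0" | "c < 0" by linarith
  then show ?thesis
  proof cases
    case 3
    have "mgauge P (c *\<^sub>R x) = mgauge P ((- c) *\<^sub>R x)"
      using mgauge_minus[of "c *\<^sub>R x"] assms V by (simp add: subspace_scale)
    also have "\<dots> = - c * mgauge P x" using 3 assms by (intro mgauge_scale_pos) auto
    finally show ?thesis using 3 by simp
  qed (auto simp: mgauge_0 mgauge_scale_pos assms)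
qed

lemma mgauge_normalized:
  assumes "x \<in> V" "x \<noteq> 0" shows "x /\<^sub>R mgauge P x \<in> P"
  using mgauge_le_iff[OF V P assms(1) mgauge_pos[OF assms]] by simp

lemma mgauge_triangle:
  assumes "x \<in> V" "y \<in> V" shows "mgauge P (x + y) \<le> mgauge P x + mgauge P y"
proof (cases "x = 0 \<or> y = 0")
  case True then show ?thesis by (auto simp: mgauge_0)
next
  case False
  let ?a = "mgauge P x" and ?b = "mgauge P y"
  have p: "?a > 0" "?b > 0" using False assms by (auto simp: mgauge_pos)
  have cP: "convex P" using P V by (simp add: sym_convex_bodies_iff)
  have "?a/(?a+?b) + ?b/(?a+?b) = 1" using p by (simp add: add_divide_distrib[symmetric])
  then have "(?a/(?a+?b)) *\<^sub>R (x /\<^sub>R ?a) + (?b/(?a+?b)) *\<^sub>R (y /\<^sub>R ?b) \<in> P"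
    using p False assms mgauge_normalized by (intro convexD[OF cP]) auto
  then have "(x + y) /\<^sub>R (?a + ?b) \<in> P"
    using p by (simp add: field_simps scaleR_add_right)
  then show ?thesis using mgauge_le_iff[OF V P subspace_add[OF V assms], of "?a+?b"] p by simp
qed

lemma mgauge_bounds:
  obtains a b where "a > 0" "b > 0" "\<And>x. x \<in> V \<Longrightarrow> a * norm x \<le> mgauge P x"
     "\<And>x. x \<in> V \<Longrightarrow> mgauge P x \<le> b * norm x"
proof -
  obtain r where r: "r > 0" "\<And>x. x \<in> V \<Longrightarrow> norm x \<le> r \<Longrightarrow> x \<in> P"
    using sym_convex_bodies_inner[OF V P] by metis
  obtain b where b: "b > 0" "\<And>x. x \<in> P \<Longrightarrow> norm x \<le> b"
    using sym_convex_bodies_bound[OF P] by metis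
  have "1/b * norm x \<le> mgauge P x \<and> mgauge P x \<le> 1/r * norm x" if x: "x \<in> V" for x
  proof (cases "x = 0")
    case True then show ?thesis by (simp add: mgauge_0)
  next
    case False
    have "norm (x /\<^sub>R mgauge P x) \<le> b" using b mgauge_normalized[OF x False] by blast
    moreover have "x /\<^sub>R (norm x / r) \<in> P" using r False x V by (intro r) (auto simp: subspace_scale)
    then have "mgauge P x \<le> norm x / r" using mgauge_le_iff[OF V P x] False r by simp
    ultimately show ?thesis using b(1) mgauge_pos[OF x False] by (simp add: field_simps)
  qed
  then show ?thesis using that[of "1/b" "1/r"] r b by auto
qed

end

lemma mgauge_antimono:
  fixes V :: "'a::euclidean_space set"
  assumes V: "subspace V" and P: "P \<in> sym_convex_bodies V" and R: "R \<in> sym_convex_bodies V"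
    and sub: "P \<subseteq> (\<lambda>x. c *\<^sub>R x) ` R" and c: "c > 0" and x: "x \<in> V"
  shows "mgauge R x \<le> c * mgauge P x"
proof (cases "x = 0")
  case True then show ?thesis by (simp add: mgauge_0[OF V P] mgauge_0[OF V R])
next
  case False
  have "x /\<^sub>R mgauge P x \<in> (\<lambda>x. c *\<^sub>R x) ` R" using mgauge_normalized[OF V P x False] sub by auto
  then obtain y where y: "y \<in> R" "x /\<^sub>R mgauge P x = c *\<^sub>R y" by blast
  then have "y = (x /\<^sub>R mgauge P x) /\<^sub>R c" using c by simp
  then have "x /\<^sub>R (c * mgauge P x) \<in> R" using y(1) by simp
  then show ?thesis
    using c mgauge_le_iff[OF V R x, of "c * mgauge P x"] mgauge_pos[OF V P x False] by simp
qed

lemma mgauge_linear_image: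
  assumes "linear T" "inj_on T V" "subspace V" "P \<subseteq> V" "x \<in> V"
  shows "mgauge (T ` P) (T x) = mgauge P x"
proof -
  have "T x /\<^sub>R s \<in> T ` P \<longleftrightarrow> x /\<^sub>R s \<in> P" for s
    using inj_on_image_mem_iff[OF assms(2) _ assms(4), of "x /\<^sub>R s"] assms
    by (simp add: linear_scale subspace_scale)
  then show ?thesis by (simp add: mgauge_def)
qed

text \<open>The triangle inequality and the upper bound make \<open>\<nu>\<close> Lipschitz on
  \<open>V\<close>, hence its unit ball closed. The lower bound makes the ball bounded, the upper
  bound puts a Euclidean ball inside it.\<close>

lemma norm_ball_sym_convex_body:
  fixes V :: "'a::euclidean_space set" and \<nu> :: "'a \<Rightarrow> real"
  assumes V: "subspace V"
    and tri: "\<And>x y. x \<in> V \<Longrightarrow> y \<in> V \<Longrightarrow> \<nu> (x + y) \<le> \<nu> x + \<nu> y"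
    and sc: "\<And>c x. x \<in> V \<Longrightarrow> \<nu> (c *\<^sub>R x) = \<bar>c\<bar> * \<nu> x"
    and lo: "a > 0" "\<And>x. x \<in> V \<Longrightarrow> a * norm x \<le> \<nu> x"
    and up: "\<And>x. x \<in> V \<Longrightarrow> \<nu> x \<le> b * norm x"
  shows "{x \<in> V. \<nu> x \<le> 1} \<in> sym_convex_bodies V"
proof -
  have b: "\<bar>b\<bar> * norm x \<ge> \<nu> x" if "x \<in> V" for x
    using up[OF that] by (smt (verit) mult_right_mono norm_ge_zero)
  have "closed {x \<in> V. \<nu> x \<le> 1}"
    unfolding closed_sequential_limits
  proof (intro allI impI)
    fix X l assume X: "(\<forall>n. X n \<in> {x \<in> V. \<nu> x \<le> 1}) \<and> X \<longlonglongrightarrow> l"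
    have l: "l \<in> V" using X closed_subspace[OF V] closed_sequentially[of V X l] by auto
    have "\<nu> l \<le> 1 + \<bar>b\<bar> * norm (l - X n)" for n
    proof -
      have "\<nu> (X n + (l - X n)) \<le> \<nu> (X n) + \<nu> (l - X n)"
        using X l V by (intro tri) (auto simp: subspace_diff)
      also have "\<nu> (l - X n) \<le> \<bar>b\<bar> * norm (l - X n)"
        using X l V by (intro b) (auto simp: subspace_diff)
      moreover have "\<nu> (X n) \<le> 1" using X by auto
      ultimately show ?thesis by simp
    qed
    moreover have "(\<lambda>n. 1 + \<bar>b\<bar> * norm (l - X n)) \<longlonglongrightarrow> 1 + \<bar>b\<bar> * norm (l - l)"
      using X by (intro tendsto_intros) auto
    ultimately have "\<nu> l \<le> 1 + \<bar>b\<bar> * norm (l - l)" by (intro LIMSEQ_le_const) auto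
    with l show "l \<in> {x \<in> V. \<nu> x \<le> 1}" by simp
  qed
  moreover have "bounded {x \<in> V. \<nu> x \<le> 1}"
    unfolding bounded_iff using lo
    by (intro exI[of _ "1/a"]) (auto simp: field_simps intro: order_trans)
  ultimately have "compact {x \<in> V. \<nu> x \<le> 1}" by (simp add: compact_eq_bounded_closed)
  moreover have "convex {x \<in> V. \<nu> x \<le> 1}"
  proof (rule convexI)
    fix x y u v assume xy: "x \<in> {x \<in> V. \<nu> x \<le> 1}" "y \<in> {x \<in> V. \<nu> x \<le> 1}"
      and uv: "0 \<le> (u::real)" "0 \<le> v" "u + v = 1"
    have "\<nu> (u *\<^sub>R x + v *\<^sub>R y) \<le> u * \<nu> x + v * \<nu> y"
      using tri[of "u *\<^sub>R x" "v *\<^sub>R y"] sc xy uv V by (auto simp: subspace_scale)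
    also have "\<dots> \<le> u * 1 + v * 1" using xy uv by (intro add_mono mult_left_mono) auto
    finally show "u *\<^sub>R x + v *\<^sub>R y \<in> {x \<in> V. \<nu> x \<le> 1}"
      using xy uv V by (auto simp: subspace_scale subspace_add)
  qed
  moreover have "- x \<in> {x \<in> V. \<nu> x \<le> 1}" if "x \<in> {x \<in> V. \<nu> x \<le> 1}" for x
    using that sc[of x "-1"] V by (auto simp: subspace_neg)
  moreover have "\<exists>r>0. \<forall>x\<in>V. norm x \<le> r \<longrightarrow> x \<in> {x \<in> V. \<nu> x \<le> 1}"
  proof (intro exI[of _ "1 / (\<bar>b\<bar> + 1)"] conjI ballI impI)
    fix x assume x: "x \<in> V" "norm x \<le> 1 / (\<bar>b\<bar> + 1)"
    have "\<nu> x \<le> (\<bar>b\<bar> + 1) * norm x" using b[OF x(1)] by (simp add: distrib_right add_increasing2)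
    also have "\<dots> \<le> 1" using x by (simp add: field_simps)
    finally show "x \<in> {x \<in> V. \<nu> x \<le> 1}" using x by simp
  qed auto
  ultimately show ?thesis by (subst sym_convex_bodies_iff[OF V]) auto
qed

text \<open>The inner ball of the image comes from a bounded left inverse \<open>g\<close> of
  \<open>f\<close> on \<open>L\<close>: a radius \<open>r\<close> in \<open>L\<close> becomes
  \<open>r / B\<close> in the image of \<open>L\<close>.\<close>

lemma sym_convex_bodies_linear_image:
  fixes f :: "'a::euclidean_space \<Rightarrow> 'b::euclidean_space"
  assumes L: "subspace L" and P: "P \<in> sym_convex_bodies L" and f: "linear f" "inj_on f L"
  shows "f ` P \<in> sym_convex_bodies (f ` L)"
proof -
  have P': "P \<subseteq> L" "compact P" "convex P" "\<forall>x\<in>P. - x \<in> P"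
    using P by (auto simp: sym_convex_bodies_iff[OF L])
  obtain r where r: "r > 0" "\<And>x. x \<in> L \<Longrightarrow> norm x \<le> r \<Longrightarrow> x \<in> P"
    using sym_convex_bodies_inner[OF L P] by metis
  obtain g where g: "linear g" "\<And>x. x \<in> L \<Longrightarrow> g (f x) = x"
    using linear_exists_left_inverse_on[OF f(1) L f(2)] by blast
  obtain B where B: "B > 0" "\<And>y. norm (g y) \<le> B * norm y"
    using linear_bounded_pos[OF g(1)] by blast
  have "y \<in> f ` P" if y: "y \<in> f ` L" "norm y \<le> r / B" for y
  proof -
    obtain x where x: "x \<in> L" "y = f x" using y by blast
    have "norm x \<le> B * norm y" using B(2)[of y] g(2) x by simp
    also have "\<dots> \<le> r" using y(2) B(1) by (simp add: field_simps)
    finally show ?thesis using r(2)[OF x(1)] x by blast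
  qed
  moreover have "compact (f ` P)"
    using P'(2) f(1) by (intro compact_continuous_image linear_continuous_on) (auto simp: linear_linear)
  moreover have "\<forall>x\<in>f ` P. - x \<in> f ` P"
    using P'(4) by (auto simp: linear_neg[OF f(1), symmetric])
  moreover have "\<exists>r>0. \<forall>y\<in>f ` L. norm y \<le> r \<longrightarrow> y \<in> f ` P"
    using calculation(1) r(1) B(1) by (intro exI[of _ "r / B"]) auto
  ultimately show ?thesis
    using P' convex_linear_image[OF f(1)]
    by (subst sym_convex_bodies_iff[OF linear_subspace_image[OF f(1) L]]) auto
qed

subsection \<open>Elementary tensors\<close>

lemma subspace_tensor_space: "subspace (tensor_space K)"
  by (simp add: tensor_space_def subspace_coord_space)

lemma tens_upd_nth: "tens (x(i := y)) $ f = y $ f i * (\<Prod>j\<in>UNIV - {i}. x j $ f j)"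
proof -
  have "tens (x(i := y)) $ f = (\<Prod>j\<in>UNIV. (x(i := y)) j $ f j)" by (simp add: tens_def)
  also have "\<dots> = (x(i := y)) i $ f i * (\<Prod>j\<in>UNIV - {i}. (x(i := y)) j $ f j)"
    by (rule prod.remove) auto
  also have "(\<Prod>j\<in>UNIV - {i}. (x(i := y)) j $ f j) = (\<Prod>j\<in>UNIV - {i}. x j $ f j)"
    by (rule prod.cong) auto
  finally show ?thesis by (simp only: fun_upd_same)
qed

lemma linear_tens_upd: "linear (\<lambda>y. tens (x(i := y)))"
  by (rule linearI) (auto simp: vec_eq_iff tens_upd_nth distrib_right)

lemma tens_scale: "tens (\<lambda>i. c i *\<^sub>R x i) = (\<Prod>i\<in>UNIV. c i) *\<^sub>R tens x"
  by (simp add: tens_def vec_eq_iff prod.distrib)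

lemma tens_upd_scale: "tens (x(i := c *\<^sub>R y)) = c *\<^sub>R tens (x(i := y))"
  by (rule linear_scale[OF linear_tens_upd])

lemma tens_eq_0_iff: "tens x = 0 \<longleftrightarrow> (\<exists>i. x i = 0)"
proof -
  have "tens x = 0 \<longleftrightarrow> tens x \<bullet> tens x = 0" by simp
  also have "\<dots> \<longleftrightarrow> (\<exists>i. x i = 0)" by (simp add: inner_tens)
  finally show ?thesis .
qed

lemma tens_in_decomposables: "(\<And>i. x i \<in> coord_space (K i)) \<Longrightarrow> tens x \<in> decomposables K"
  by (auto simp: decomposables_def)

lemma tens_in_tensor_space: "(\<And>i. x i \<in> coord_space (K i)) \<Longrightarrow> tens x \<in> tensor_space K"
  using decomposables_subset tens_in_decomposables by blast

lemma decomposables_scale: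
  assumes "z \<in> decomposables K" shows "c *\<^sub>R z \<in> decomposables K"
proof -
  obtain x where x: "z = tens x" "\<forall>i. x i \<in> coord_space (K i)"
    using assms by (auto simp: decomposables_def)
  fix i
  have "c *\<^sub>R z = tens (x(i := c *\<^sub>R x i))" by (simp add: tens_upd_scale x)
  with x show ?thesis
    by (auto intro!: tens_in_decomposables simp: subspace_scale subspace_coord_space)
qed

lemma zero_in_decomposables: "0 \<in> decomposables K"
proof -
  have "tens (\<lambda>i. 0) \<in> decomposables K"
    by (rule tens_in_decomposables) (simp add: subspace_0 subspace_coord_space)
  then show ?thesis by (metis tens_eq_0_iff)
qed

text \<open>With the \<open>i\<close>-th index as row and the other indices as column, these are the
  2 by 2 minors of the array. They vanish because each such flattening of a decomposable tensor has
  rank at most one.\<close>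

lemma decomposables_minor:
  assumes "z \<in> decomposables K"
  shows "z $ f * z $ g = z $ (f(i := g i)) * z $ (g(i := f i))"
proof -
  obtain x where x: "z = tens x" using assms by (auto simp: decomposables_def)
  have *: "z $ h = x i $ h i * (\<Prod>j\<in>UNIV - {i}. x j $ h j)" for h
    using tens_upd_nth[of x i "x i" h] by (simp add: x)
  have **: "(\<Prod>j\<in>UNIV - {i}. x j $ (h(i := a)) j) = (\<Prod>j\<in>UNIV - {i}. x j $ h j)" for h a
    by (rule prod.cong) auto
  show ?thesis unfolding *[of f] *[of g] *[of "f(i := g i)"] *[of "g(i := f i)"] ** by simp
qed

text \<open>Expansion from a nonzero entry at \<open>a\<close>: the lines of the array through
  \<open>a\<close>, divided by that entry, serve as factors, and the minors allow the indices of
  \<open>a\<close> to be replaced by those of \<open>f\<close> one place at a time.\<close>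

lemma decomposables_if_minors:
  assumes z: "z \<in> tensor_space K"
    and m: "\<And>f g i. z $ f * z $ g = z $ (f(i := g i)) * z $ (g(i := f i))"
  shows "z \<in> decomposables K"
proof (cases "z = 0")
  case True then show ?thesis by (simp add: zero_in_decomposables)
next
  case False
  then obtain a where a: "z $ a \<noteq> 0" by (auto simp: vec_eq_iff)
  then have aK: "a i \<in> K i" for i
    using z by (auto simp: tensor_space_def coord_space_def Pi_def)
  define x :: "'a \<Rightarrow> real ^ 'b" where "x = (\<lambda>i. \<chi> j. z $ (a(i := j)) / z $ a)"
  have *: "z $ (override_on a f S) = z $ a * (\<Prod>i\<in>S. x i $ f i)" for S f
  proof (induction S rule: infinite_finite_induct)
    case (insert i S)
    let ?h = "override_on a f S"
    have "z $ (?h(i := f i)) * z $ a = z $ ?h * z $ (a(i := f i))"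
      using m[of "?h(i := f i)" a i] insert(2)
      by (simp add: override_on_apply_notin fun_upd_idem)
    moreover have "override_on a f (insert i S) = ?h(i := f i)"
      by (auto simp: override_on_def)
    ultimately have "z $ (override_on a f (insert i S)) * z $ a = z $ ?h * z $ (a(i := f i))"
      by (simp only:)
    then show ?case
      using insert a by (simp only: insert(3)) (simp add: x_def field_simps)
  qed auto
  have "override_on a f UNIV = f" for f by (simp add: override_on_def)
  then have "z $ f = (z $ a *\<^sub>R tens x) $ f" for f
    using *[of f UNIV] by (simp only: tens_def vector_scaleR_component vec_lambda_beta real_scaleR_def)
  then have "z = z $ a *\<^sub>R tens x" by (blast intro: vec_eq_iff[THEN iffD2])
  moreover have "x i \<in> coord_space (K i)" for i
  proof -
    have "z $ (a(i := j)) = 0" if "j \<notin> K i" for j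
    proof -
      have "a(i := j) \<notin> Pi UNIV K" using that by (metis PiE UNIV_I fun_upd_same)
      then show ?thesis using z unfolding tensor_space_def coord_space_def by blast
    qed
    then show ?thesis by (simp add: x_def coord_space_def)
  qed
  ultimately show ?thesis using tens_in_decomposables decomposables_scale by metis
qed

subsection \<open>The group of decomposability preserving maps\<close>

text \<open>The quadratic forms vanishing on the decomposable tensors cut them out, and pulling back by
  an invertible map that preserves decomposability is an injection of the finite-dimensional space
  of these forms into itself, hence a bijection.\<close>

lemma linear_bij_preserving_decomposables:
  fixes T :: "real ^ ('l::finite \<Rightarrow> 'k::finite) \<Rightarrow> real ^ ('l \<Rightarrow> 'k)"
  assumes T: "linear T" "inj T" "T ` decomposables K \<subseteq> decomposables K"
    and w: "w \<in> tensor_space K" "T w \<in> decomposables K"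
  shows "w \<in> decomposables K"
proof -
  define I where "I = {A :: real^('l \<Rightarrow> 'k)^('l \<Rightarrow> 'k). \<forall>z\<in>decomposables K. z \<bullet> (A *v z) = 0}"
  define M where "M = matrix T"
  have TM: "T x = M *v x" for x by (simp add: M_def T(1))
  \<comment> \<open>The pullback of a quadratic form along \<open>T\<close>, in terms of matrices.
    \<open>I\<close> consists of all matrices whose form vanishes on the decomposable tensors,
    symmetric or not.\<close>
  define \<Phi> where "\<Phi> = (\<lambda>A. transpose M ** A ** M)"
  have \<Phi>: "x \<bullet> (\<Phi> A *v x) = T x \<bullet> (A *v T x)" for x A
    unfolding \<Phi>_def TM matrix_vector_mul_assoc[symmetric]
    by (metis dot_lmul_matrix vector_transpose_matrix transpose_transpose inner_commute)
  have rd: "(A + B) ** C = A ** C + B ** C" for A B C :: "real^('l \<Rightarrow> 'k)^('l \<Rightarrow> 'k)"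
    by (simp add: matrix_matrix_mult_def vec_eq_iff distrib_right sum.distrib)
  have lin: "linear \<Phi>"
    unfolding \<Phi>_def
    by (rule linearI) (auto simp: matrix_add_ldistrib rd scalar_matrix_assoc matrix_scalar_ac)
  have sub: "subspace I"
    by (auto simp: I_def subspace_def matrix_vector_mult_add_rdistrib inner_add_right
        scaleR_matrix_vector_assoc[symmetric])
  obtain M' where M': "M ** M' = mat 1" "M' ** M = mat 1"
    using T(2) TM matrix_left_invertible_injective[of M] matrix_left_right_inverse
    by (metis (no_types, lifting) ext)
  have inj: "inj \<Phi>"
  proof (rule injI)
    fix A B assume "\<Phi> A = \<Phi> B"
    then have "transpose M' ** (transpose M ** A ** M) ** M' = transpose M' ** (transpose M ** B ** M) ** M'"
      by (simp add: \<Phi>_def)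
    moreover have "transpose M' ** (transpose M ** A ** M) ** M' = A" for A
    proof -
      have "transpose M' ** (transpose M ** A ** M) ** M' = (transpose M' ** transpose M) ** A ** (M ** M')"
        by (simp add: matrix_mul_assoc)
      then show ?thesis by (simp add: M' matrix_transpose_mul[symmetric])
    qed
    ultimately show "A = B" by simp
  qed
  have PI: "\<Phi> ` I \<subseteq> I" using T(3) by (auto simp: I_def \<Phi>)
  have "dim (\<Phi> ` I) = dim I"
    using lin inj by (intro dim_image_eq) (auto intro: inj_on_subset)
  then have eq: "\<Phi> ` I = I"
    by (intro subspace_dim_equal[OF linear_subspace_image[OF lin sub] sub PI]) (rule eq_imp_le[OF sym])
  have "w \<bullet> (A *v w) = 0" if "A \<in> I" for A
  proof -
    have "A \<in> \<Phi> ` I" unfolding eq by (rule that)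
    then obtain B where B: "B \<in> I" "A = \<Phi> B" by (rule imageE)
    have "T w \<bullet> (B *v T w) = 0" using B(1) w(2) unfolding I_def by blast
    then show ?thesis by (simp only: B(2) \<Phi>)
  qed
  note w0 = this
  show ?thesis
  proof (rule decomposables_if_minors[OF w(1)])
    fix f g :: "'l \<Rightarrow> 'k" and i
    define f' where "f' = f(i := g i)"
    define g' where "g' = g(i := f i)"
    \<comment> \<open>The elementary matrix \<open>E f g\<close> has the quadratic form
      \<open>z $ f * z $ g\<close>, so that every minor is the form of a matrix in
      \<open>I\<close>.\<close>
    define E where "E = (\<lambda>f g. (\<chi> a b. if a = f \<and> b = g then 1 else 0) :: real^('l \<Rightarrow> 'k)^('l \<Rightarrow> 'k))"
    have E: "z \<bullet> (E f g *v z) = z $ f * z $ g" for z f g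
    proof -
      have "(E f g *v z) $ a = (if a = f then z $ g else 0)" for a
      proof -
        have "(E f g *v z) $ a = (\<Sum>b\<in>UNIV. if b = g then (if a = f then z $ g else 0) else 0)"
          unfolding E_def matrix_vector_mult_def vec_lambda_beta by (rule sum.cong) auto
        then show ?thesis by simp
      qed
      then have "z \<bullet> (E f g *v z) = (\<Sum>a\<in>UNIV. if a = f then z $ f * z $ g else 0)"
        unfolding inner_vec_def by (intro sum.cong) auto
      then show ?thesis by simp
    qed
    have EE: "z \<bullet> ((E f g - E f' g') *v z) = z $ f * z $ g - z $ f' * z $ g'" for z
      by (simp add: matrix_vector_mult_diff_rdistrib inner_diff_right E)
    have "E f g - E f' g' \<in> I"
      unfolding I_def mem_Collect_eq EE using decomposables_minor[of _ K f g i] by (auto simp: f'_def g'_def)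
    from w0[OF this] show "w $ f * w $ g = w $ (f(i := g i)) * w $ (g(i := f i))"
      unfolding EE unfolding f'_def g'_def by simp
  qed
qed

text \<open>The group is defined by one inclusion of the decomposable tensors; the converse obtained
  here is what makes it closed under inverses.\<close>

lemma GL_tensor_mem_decomposables_iff:
  assumes T: "T \<in> GL_tensor K" and z: "z \<in> tensor_space K"
  shows "T z \<in> decomposables K \<longleftrightarrow> z \<in> decomposables K"
proof
  let ?V = "tensor_space K"
  have lT: "linear T" and bT: "bij_betw T ?V ?V" and dT: "T ` decomposables K \<subseteq> decomposables K"
    using T by (auto simp: GL_tensor_def)
  show "T z \<in> decomposables K" if "z \<in> decomposables K" using that dT by auto
  define p :: "real ^ ('a \<Rightarrow> 'b) \<Rightarrow> real ^ ('a \<Rightarrow> 'b)"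
    where "p = (\<lambda>x. \<chi> f. if f \<in> Pi UNIV K then x $ f else 0)"
  have lp: "linear p" by (rule linearI) (auto simp: p_def vec_eq_iff)
  have pV: "p x \<in> ?V" for x by (simp add: p_def tensor_space_def coord_space_def)
  have p_id: "p x = x" if "x \<in> ?V" for x
    using that by (auto simp: p_def tensor_space_def coord_space_def vec_eq_iff)
  \<comment> \<open>\<open>T\<close> is controlled on \<open>tensor_space K\<close> only.
    \<open>S\<close> agrees with it there and is the identity on the complementary coordinates,
    hence injective on the whole type.\<close>
  define S where "S = (\<lambda>x. T (p x) + (x - p x))"
  have lS: "linear S"
    unfolding S_def
    by (intro linear_compose_add linear_compose_sub lp linear_ident linear_compose[OF lp lT, unfolded o_def])
  have S_T: "S x = T x" if "x \<in> ?V" for x by (simp add: S_def p_id that)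
  have "inj S"
    unfolding linear_injective_0[OF lS]
  proof (intro allI impI)
    fix x assume x: "S x = 0"
    have "p (S x) = T (p x) + (p x - p (p x))"
      unfolding S_def using pV bT
      by (simp add: linear_add[OF lp] linear_diff[OF lp] p_id bij_betwE)
    then have "T (p x) = T 0" using x by (simp add: p_id pV linear_0[OF lp] linear_0[OF lT])
    then have px: "p x = 0"
      using bT pV subspace_0[OF subspace_tensor_space] by (metis bij_betw_def inj_onD)
    with x show "x = 0" by (simp add: S_def linear_0[OF lT])
  qed
  moreover have "S ` decomposables K \<subseteq> decomposables K"
  proof clarify
    fix y assume y: "y \<in> decomposables K"
    then have "S y = T y" using S_T decomposables_subset by (metis subsetD)
    with y dT show "S y \<in> decomposables K" by auto
  qed
  ultimately show "z \<in> decomposables K" if "T z \<in> decomposables K"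
    using linear_bij_preserving_decomposables[OF lS _ _ z] that S_T[OF z] by simp
qed

lemma GL_tensor_compose:
  assumes "S \<in> GL_tensor K" "T \<in> GL_tensor K" shows "S \<circ> T \<in> GL_tensor K"
  using assms by (auto simp: GL_tensor_def linear_compose bij_betw_trans image_comp[symmetric])

lemma GL_tensor_scale:
  assumes "c \<noteq> 0" shows "(\<lambda>x. c *\<^sub>R x) \<in> GL_tensor K"
proof -
  have "bij_betw (\<lambda>x. c *\<^sub>R x) (tensor_space K) (tensor_space K)"
    using assms
    by (intro bij_betwI[of _ _ _ "\<lambda>x. x /\<^sub>R c"]) (auto simp: subspace_scale subspace_tensor_space)
  moreover have "linear (\<lambda>x. c *\<^sub>R x :: real ^ ('a \<Rightarrow> 'b))"
    by (rule linearI) (auto simp: scaleR_add_right)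
  ultimately show ?thesis by (auto simp: GL_tensor_def decomposables_scale)
qed

text \<open>The inverse is one on \<open>tensor_space K\<close>, where alone the elements of the
  group are required to be bijective.\<close>

lemma GL_tensor_inverse:
  assumes T: "T \<in> GL_tensor K"
  obtains S where "S \<in> GL_tensor K" "\<And>x. x \<in> tensor_space K \<Longrightarrow> S (T x) = x"
    "\<And>x. x \<in> tensor_space K \<Longrightarrow> T (S x) = x"
proof -
  let ?V = "tensor_space K"
  have lT: "linear T" and bT: "bij_betw T ?V ?V" using T by (auto simp: GL_tensor_def)
  obtain S where S: "range S \<subseteq> ?V" "linear S" "\<And>x. x \<in> ?V \<Longrightarrow> S (T x) = x"
    using linear_exists_left_inverse_on[OF lT subspace_tensor_space] bT
    by (metis bij_betw_def)
  have TS: "T (S x) = x" if "x \<in> ?V" for x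
    using that bT S(3) by (metis bij_betw_def imageE)
  have "bij_betw S ?V ?V"
    using S TS bT by (intro bij_betwI[of _ _ _ T]) (auto simp: bij_betwE)
  moreover have "S ` decomposables K \<subseteq> decomposables K"
  proof clarify
    fix z assume z: "z \<in> decomposables K"
    then have "S z \<in> ?V" "T (S z) = z" using S(1) TS decomposables_subset by blast+
    with z show "S z \<in> decomposables K" using GL_tensor_mem_decomposables_iff[OF T, of "S z"] by simp
  qed
  ultimately have "S \<in> GL_tensor K" using S by (simp add: GL_tensor_def)
  then show ?thesis by (rule that[OF _ S(3) TS])
qed

lemma GL_tensor_image_decomposables:
  assumes "T \<in> GL_tensor K" shows "T ` decomposables K = decomposables K"
proof -
  obtain S where "S \<in> GL_tensor K" "\<And>x. x \<in> tensor_space K \<Longrightarrow> S (T x) = x"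
    "\<And>x. x \<in> tensor_space K \<Longrightarrow> T (S x) = x"
    using GL_tensor_inverse[OF assms] by metis
  note S = this
  show ?thesis
  proof
    show "T ` decomposables K \<subseteq> decomposables K" using assms by (simp add: GL_tensor_def)
    show "decomposables K \<subseteq> T ` decomposables K"
    proof
      fix z assume z: "z \<in> decomposables K"
      then have "S z \<in> decomposables K" using S(1) by (auto simp: GL_tensor_def)
      then show "z \<in> T ` decomposables K"
        using z S(3) decomposables_subset by (metis image_eqI subsetD)
    qed
  qed
qed


subsection \<open>The Banach--Mazur metric\<close>

text \<open>Symmetry and multiplicativity hold already for single admissible factors; separating the
  set from its infimum postpones the limits.\<close>

definition bm_factors ::
  "('l::finite \<Rightarrow> 'k::finite set) \<Rightarrow> (real ^ ('l \<Rightarrow> 'k)) set \<Rightarrow> (real ^ ('l \<Rightarrow> 'k)) set \<Rightarrow> real set" where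
  "bm_factors K P R = {c. 1 \<le> c \<and> (\<exists>T\<in>GL_tensor K. R \<subseteq> T ` P \<and> T ` P \<subseteq> (\<lambda>x. c *\<^sub>R x) ` R)}"

lemma tensor_BM_dist_eq: "tensor_BM_dist K P R = Inf (bm_factors K P R)"
  by (simp add: tensor_BM_dist_def bm_factors_def)

lemma tensorial_bodies_sym_convex:
  "P \<in> tensorial_bodies K \<Longrightarrow> P \<in> sym_convex_bodies (tensor_space K)"
  by (simp add: tensorial_bodies_def)

lemma tensor_BM_dist_le: "c \<in> bm_factors K P R \<Longrightarrow> tensor_BM_dist K P R \<le> c"
  unfolding tensor_BM_dist_eq
  by (intro cInf_lower bdd_belowI[of _ 1]) (auto simp: bm_factors_def)

lemma body_scale_subset:
  assumes "R \<in> sym_convex_bodies (V :: 'a::euclidean_space set)" "subspace V" "0 < c" "c \<le> d"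
  shows "(\<lambda>x. c *\<^sub>R x) ` R \<subseteq> (\<lambda>x. d *\<^sub>R x) ` R"
proof
  fix y assume "y \<in> (\<lambda>x. c *\<^sub>R x) ` R"
  then obtain x where x: "x \<in> R" "y = c *\<^sub>R x" by blast
  have "(c / d) *\<^sub>R x \<in> R"
    using assms x sym_convex_bodies_zero[OF assms(2,1)]
    by (intro convex_scale_mem) (auto simp: sym_convex_bodies_iff)
  moreover have "y = d *\<^sub>R ((c / d) *\<^sub>R x)" using x assms by simp
  ultimately show "y \<in> (\<lambda>x. d *\<^sub>R x) ` R" by blast
qed

text \<open>Replacing \<open>T\<close> by \<open>a T\<close> brings a two-sided comparison into the
  normal form with \<open>R\<close> inside. Only the product has to be at least 1, so the factor may
  be distributed freely between the two inclusions.\<close>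

lemma bm_factors_scaled:
  assumes T: "T \<in> GL_tensor K" and ab: "a > 0" "b > 0"
    and R: "R \<subseteq> (\<lambda>x. a *\<^sub>R x) ` T ` P" and P: "T ` P \<subseteq> (\<lambda>x. b *\<^sub>R x) ` R"
    and "a * b \<ge> 1"
  shows "a * b \<in> bm_factors K P R"
proof -
  have "(\<lambda>x. a *\<^sub>R x) \<circ> T \<in> GL_tensor K"
    using GL_tensor_compose[OF GL_tensor_scale T] ab by auto
  moreover have "R \<subseteq> ((\<lambda>x. a *\<^sub>R x) \<circ> T) ` P" using R by (simp add: image_comp)
  moreover have "((\<lambda>x. a *\<^sub>R x) \<circ> T) ` P \<subseteq> (\<lambda>x. (a * b) *\<^sub>R x) ` R"
  proof -
    have "(\<lambda>x. a *\<^sub>R x) ` T ` P \<subseteq> (\<lambda>x. a *\<^sub>R x) ` (\<lambda>x. b *\<^sub>R x) ` R"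
      using P by (rule image_mono)
    then show ?thesis by (simp add: image_comp o_def)
  qed
  ultimately show ?thesis using assms(6) unfolding bm_factors_def by blast
qed

lemma GL_tensor_id: "(\<lambda>x. x) \<in> GL_tensor K"
  using GL_tensor_scale[of 1 K] by simp

lemma body_subset_scaled:
  fixes V :: "'a::euclidean_space set"
  assumes "subspace V" "P \<in> sym_convex_bodies V" "R \<in> sym_convex_bodies V"
  obtains c where "c \<ge> 1" "R \<subseteq> (\<lambda>x. c *\<^sub>R x) ` P"
proof -
  obtain r where r: "r > 0" "\<And>x. x \<in> V \<Longrightarrow> norm x \<le> r \<Longrightarrow> x \<in> P"
    using sym_convex_bodies_inner[OF assms(1,2)] by metis
  obtain b where b: "b > 0" "\<And>x. x \<in> R \<Longrightarrow> norm x \<le> b"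
    using sym_convex_bodies_bound[OF assms(3)] by metis
  define c where "c = max 1 (b / r)"
  have c: "c \<ge> 1" "b \<le> r * c" using r(1) by (auto simp: c_def field_simps max_def)
  have "x \<in> (\<lambda>x. c *\<^sub>R x) ` P" if x: "x \<in> R" for x
  proof (rule image_eqI)
    show "x = c *\<^sub>R (x /\<^sub>R c)" using c by simp
    have "x \<in> V" using x assms(1,3) by (auto simp: sym_convex_bodies_iff)
    moreover have "norm x \<le> r * c" using b(2)[OF x] c by linarith
    ultimately show "x /\<^sub>R c \<in> P"
      using c assms(1) by (intro r(2)) (auto simp: subspace_scale field_simps)
  qed
  then show ?thesis using that c(1) by blast
qed

lemma bm_factors_nonempty:
  assumes "P \<in> sym_convex_bodies (tensor_space K)" "R \<in> sym_convex_bodies (tensor_space K)"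
  shows "bm_factors K P R \<noteq> {}"
proof -
  obtain a where a: "a \<ge> 1" "R \<subseteq> (\<lambda>x. a *\<^sub>R x) ` P"
    using body_subset_scaled[OF subspace_tensor_space assms] by blast
  obtain b where b: "b \<ge> 1" "P \<subseteq> (\<lambda>x. b *\<^sub>R x) ` R"
    using body_subset_scaled[OF subspace_tensor_space assms(2,1)] by blast
  have "1 * 1 \<le> a * b" using a b by (intro mult_mono) auto
  then have "a * b \<in> bm_factors K P R"
    using a b by (intro bm_factors_scaled[OF GL_tensor_id]) auto
  then show ?thesis by blast
qed

context
  fixes K :: "'l::finite \<Rightarrow> 'k::finite set"
begin

lemma tensor_BM_dist_ge_1:
  assumes "P \<in> sym_convex_bodies (tensor_space K)" "R \<in> sym_convex_bodies (tensor_space K)"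
  shows "tensor_BM_dist K P R \<ge> 1"
  unfolding tensor_BM_dist_eq
  by (rule cInf_greatest[OF bm_factors_nonempty[OF assms]]) (auto simp: bm_factors_def)

lemma bm_factors_less:
  assumes "P \<in> sym_convex_bodies (tensor_space K)" "R \<in> sym_convex_bodies (tensor_space K)" "tensor_BM_dist K P R < c"
  obtains d where "d \<in> bm_factors K P R" "d < c"
  using assms bm_factors_nonempty[OF assms(1,2)] unfolding tensor_BM_dist_eq
  by (metis cInf_lessD)

lemma tensor_BM_dist_refl: "P \<in> sym_convex_bodies (tensor_space K) \<Longrightarrow> tensor_BM_dist K P P = 1"
proof -
  assume P: "P \<in> sym_convex_bodies (tensor_space K)"
  have "1 * 1 \<in> bm_factors K P P" by (rule bm_factors_scaled[OF GL_tensor_id]) auto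
  then show ?thesis using tensor_BM_dist_le tensor_BM_dist_ge_1[OF P P] by fastforce
qed

text \<open>The inverse \<open>S\<close> of \<open>T\<close> on the tensor space gives
  \<open>S R \<subseteq> P \<subseteq> c S R\<close>, and rescaling \<open>S\<close> by
  \<open>c\<close> restores the normal form.\<close>

lemma bm_factors_sym:
  assumes "P \<in> sym_convex_bodies (tensor_space K)" "R \<in> sym_convex_bodies (tensor_space K)" "c \<in> bm_factors K P R"
  shows "c \<in> bm_factors K R P"
proof -
  obtain T where T: "T \<in> GL_tensor K" "R \<subseteq> T ` P" "T ` P \<subseteq> (\<lambda>x. c *\<^sub>R x) ` R" and c: "c \<ge> 1"
    using assms(3) by (auto simp: bm_factors_def)
  obtain S where S: "S \<in> GL_tensor K" "\<And>x. x \<in> tensor_space K \<Longrightarrow> S (T x) = x" "\<And>x. x \<in> tensor_space K \<Longrightarrow> T (S x) = x"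
    using GL_tensor_inverse[OF T(1)] by metis
  have lS: "linear S" using S by (simp add: GL_tensor_def)
  have PV: "P \<subseteq> tensor_space K" using assms by (simp add: sym_convex_bodies_def)
  have ST: "S ` T ` P = P" using S(2) PV by (force simp: image_comp)
  have "S ` R \<subseteq> P" using image_mono[OF T(2), of S] ST by simp
  moreover have "P \<subseteq> (\<lambda>x. c *\<^sub>R x) ` S ` R"
    using image_mono[OF T(3), of S] ST by (simp add: image_comp o_def linear_scale[OF lS])
  ultimately have "c * 1 \<in> bm_factors K R P" using c by (intro bm_factors_scaled[OF S(1)]) auto
  then show ?thesis by simp
qed

lemma tensor_BM_dist_sym:
  assumes "P \<in> sym_convex_bodies (tensor_space K)" "R \<in> sym_convex_bodies (tensor_space K)"
  shows "tensor_BM_dist K P R = tensor_BM_dist K R P"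
  unfolding tensor_BM_dist_eq using bm_factors_sym assms by (metis subsetI subset_antisym)

lemma bm_factors_trans:
  assumes "a \<in> bm_factors K P R" "b \<in> bm_factors K R S"
  shows "a * b \<in> bm_factors K P S"
proof -
  obtain T where T: "T \<in> GL_tensor K" "R \<subseteq> T ` P" "T ` P \<subseteq> (\<lambda>x. a *\<^sub>R x) ` R" and a: "a \<ge> 1"
    using assms by (auto simp: bm_factors_def)
  obtain U where U: "U \<in> GL_tensor K" "S \<subseteq> U ` R" "U ` R \<subseteq> (\<lambda>x. b *\<^sub>R x) ` S" and b: "b \<ge> 1"
    using assms by (auto simp: bm_factors_def)
  have lU: "linear U" using U by (simp add: GL_tensor_def)
  have 1: "S \<subseteq> (U \<circ> T) ` P" using U(2) image_mono[OF T(2), of U] by (auto simp: image_comp)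
  have "(U \<circ> T) ` P \<subseteq> (\<lambda>x. a *\<^sub>R x) ` U ` R"
    using image_mono[OF T(3), of U] by (simp add: image_comp o_def linear_scale[OF lU])
  also have "\<dots> \<subseteq> (\<lambda>x. a *\<^sub>R x) ` (\<lambda>x. b *\<^sub>R x) ` S" using U(3) by (rule image_mono)
  also have "\<dots> = (\<lambda>x. (a * b) *\<^sub>R x) ` S" by (simp add: image_comp o_def)
  finally have 2: "(U \<circ> T) ` P \<subseteq> (\<lambda>x. (a * b) *\<^sub>R x) ` S" .
  have "1 * 1 \<le> a * b" using a b by (intro mult_mono) auto
  then show ?thesis unfolding bm_factors_def mem_Collect_eq
    by (intro conjI bexI[OF _ GL_tensor_compose[OF U(1) T(1)]] 1 2) simp
qed

lemma tensor_BM_dist_triangle: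
  assumes "P \<in> sym_convex_bodies (tensor_space K)" "R \<in> sym_convex_bodies (tensor_space K)" "S \<in> sym_convex_bodies (tensor_space K)"
  shows "tensor_BM_dist K P S \<le> tensor_BM_dist K P R * tensor_BM_dist K R S"
proof -
  have ge: "tensor_BM_dist K P R \<ge> 1" "tensor_BM_dist K R S \<ge> 1" using assms tensor_BM_dist_ge_1 by auto
  have 1: "tensor_BM_dist K P S \<le> a * b" if a: "a \<in> bm_factors K P R" and b: "b \<in> bm_factors K R S" for a b
    using tensor_BM_dist_le[OF bm_factors_trans[OF a b]] .
  \<comment> \<open>The two infima are taken one after the other, each after division by the other
    quantity, which is at least 1.\<close>
  have "tensor_BM_dist K P S / b \<le> tensor_BM_dist K P R" if b: "b \<in> bm_factors K R S" for b
    unfolding tensor_BM_dist_eq[of K P R]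
  proof (rule cInf_greatest[OF bm_factors_nonempty[OF assms(1,2)]])
    fix a assume "a \<in> bm_factors K P R"
    from 1[OF this b] b show "tensor_BM_dist K P S / b \<le> a" by (auto simp: bm_factors_def divide_le_eq)
  qed
  then have "tensor_BM_dist K P S / tensor_BM_dist K P R \<le> b" if b: "b \<in> bm_factors K R S" for b
    using b ge by (fastforce simp: bm_factors_def field_simps)
  then have "tensor_BM_dist K P S / tensor_BM_dist K P R \<le> tensor_BM_dist K R S"
    unfolding tensor_BM_dist_eq[of K R S] by (intro cInf_greatest bm_factors_nonempty[OF assms(2,3)])
  then show ?thesis using ge by (simp add: field_simps)
qed

lemma tensor_BM_dist_le_if_scaled_subsets:
  assumes P: "P \<in> sym_convex_bodies (tensor_space K)" and R: "R \<in> sym_convex_bodies (tensor_space K)"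
    and ab: "a \<ge> 1" "b \<ge> 1" "R \<subseteq> (\<lambda>x. a *\<^sub>R x) ` P" "P \<subseteq> (\<lambda>x. b *\<^sub>R x) ` R"
  shows "tensor_BM_dist K P R \<le> a * b"
proof -
  have "1 * 1 \<le> a * b" using ab by (intro mult_mono) auto
  then show ?thesis
    using ab by (intro tensor_BM_dist_le bm_factors_scaled[OF GL_tensor_id]) auto
qed

section \<open>Classes of bodies as a metric space\<close>

definition bm_class :: "(real ^ ('l \<Rightarrow> 'k)) set \<Rightarrow> (real ^ ('l \<Rightarrow> 'k)) set set" where
  "bm_class P = tensor_BM_rel K `` {P}"

text \<open>The same choice as in \<open>BM_tensor_metric\<close>, so that unfolding presents the
  metric as \<open>ln\<close> of the distance of representatives.\<close>

definition bm_rep :: "(real ^ ('l \<Rightarrow> 'k)) set set \<Rightarrow> (real ^ ('l \<Rightarrow> 'k)) set" where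
  "bm_rep C = (SOME P. P \<in> C)"

lemma equiv_tensor_BM_rel: "equiv (tensorial_bodies K) (tensor_BM_rel K)"
proof (rule equivI)
  note sc = tensorial_bodies_sym_convex
  show "tensor_BM_rel K \<subseteq> tensorial_bodies K \<times> tensorial_bodies K"
    by (auto simp: tensor_BM_rel_def)
  show "refl_on (tensorial_bodies K) (tensor_BM_rel K)"
    by (auto simp: refl_on_def tensor_BM_rel_def intro: tensor_BM_dist_refl sc)
  show "sym (tensor_BM_rel K)"
    by (auto simp: sym_def tensor_BM_rel_def) (metis tensor_BM_dist_sym sc)
  show "trans (tensor_BM_rel K)"
  proof (rule transI)
    fix P R S assume "(P, R) \<in> tensor_BM_rel K" "(R, S) \<in> tensor_BM_rel K"
    then have b: "P \<in> tensorial_bodies K" "R \<in> tensorial_bodies K" "S \<in> tensorial_bodies K"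
      and d: "tensor_BM_dist K P R = 1" "tensor_BM_dist K R S = 1" by (auto simp: tensor_BM_rel_def)
    have "tensor_BM_dist K P S \<le> 1" using tensor_BM_dist_triangle[OF b[THEN sc]] d by simp
    then have "tensor_BM_dist K P S = 1" using tensor_BM_dist_ge_1[OF b(1,3)[THEN sc]] by simp
    with b show "(P, S) \<in> tensor_BM_rel K" by (simp add: tensor_BM_rel_def)
  qed
qed

lemma bm_class_in: "P \<in> tensorial_bodies K \<Longrightarrow> bm_class P \<in> BM_tensor K"
  by (simp add: bm_class_def BM_tensor_def quotientI)

lemma bm_class_eq_iff:
  "P \<in> tensorial_bodies K \<Longrightarrow> R \<in> tensorial_bodies K \<Longrightarrow> bm_class P = bm_class R \<longleftrightarrow> tensor_BM_dist K P R = 1"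
  unfolding bm_class_def using eq_equiv_class_iff[OF equiv_tensor_BM_rel]
  by (simp add: tensor_BM_rel_def)

lemma bm_rep:
  assumes "C \<in> BM_tensor K"
  shows "bm_rep C \<in> tensorial_bodies K" "bm_class (bm_rep C) = C"
proof -
  obtain P where P: "P \<in> tensorial_bodies K" "C = bm_class P"
    using assms unfolding BM_tensor_def bm_class_def by (rule quotientE)
  then have "P \<in> C" using equiv_class_self[OF equiv_tensor_BM_rel] by (simp add: bm_class_def)
  then have r: "bm_rep C \<in> C" unfolding bm_rep_def by (rule someI)
  then have rel: "(P, bm_rep C) \<in> tensor_BM_rel K" unfolding P(2) bm_class_def by blast
  then show "bm_rep C \<in> tensorial_bodies K" by (simp add: tensor_BM_rel_def)
  show "bm_class (bm_rep C) = C"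
    using equiv_class_eq[OF equiv_tensor_BM_rel rel] P by (simp add: bm_class_def)
qed

lemma BM_tensor_metric_rep:
  "C \<in> BM_tensor K \<Longrightarrow> D \<in> BM_tensor K \<Longrightarrow> BM_tensor_metric K C D = ln (tensor_BM_dist K (bm_rep C) (bm_rep D))"
  by (simp add: BM_tensor_metric_def bm_rep_def)

text \<open>The chosen representatives are at distance 1 from the given bodies, and the
  multiplicative triangle inequality, used in both directions, removes them.\<close>

lemma BM_tensor_metric_class:
  assumes P: "P \<in> tensorial_bodies K" and R: "R \<in> tensorial_bodies K"
  shows "BM_tensor_metric K (bm_class P) (bm_class R) = ln (tensor_BM_dist K P R)"
proof -
  note sc = tensorial_bodies_sym_convex
  let ?P = "bm_rep (bm_class P)" and ?R = "bm_rep (bm_class R)"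
  note rP = bm_rep[OF bm_class_in[OF P]] and rR = bm_rep[OF bm_class_in[OF R]]
  have 1: "tensor_BM_dist K ?P P = 1" "tensor_BM_dist K P ?P = 1"
    using bm_class_eq_iff[OF rP(1) P] bm_class_eq_iff[OF P rP(1)] rP(2) by simp_all
  have 2: "tensor_BM_dist K ?R R = 1" "tensor_BM_dist K R ?R = 1"
    using bm_class_eq_iff[OF rR(1) R] bm_class_eq_iff[OF R rR(1)] rR(2) by simp_all
  note tri = tensor_BM_dist_triangle and b = sc[OF P] sc[OF R] sc[OF rP(1)] sc[OF rR(1)]
  have "tensor_BM_dist K ?P ?R = tensor_BM_dist K P R"
    using tri[OF b(3,1,4)] tri[OF b(1,2,4)] tri[OF b(1,3,2)] tri[OF b(3,4,2)] 1 2 by simp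
  then show ?thesis using BM_tensor_metric_rep bm_class_in P R by simp
qed

lemma Metric_space_BM_tensor: "Metric_space (BM_tensor K) (BM_tensor_metric K)"
proof
  note sc = tensorial_bodies_sym_convex
  fix C D
  have "tensor_BM_dist K (bm_rep C) (bm_rep D) \<ge> 1" "tensor_BM_dist K (bm_rep C) (bm_rep D) = tensor_BM_dist K (bm_rep D) (bm_rep C)"
    if "C \<in> BM_tensor K" "D \<in> BM_tensor K"
    using tensor_BM_dist_ge_1 tensor_BM_dist_sym sc[OF bm_rep(1)[OF that(1)]] sc[OF bm_rep(1)[OF that(2)]]
    by simp_all
  note * = this
  show "0 \<le> BM_tensor_metric K C D"
    unfolding BM_tensor_metric_def bm_rep_def[symmetric] using *(1) by simp
  show "BM_tensor_metric K C D = BM_tensor_metric K D C"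
    unfolding BM_tensor_metric_def bm_rep_def[symmetric] using *(2) by simp
next
  note sc = tensorial_bodies_sym_convex
  fix C D assume CD: "C \<in> BM_tensor K" "D \<in> BM_tensor K"
  have "ln (tensor_BM_dist K (bm_rep C) (bm_rep D)) = 0 \<longleftrightarrow> tensor_BM_dist K (bm_rep C) (bm_rep D) = 1"
    using tensor_BM_dist_ge_1[OF sc[OF bm_rep(1)[OF CD(1)]] sc[OF bm_rep(1)[OF CD(2)]]] by auto
  also have "\<dots> \<longleftrightarrow> C = D" using bm_class_eq_iff CD bm_rep by metis
  finally show "BM_tensor_metric K C D = 0 \<longleftrightarrow> C = D" using CD by (simp add: BM_tensor_metric_rep)
next
  note sc = tensorial_bodies_sym_convex
  fix C D E assume C: "C \<in> BM_tensor K" "D \<in> BM_tensor K" "E \<in> BM_tensor K"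
  let ?c = "bm_rep C" and ?d = "bm_rep D" and ?e = "bm_rep E"
  have b: "?c \<in> sym_convex_bodies (tensor_space K)" "?d \<in> sym_convex_bodies (tensor_space K)" "?e \<in> sym_convex_bodies (tensor_space K)"
    using C bm_rep(1) sc by auto
  have ge: "tensor_BM_dist K ?c ?d \<ge> 1" "tensor_BM_dist K ?d ?e \<ge> 1" "tensor_BM_dist K ?c ?e \<ge> 1" using b tensor_BM_dist_ge_1 by auto
  have "ln (tensor_BM_dist K ?c ?e) \<le> ln (tensor_BM_dist K ?c ?d * tensor_BM_dist K ?d ?e)"
    using ge tensor_BM_dist_triangle[OF b] by simp
  also have "\<dots> = ln (tensor_BM_dist K ?c ?d) + ln (tensor_BM_dist K ?d ?e)" using ge by (simp add: ln_mult)
  finally show "BM_tensor_metric K C E \<le> BM_tensor_metric K C D + BM_tensor_metric K D E"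
    using C by (simp add: BM_tensor_metric_rep)
qed

lemma topspace_BM_tensor_top: "topspace (BM_tensor_top K) = BM_tensor K"
  unfolding BM_tensor_top_def by (rule Metric_space.topspace_mtopology[OF Metric_space_BM_tensor])

section \<open>Passing deformations of bodies to the space of classes\<close>

lemma tensor_BM_dist_map_le_power:
  assumes F: "\<And>P. P \<in> tensorial_bodies K \<Longrightarrow> F P \<in> tensorial_bodies K"
    and equi: "\<And>P T. P \<in> tensorial_bodies K \<Longrightarrow> T \<in> GL_tensor K \<Longrightarrow> F (T ` P) = T ` F P"
    and lip: "\<And>R S c. R \<in> sym_convex_bodies (tensor_space K) \<Longrightarrow> S \<in> sym_convex_bodies (tensor_space K) \<Longrightarrow> c \<ge> 1 \<Longrightarrow>
       R \<subseteq> S \<Longrightarrow> S \<subseteq> (\<lambda>x. c *\<^sub>R x) ` R \<Longrightarrow>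
       F S \<subseteq> (\<lambda>x. (c ^ k) *\<^sub>R x) ` F R \<and> F R \<subseteq> (\<lambda>x. (c ^ k) *\<^sub>R x) ` F S"
    and P: "P \<in> tensorial_bodies K" and R: "R \<in> tensorial_bodies K"
  shows "tensor_BM_dist K (F P) (F R) \<le> tensor_BM_dist K P R ^ (2 * k)"
proof -
  note sc = tensorial_bodies_sym_convex
  have le: "tensor_BM_dist K (F P) (F R) \<le> c ^ (2 * k)" if cin: "c \<in> bm_factors K P R" for c
  proof -
    obtain T where T: "T \<in> GL_tensor K" "R \<subseteq> T ` P" "T ` P \<subseteq> (\<lambda>x. c *\<^sub>R x) ` R" and c: "c \<ge> 1"
      using cin unfolding bm_factors_def by blast
    \<comment> \<open>The image of \<open>P\<close> enters only as a symmetric convex body of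
      \<open>tensor_space K\<close>; this is why \<open>lip\<close> ranges over all such
      bodies.\<close>
    have "T ` P \<in> sym_convex_bodies (T ` tensor_space K)"
      using T(1) by (intro sym_convex_bodies_linear_image[OF subspace_tensor_space sc[OF P]])
        (auto simp: GL_tensor_def bij_betw_def)
    then have TP: "T ` P \<in> sym_convex_bodies (tensor_space K)"
      using T(1) by (simp add: GL_tensor_def bij_betw_def)
    note l = lip[OF sc[OF R] TP c T(2,3)]
    have ck: "c ^ k \<ge> 1" using c by (rule one_le_power)
    have "1 * 1 \<le> c ^ k * c ^ k" using ck by (intro mult_mono) auto
    \<comment> \<open>\<open>F\<close> may fail to be monotone, so each of the two inclusions costs
      a factor \<open>c ^ k\<close>; hence the exponent \<open>2 * k\<close>.\<close>
    then have "c ^ k * c ^ k \<in> bm_factors K (F P) (F R)"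
      using l ck by (intro bm_factors_scaled[OF T(1)]) (auto simp: equi[OF P T(1)])
    then show ?thesis by (metis tensor_BM_dist_le mult_2 power_add)
  qed
  have ev: "tensor_BM_dist K (F P) (F R) \<le> (tensor_BM_dist K P R + 1 / real (Suc n)) ^ (2 * k)" for n
  proof -
    obtain c where c: "c \<in> bm_factors K P R" "c < tensor_BM_dist K P R + 1 / real (Suc n)"
      by (rule bm_factors_less[OF sc[OF P] sc[OF R], of "tensor_BM_dist K P R + 1 / real (Suc n)"]) auto
    have "c ^ (2 * k) \<le> (tensor_BM_dist K P R + 1 / real (Suc n)) ^ (2 * k)"
      using c by (intro power_mono) (auto simp: bm_factors_def)
    with le[OF c(1)] show ?thesis by linarith
  qed
  have "(\<lambda>n. (tensor_BM_dist K P R + 1 / real (Suc n)) ^ (2 * k)) \<longlonglongrightarrow> (tensor_BM_dist K P R + 0) ^ (2 * k)"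
    by (intro tendsto_intros LIMSEQ_Suc[OF lim_1_over_n])
  with ev show ?thesis by (intro LIMSEQ_le_const) auto
qed

text \<open>The exponent in \<open>lip\<close> is uniform in \<open>t\<close>, whereas
  \<open>d\<close> in \<open>cont\<close> may depend on \<open>P\<close>. For joint continuity this
  suffices: time is moved first at the fixed body, then the body at the new time. Working with
  representatives is harmless because \<open>lip\<close> sends distance 1 to distance 1.\<close>

lemma homotopic_BM_tensor_maps:
  fixes F :: "real \<Rightarrow> (real ^ ('l \<Rightarrow> 'k)) set \<Rightarrow> (real ^ ('l \<Rightarrow> 'k)) set"
  assumes F: "\<And>t P. t \<in> {0..1} \<Longrightarrow> P \<in> tensorial_bodies K \<Longrightarrow> F t P \<in> tensorial_bodies K"
    and lip: "\<And>t P R. t \<in> {0..1} \<Longrightarrow> P \<in> tensorial_bodies K \<Longrightarrow> R \<in> tensorial_bodies K \<Longrightarrow>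
      tensor_BM_dist K (F t P) (F t R) \<le> tensor_BM_dist K P R ^ k"
    and cont: "\<And>t P e. t \<in> {0..1} \<Longrightarrow> P \<in> tensorial_bodies K \<Longrightarrow> e > 0 \<Longrightarrow>
      \<exists>d>0. \<forall>s\<in>{0..1}. \<bar>s - t\<bar> < d \<longrightarrow> tensor_BM_dist K (F t P) (F s P) < 1 + e"
  shows "homotopic_with (\<lambda>_. True) (BM_tensor_top K) (BM_tensor_top K)
    (\<lambda>C. bm_class (F 0 (bm_rep C))) (\<lambda>C. bm_class (F 1 (bm_rep C)))"
proof -
  interpret M: Metric_space "BM_tensor K" "BM_tensor_metric K" by (rule Metric_space_BM_tensor)
  note sc = tensorial_bodies_sym_convex
  let ?I = "top_of_set {0..1::real}"
  define h where "h = (\<lambda>(t, C). bm_class (F t (bm_rep C)))"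
  have "continuous_map (prod_topology ?I M.mtopology) M.mtopology h"
    unfolding M.continuous_map_to_metric
  proof (intro ballI allI impI)
    fix x and e :: real
    assume x: "x \<in> topspace (prod_topology ?I M.mtopology)" and e: "e > 0"
    obtain t C where tC: "x = (t, C)" "t \<in> {0..1}" "C \<in> BM_tensor K" using x by auto
    let ?P = "bm_rep C"
    have P: "?P \<in> tensorial_bodies K" using tC bm_rep by auto
    obtain d where d: "d > 0" "\<And>s. s \<in> {0..1} \<Longrightarrow> \<bar>s - t\<bar> < d \<Longrightarrow> tensor_BM_dist K (F t ?P) (F s ?P) < 1 + e/2"
      using cont[OF tC(2) P, of "e/2"] e by auto
    \<comment> \<open>The summand 1 makes \<open>real k * r < e / 2\<close> strict and covers
      \<open>k = 0\<close>.\<close>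
    define r where "r = e / (2 * (real k + 1))"
    have r: "r > 0" "real k * r < e / 2" using e by (auto simp: r_def field_simps)
    define U where "U = ({0..1} \<inter> ball t d) \<times> M.mball C r"
    have "openin (prod_topology ?I M.mtopology) U"
      unfolding U_def by (auto simp: openin_prod_Times_iff openin_open_Int)
    moreover have "x \<in> U" using tC d r by (auto simp: U_def)
    moreover have "h y \<in> M.mball (h x) e" if y: "y \<in> U" for y
    proof -
      obtain s D where sD: "y = (s, D)" "s \<in> {0..1}" "\<bar>s - t\<bar> < d" "D \<in> BM_tensor K"
        "BM_tensor_metric K C D < r"
        using y by (auto simp: U_def dist_real_def)
      let ?R = "bm_rep D"
      have R: "?R \<in> tensorial_bodies K" using sD bm_rep by auto
      note b = F[OF tC(2) P] F[OF sD(2) P] F[OF sD(2) R]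
      have ge: "tensor_BM_dist K (F t ?P) (F s ?P) \<ge> 1" "tensor_BM_dist K (F s ?P) (F s ?R) \<ge> 1" "tensor_BM_dist K ?P ?R \<ge> 1"
        by (intro tensor_BM_dist_ge_1 sc b P R)+
      have "BM_tensor_metric K (h x) (h y) \<le> BM_tensor_metric K (h x) (bm_class (F s ?P))
         + BM_tensor_metric K (bm_class (F s ?P)) (h y)"
        unfolding h_def tC sD prod.case using b by (intro M.triangle) (auto intro: bm_class_in)
      also have "\<dots> = ln (tensor_BM_dist K (F t ?P) (F s ?P)) + ln (tensor_BM_dist K (F s ?P) (F s ?R))"
        unfolding h_def tC sD prod.case using b by (simp add: BM_tensor_metric_class)
      also have "ln (tensor_BM_dist K (F t ?P) (F s ?P)) \<le> tensor_BM_dist K (F t ?P) (F s ?P) - 1"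
        using ge by (intro ln_le_minus_one) auto
      also have "tensor_BM_dist K (F t ?P) (F s ?P) - 1 < e / 2" using d(2)[OF sD(2,3)] by simp
      also have "ln (tensor_BM_dist K (F s ?P) (F s ?R)) \<le> ln (tensor_BM_dist K ?P ?R ^ k)"
        using lip[OF sD(2) P R] ge by simp
      also have "ln (tensor_BM_dist K ?P ?R ^ k) = real k * BM_tensor_metric K C D"
        using ge tC sD by (simp add: ln_realpow BM_tensor_metric_rep)
      also have "\<dots> \<le> real k * r" using sD by (intro mult_left_mono) auto
      also have "\<dots> < e / 2" by (rule r)
      finally have "BM_tensor_metric K (h x) (h y) < e" by simp
      then show ?thesis using b by (auto simp: h_def tC sD intro: bm_class_in)
    qed
    ultimately show "\<exists>U. openin (prod_topology ?I M.mtopology) U \<and> x \<in> U \<and>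
        (\<forall>y\<in>U. h y \<in> M.mball (h x) e)" by blast
  qed
  then show ?thesis
    unfolding homotopic_with_def BM_tensor_top_def
    by (intro exI[of _ h]) (auto simp: h_def)
qed

end

subsection \<open>Linear algebra of inner products\<close>

text \<open>Gram-Schmidt for the form \<open>B\<close>, with \<open>s\<close> the
  \<open>B\<close>-orthogonal projection of \<open>a\<close> to \<open>span C\<close>. The set
  \<open>T\<close> may be dependent: a vector with vanishing remainder adds nothing to
  \<open>C\<close>.\<close>

lemma orthonormal_for_form:
  fixes B :: "'a::euclidean_space \<Rightarrow> 'a \<Rightarrow> real"
  assumes lin: "\<And>y. linear (\<lambda>x. B x y)" and sym: "\<And>x y. B x y = B y x"
    and S: "subspace S" and pos: "\<And>x. x \<in> S \<Longrightarrow> x \<noteq> 0 \<Longrightarrow> B x x > 0"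
    and T: "finite T" "T \<subseteq> S"
  shows "\<exists>C. finite C \<and> C \<subseteq> S \<and> span C = span T \<and> (\<forall>c\<in>C. \<forall>d\<in>C. B c d = (if c = d then 1 else 0))"
  using T
proof (induction T rule: finite_induct)
  case empty
  then show ?case by (intro exI[of _ "{}"]) auto
next
  case (insert a T)
  then obtain C where C: "finite C" "C \<subseteq> S" "span C = span T"
    and on: "\<And>c d. c \<in> C \<Longrightarrow> d \<in> C \<Longrightarrow> B c d = (if c = d then 1 else 0)" by auto
  define s where "s = (\<Sum>c\<in>C. B a c *\<^sub>R c)"
  have s: "s \<in> span C" unfolding s_def by (intro span_sum span_scale span_base)
  have "span C \<subseteq> S" using C(2) S by (simp add: span_minimal)
  then have aS: "a - s \<in> S" using s insert.prems S by (auto intro: subspace_diff)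
  have sp: "span (insert a T) = span (insert (a - s) C)"
  proof -
    have "span (insert a T) = span (insert a C)" by (simp add: span_insert C(3))
    also have "\<dots> = span (insert (a - s) C)"
      using eq_span_insert_eq[of a "a - s" C] s by simp
    finally show ?thesis .
  qed
  have orth: "B (a - s) d = 0" if d: "d \<in> C" for d
  proof -
    have "B s d = (\<Sum>c\<in>C. B a c * B c d)"
      unfolding s_def by (simp add: linear_sum[OF lin] linear_scale[OF lin])
    also have "\<dots> = (\<Sum>c\<in>C. if c = d then B a d else 0)"
      using on d by (intro sum.cong) auto
    also have "\<dots> = B a d" using C(1) d by simp
    finally show ?thesis by (simp add: linear_diff[OF lin])
  qed
  show ?case
  proof (cases "a - s = 0")
    case True
    then have "span (insert a T) = span C" using sp by (simp add: span_insert_0)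
    then show ?thesis using C on by (intro exI[of _ C]) auto
  next
    case False
    define n where "n = sqrt (B (a - s) (a - s))"
    have n: "n > 0" "n * n = B (a - s) (a - s)" using pos[OF aS False] by (auto simp: n_def)
    define e where "e = (a - s) /\<^sub>R n"
    have es: "B e z = inverse n * B (a - s) z" for z by (simp add: e_def linear_scale[OF lin])
    have "B (a - s) e = inverse n * (n * n)" using es[of "a - s"] sym[of "a - s" e] n(2) by simp
    then have ee: "B e e = 1" using es[of e] n(1) by (simp add: field_simps)
    have ed: "B e d = 0" "B d e = 0" if "d \<in> C" for d
      using orth[OF that] sym[of e d] by (auto simp: e_def linear_scale[OF lin])
    have "e \<notin> C" using ee ed by force
    note ee ed this
    moreover have "e \<in> S" using aS S by (simp add: e_def subspace_scale)
    moreover have "span (insert e C) = span (insert a T)"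
    proof -
      have "a - s = n *\<^sub>R e" using n by (simp add: e_def)
      then have "a - s \<in> span (insert e C)" by (simp add: span_scale span_base)
      moreover have "e \<in> span (insert (a - s) C)" by (simp add: e_def span_scale span_base)
      ultimately show ?thesis unfolding sp
        by (intro span_eq[THEN iffD2] conjI subsetI) (auto intro: span_base)
    qed
    ultimately show ?thesis using C on by (intro exI[of _ "insert e C"]) auto
  qed
qed

text \<open>A Euclidean orthonormal basis of \<open>S\<close> is sent to a
  \<open>B\<close>-orthonormal one. This is what later puts all projective products of ellipsoids
  into one orbit.\<close>

lemma isometry_for_form:
  fixes B :: "'a::euclidean_space \<Rightarrow> 'a \<Rightarrow> real"
  assumes lin: "\<And>y. linear (\<lambda>x. B x y)" and sym: "\<And>x y. B x y = B y x"
    and S: "subspace S" and pos: "\<And>x. x \<in> S \<Longrightarrow> x \<noteq> 0 \<Longrightarrow> B x x > 0"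
  obtains A where "linear A" "A ` S = S" "inj_on A S" "\<And>x. x \<in> S \<Longrightarrow> B (A x) (A x) = x \<bullet> x"
proof -
  obtain E where E: "E \<subseteq> S" "pairwise orthogonal E" "\<And>x. x \<in> E \<Longrightarrow> norm x = 1"
    "independent E" "card E = dim S" "span E = S"
    using orthonormal_basis_subspace[OF S] by metis
  have fE: "finite E" using E(4) independent_imp_finite by blast
  obtain C where C: "finite C" "C \<subseteq> S" "span C = span E"
    and on: "\<And>c d. c \<in> C \<Longrightarrow> d \<in> C \<Longrightarrow> B c d = (if c = d then 1 else 0)"
    using orthonormal_for_form[OF lin sym S pos fE E(1)] by metis
  have "independent C"
    unfolding dependent_def
  proof
    assume "\<exists>a\<in>C. a \<in> span (C - {a})"
    then obtain a where a: "a \<in> C" "a \<in> span (C - {a})" by blast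
    have "subspace {x. B x a = 0}"
      using linear_subspace_kernel[OF lin] by simp
    then have "span (C - {a}) \<subseteq> {x. B x a = 0}"
      using on a(1) by (intro span_minimal) auto
    then show False using a on[OF a(1) a(1)] by auto
  qed
  then have "card C = card E" using C(3) E(5,6) by (metis dim_span dim_eq_card_independent)
  then obtain \<phi> where \<phi>: "bij_betw \<phi> E C"
    using finite_same_card_bij[OF fE C(1)] by metis
  define A where "A = (\<lambda>x. \<Sum>e\<in>E. (x \<bullet> e) *\<^sub>R \<phi> e)"
  have lA: "linear A"
    unfolding A_def by (rule linearI)
      (auto simp: inner_add_left scaleR_add_left sum.distrib scaleR_sum_right)
  have \<phi>E: "\<phi> e \<in> C" if "e \<in> E" for e using \<phi> that by (auto simp: bij_betw_def)
  have BA: "B (A x) (A x) = x \<bullet> x" if x: "x \<in> S" for x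
  proof -
    have 1: "B (A x) (\<phi> d) = x \<bullet> d" if d: "d \<in> E" for d
    proof -
      have "B (A x) (\<phi> d) = (\<Sum>e\<in>E. (x \<bullet> e) * B (\<phi> e) (\<phi> d))"
        unfolding A_def by (simp add: linear_sum[OF lin] linear_scale[OF lin])
      also have "\<dots> = (\<Sum>e\<in>E. if e = d then x \<bullet> d else 0)"
        using on \<phi>E d \<phi> by (intro sum.cong) (auto simp: bij_betw_def inj_on_eq_iff)
      finally show ?thesis using fE d by simp
    qed
    have Az: "B (A x) z = (\<Sum>e\<in>E. (x \<bullet> e) * B (\<phi> e) z)" for z
      unfolding A_def by (simp add: linear_sum[OF lin] linear_scale[OF lin])
    have "B (A x) (A x) = (\<Sum>e\<in>E. (x \<bullet> e) * B (A x) (\<phi> e))"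
      unfolding Az[of "A x"] by (rule sum.cong[OF refl]) (simp only: sym[of "A x"])
    also have "\<dots> = (\<Sum>e\<in>E. (x \<bullet> e) * (x \<bullet> e))" using 1 by simp
    also have "\<dots> = x \<bullet> (\<Sum>e\<in>E. (x \<bullet> e) *\<^sub>R e)" by (simp add: inner_sum_right)
    also have "(\<Sum>e\<in>E. (x \<bullet> e) *\<^sub>R e) = x"
      using E x fE by (intro orthonormal_basis_expand) auto
    finally show ?thesis .
  qed
  have "inj_on A S"
  proof (rule inj_onI)
    fix x y assume xy: "x \<in> S" "y \<in> S" "A x = A y"
    have "B (A (x - y)) (A (x - y)) = 0"
      using xy by (simp add: linear_diff[OF lA] linear_0[OF lin])
    then show "x = y" using BA[of "x - y"] xy S by (simp add: subspace_diff)
  qed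
  moreover have AS: "A ` S \<subseteq> S"
    unfolding A_def using \<phi>E C(2) S by (auto intro!: subspace_sum subspace_scale)
  moreover have "A ` S = S"
  proof (rule subspace_dim_equal[OF linear_subspace_image[OF lA S] S AS])
    have "dim (A ` S) = dim S"
      using \<open>inj_on A S\<close> S by (intro dim_image_eq[OF lA]) (simp add: span_eq_iff[THEN iffD2])
    then show "dim S \<le> dim (A ` S)" by simp
  qed
  ultimately show ?thesis using that lA BA by metis
qed

text \<open>With \<open>p\<close> the orthogonal projection to \<open>L\<close>, the map
  \<open>x \<mapsto> f (p x) + g (x - p x)\<close> glues the two parts; orthogonality of the images
  makes their sum direct. It turns a map that is injective on \<open>L\<close> into an automorphism,
  as the change of variables demands.\<close>

lemma linear_extension_orthogonal:
  fixes f g :: "'a::euclidean_space \<Rightarrow> 'a"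
  assumes L: "subspace L" and f: "linear f" "inj_on f L"
    and g: "linear g" "inj_on g {x. \<forall>y\<in>L. y \<bullet> x = 0}"
    and orth: "\<And>x y. x \<in> L \<Longrightarrow> \<forall>z\<in>L. z \<bullet> y = 0 \<Longrightarrow> f x \<bullet> g y = 0"
  obtains A where "linear A" "inj A" "\<And>x. x \<in> L \<Longrightarrow> A x = f x"
    "\<And>x. \<forall>y\<in>L. y \<bullet> x = 0 \<Longrightarrow> A x = g x"
proof -
  obtain E where E: "E \<subseteq> L" "pairwise orthogonal E" "\<And>x. x \<in> E \<Longrightarrow> norm x = 1"
    "independent E" "span E = L"
    using orthonormal_basis_subspace[OF L] by metis
  have fE: "finite E" using E(4) independent_imp_finite by blast
  define p where "p = (\<lambda>x. \<Sum>e\<in>E. (x \<bullet> e) *\<^sub>R e)"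
  have lp: "linear p"
    unfolding p_def by (rule linearI)
      (auto simp: inner_add_left scaleR_add_left sum.distrib scaleR_sum_right)
  have pL: "p x \<in> L" for x
    unfolding p_def using E(1) L by (auto intro!: subspace_sum subspace_scale)
  have p_id: "p x = x" if "x \<in> L" for x
    unfolding p_def using E fE that by (intro orthonormal_basis_expand) auto
  have p_0: "p x = 0" if "\<forall>y\<in>L. y \<bullet> x = 0" for x
    unfolding p_def using that E(1) by (intro sum.neutral) (auto simp: inner_commute)
  have perp: "y \<bullet> (x - p x) = 0" if y: "y \<in> L" for x y
  proof -
    have "y \<bullet> p x = p y \<bullet> x"
      unfolding p_def inner_sum_left inner_sum_right
      by (rule sum.cong) (auto simp: inner_commute mult.commute)
    then show ?thesis using p_id[OF y] by (simp add: inner_diff_right)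
  qed
  define A where "A = (\<lambda>x. f (p x) + g (x - p x))"
  have lA: "linear A"
    unfolding A_def
    by (intro linear_compose_add linear_compose[OF lp f(1), unfolded o_def]
       linear_compose[OF _ g(1), unfolded o_def] linear_compose_sub lp linear_ident)
  moreover have "inj A"
    unfolding linear_injective_0[OF lA]
  proof (intro allI impI)
    fix x assume "A x = 0"
    then have e: "f (p x) = - g (x - p x)" by (simp add: A_def add_eq_0_iff)
    have "f (p x) \<bullet> g (x - p x) = 0" using orth[OF pL] perp by blast
    then have "g (x - p x) = 0" "f (p x) = 0" using e by auto
    then have "g (x - p x) = g 0" "f (p x) = f 0" by (auto simp: linear_0 f g)
    then have "x - p x = 0" "p x = 0"
      using g(2) f(2) pL perp subspace_0[OF L] by (auto dest!: inj_onD)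
    then show "x = 0" by simp
  qed
  moreover have "A x = f x" if "x \<in> L" for x by (simp add: A_def p_id[OF that] linear_0 g)
  moreover have "A x = g x" if "\<forall>y\<in>L. y \<bullet> x = 0" for x
    using p_0[OF that] by (simp add: A_def linear_0 f)
  ultimately show ?thesis using that by metis
qed

subsection \<open>The moment form of the polar body\<close>

lemma absolutely_integrable_continuous_compact:
  fixes f :: "'a::euclidean_space \<Rightarrow> real"
  assumes "compact S" "continuous_on S f"
  shows "f absolutely_integrable_on S"
proof -
  have "integrable lborel (\<lambda>x. indicator S x *\<^sub>R f x)"
    by (rule borel_integrable_compact[OF assms])
  then show ?thesis
    unfolding set_integrable_def by (simp add: integrable_completion borel_measurable_integrable)
qed

lemma integral_linear_image:
  fixes f :: "real^'m::{finite,wellorder} \<Rightarrow> real"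
  assumes g: "linear g" and f: "f absolutely_integrable_on (g ` S)"
  shows "integral (g ` S) f = \<bar>det (matrix g)\<bar> * integral S (\<lambda>x. f (g x))"
proof -
  have "(\<lambda>x. vec (f x) :: real^1) absolutely_integrable_on (g ` S)"
    using f by (simp add: absolutely_integrable_on_1_iff)
  then have "integral (g ` S) (\<lambda>x. vec (f x) :: real^1) =
      \<bar>det (matrix g)\<bar> *\<^sub>R integral S ((\<lambda>x. vec (f x)) \<circ> g)"
    by (intro integral_change_of_variables_linear[OF g]) auto
  then show ?thesis by (simp add: integral_on_1_eq o_def vec_eq_iff)
qed

text \<open>The polar of \<open>Q\<close> in its span, times the unit ball of the orthogonal complement so that it
  is full-dimensional.\<close>

definition thick_polar :: "'a::euclidean_space set \<Rightarrow> 'a set" where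
  "thick_polar Q = {y. \<forall>x \<in> Q \<union> {x. norm x \<le> 1 \<and> (\<forall>q\<in>Q. q \<bullet> x = 0)}. x \<bullet> y \<le> 1}"

text \<open>The second moment of the uniform probability measure on the thickened polar. Division by
  the volume cancels determinants. Integrating over the polar gives a form on the space of
  \<open>Q\<close> itself, and its root scales with \<open>Q\<close> in the same way as the
  gauge.\<close>

definition moment_form :: "'a::euclidean_space set \<Rightarrow> 'a \<Rightarrow> 'a \<Rightarrow> real" where
  "moment_form Q u v =
    integral (thick_polar Q) (\<lambda>y. (u \<bullet> y) * (v \<bullet> y)) / integral (thick_polar Q) (\<lambda>y. 1)"

context
  fixes L Q :: "'a::euclidean_space set"
  assumes L: "subspace L" and Q: "Q \<in> sym_convex_bodies L"
begin

lemma body_perp_iff: "(\<forall>q\<in>Q. q \<bullet> x = 0) \<longleftrightarrow> (\<forall>l\<in>L. l \<bullet> x = 0)"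
proof
  obtain r where r: "r > 0" "\<And>x. x \<in> L \<Longrightarrow> norm x \<le> r \<Longrightarrow> x \<in> Q"
    using sym_convex_bodies_inner[OF L Q] by metis
  assume q: "\<forall>q\<in>Q. q \<bullet> x = 0"
  show "\<forall>l\<in>L. l \<bullet> x = 0"
  proof
    fix l assume l: "l \<in> L"
    show "l \<bullet> x = 0"
    proof (cases "l = 0")
      case False
      have "(r / norm l) *\<^sub>R l \<in> Q" using r(1) False l L by (intro r) (auto simp: subspace_scale)
      with q r(1) False show ?thesis by force
    qed simp
  qed
next
  assume "\<forall>l\<in>L. l \<bullet> x = 0"
  then show "\<forall>q\<in>Q. q \<bullet> x = 0" using Q by (auto simp: sym_convex_bodies_def)
qed

lemma thick_polar_ball: obtains r where "r > 0" "cball 0 r \<subseteq> thick_polar Q"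
proof -
  obtain b where b: "b > 0" "\<And>x. x \<in> Q \<Longrightarrow> norm x \<le> b"
    using sym_convex_bodies_bound[OF Q] by metis
  have "y \<in> thick_polar Q" if y: "norm y \<le> 1 / max b 1" for y
    unfolding thick_polar_def
  proof (intro CollectI ballI)
    fix x assume "x \<in> Q \<union> {x. norm x \<le> 1 \<and> (\<forall>q\<in>Q. q \<bullet> x = 0)}"
    then have x: "norm x \<le> max b 1" using b by fastforce
    have "x \<bullet> y \<le> norm x * norm y" by (rule norm_cauchy_schwarz)
    also have "\<dots> \<le> max b 1 * (1 / max b 1)" using x y by (intro mult_mono) auto
    also have "\<dots> = 1" using b(1) by (simp add: max_def)
    finally show "x \<bullet> y \<le> 1" .
  qed
  then have "cball 0 (1 / max b 1) \<subseteq> thick_polar Q" by auto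
  moreover have "1 / max b 1 > 0" by (simp add: max_def)
  ultimately show ?thesis by (rule that[rotated])
qed

text \<open>Boundedness is where the thickening enters: \<open>Q\<close> bounds only the component
  of \<open>y\<close> in \<open>L\<close>, the added unit ball bounds the component orthogonal to
  \<open>L\<close>.\<close>

lemma compact_thick_polar: "compact (thick_polar Q)"
proof -
  have "thick_polar Q = (\<Inter>x \<in> Q \<union> {x. norm x \<le> 1 \<and> (\<forall>q\<in>Q. q \<bullet> x = 0)}. {y. x \<bullet> y \<le> 1})"
    by (auto simp: thick_polar_def)
  then have "closed (thick_polar Q)" by (simp add: closed_INT closed_halfspace_le)
  moreover have "bounded (thick_polar Q)"
  proof -
    obtain r where r: "r > 0" "\<And>x. x \<in> L \<Longrightarrow> norm x \<le> r \<Longrightarrow> x \<in> Q"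
      using sym_convex_bodies_inner[OF L Q] by metis
    have "norm y \<le> 1 / r + 1" if y: "y \<in> thick_polar Q" for y
    proof -
      obtain p q where pq: "p \<in> span L" "\<And>w. w \<in> span L \<Longrightarrow> orthogonal q w" "y = p + q"
        using orthogonal_subspace_decomp_exists[of L y] by metis
      have pL: "p \<in> L" using pq L by (metis span_eq_iff)
      have qp: "\<forall>l\<in>L. l \<bullet> q = 0" using pq(2) span_base by (auto simp: orthogonal_def inner_commute)
      have 1: "norm p \<le> 1 / r"
      proof (cases "p = 0")
        case False
        have "(r / norm p) *\<^sub>R p \<in> Q" using r(1) False pL L by (intro r) (auto simp: subspace_scale)
        then have "((r / norm p) *\<^sub>R p) \<bullet> y \<le> 1" using y unfolding thick_polar_def by blast
        then have "r / norm p * (norm p)\<^sup>2 \<le> 1"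
          using qp pL by (simp add: pq(3) inner_add_right power2_norm_eq_inner)
        then show ?thesis using False r(1) by (simp add: power2_eq_square field_simps)
      qed (use r in auto)
      have 2: "norm q \<le> 1"
      proof (cases "q = 0")
        case False
        have "q /\<^sub>R norm q \<in> {x. norm x \<le> 1 \<and> (\<forall>q\<in>Q. q \<bullet> x = 0)}"
          using False qp body_perp_iff[of q] by auto
        then have "(q /\<^sub>R norm q) \<bullet> y \<le> 1" using y unfolding thick_polar_def by blast
        then have "inverse (norm q) * (norm q)\<^sup>2 \<le> 1"
          using qp pL by (simp add: pq(3) inner_add_right power2_norm_eq_inner inner_commute)
        then show ?thesis using False by (simp add: power2_eq_square field_simps)
      qed auto
      show ?thesis unfolding pq(3) using 1 2 norm_triangle_ineq[of p q] by linarith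
    qed
    then show ?thesis by (auto simp: bounded_iff)
  qed
  ultimately show ?thesis by (simp add: compact_eq_bounded_closed)
qed

lemma thick_polar_integrable:
  "continuous_on UNIV f \<Longrightarrow> (f :: 'a \<Rightarrow> real) absolutely_integrable_on (thick_polar Q)"
  by (intro absolutely_integrable_continuous_compact compact_thick_polar) (auto intro: continuous_on_subset)

lemma thick_polar_integrable':
  "continuous_on UNIV f \<Longrightarrow> (f :: 'a \<Rightarrow> real) integrable_on (thick_polar Q)"
  using thick_polar_integrable by (simp add: absolutely_integrable_on_def)

text \<open>The moment integrand vanishes at 0, so the hypothesis asks for nonzero values
  arbitrarily near 0; they are found in a small box inside the polar.\<close>

lemma thick_polar_integral_pos:
  fixes f :: "'a \<Rightarrow> real"
  assumes f: "continuous_on UNIV f" "\<And>y. f y \<ge> 0" and ne: "\<And>r. r > 0 \<Longrightarrow> \<exists>y. norm y \<le> r \<and> f y \<noteq> 0"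
  shows "integral (thick_polar Q) f > 0"
proof -
  obtain r where r: "r > 0" "cball 0 r \<subseteq> thick_polar Q" by (rule thick_polar_ball)
  have "open (ball (0::'a) r)" "(0::'a) \<in> ball 0 r" using r by auto
  then obtain a b where ab: "(0::'a) \<in> box a b" "cbox a b \<subseteq> ball 0 r"
    by (rule open_contains_cbox)
  then obtain s where s: "s > 0" "cball 0 s \<subseteq> box a b"
    using open_contains_cball[of "box a b"] open_box by metis
  obtain y where y: "norm y \<le> s" "f y \<noteq> 0" using ne[OF s(1)] by blast
  have ycb: "y \<in> cbox a b" using y s box_subset_cbox by force
  have sub: "cbox a b \<subseteq> thick_polar Q" using ab r by force
  have "integral (cbox a b) f \<noteq> 0"
  proof
    assume "integral (cbox a b) f = 0"
    then have "\<forall>x\<in>cbox a b. f x = 0"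
      using integral_cbox_eq_0_iff[of a b f] f ab by (auto intro: continuous_on_subset)
    with ycb y show False by blast
  qed
  moreover have "integral (cbox a b) f \<ge> 0" using f(2) by (cases "f integrable_on cbox a b") (auto intro: integral_nonneg simp: not_integrable_integral)
  moreover have "integral (cbox a b) f \<le> integral (thick_polar Q) f"
    using f sub by (intro integral_subset_le integrable_continuous thick_polar_integrable')
      (auto intro: continuous_on_subset)
  ultimately show ?thesis by linarith
qed

lemma thick_polar_volume_pos: "integral (thick_polar Q) (\<lambda>y. 1 :: real) > 0"
  by (rule thick_polar_integral_pos) (auto intro: exI[of _ 0])

lemma moment_form_sym: "moment_form Q u v = moment_form Q v u"
  by (simp add: moment_form_def mult.commute)

lemma moment_form_linear: "linear (\<lambda>u. moment_form Q u v)"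
proof (rule linearI)
  have i: "(\<lambda>y. (u \<bullet> y) * (v \<bullet> y)) integrable_on thick_polar Q" for u
    by (intro thick_polar_integrable' continuous_intros)
  show "moment_form Q (u + u') v = moment_form Q u v + moment_form Q u' v" for u u'
    unfolding moment_form_def inner_add_left distrib_right integral_add[OF i i] add_divide_distrib ..
  show "moment_form Q (c *\<^sub>R u) v = c *\<^sub>R moment_form Q u v" for c u
    unfolding moment_form_def by (simp add: mult.assoc)
qed

lemma moment_form_pos:
  assumes "u \<noteq> 0" shows "moment_form Q u u > 0"
  unfolding moment_form_def
proof (intro divide_pos_pos thick_polar_volume_pos thick_polar_integral_pos)
  fix r :: real assume r: "r > 0"
  have "u \<bullet> ((r / norm u) *\<^sub>R u) \<noteq> 0" using assms r by simp
  moreover have "norm ((r / norm u) *\<^sub>R u) \<le> r" using assms r by simp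
  ultimately show "\<exists>y. norm y \<le> r \<and> (u \<bullet> y) * (u \<bullet> y) \<noteq> 0" by (metis mult_eq_0_iff)
qed (auto intro!: continuous_intros)

lemma moment_form_nonneg: "moment_form Q u u \<ge> 0"
  using moment_form_pos[of u] linear_0[OF moment_form_linear[of 0]] by (cases "u = 0") auto

end

text \<open>\<open>f\<close> is completed to an automorphism \<open>A\<close> by an isometry
  \<open>g\<close> between the orthogonal complements of \<open>L\<close> and its image, so that the
  unit balls used for thickening correspond as well. Dually, the adjoint \<open>S\<close> of
  \<open>A\<close> carries the thick polar of the image onto that of \<open>Q\<close>. The
  determinant of \<open>S\<close> appears in numerator and denominator and cancels.\<close>

lemma moment_form_linear_image:
  fixes f :: "real^'m::{finite,wellorder} \<Rightarrow> real^'m::_"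
  assumes L: "subspace L" and Q: "Q \<in> sym_convex_bodies L" and f: "linear f" "inj_on f L"
    and uv: "u \<in> L" "v \<in> L"
  shows "moment_form (f ` Q) (f u) (f v) = moment_form Q u v"
proof -
  define L' where "L' = f ` L"
  have L': "subspace L'" using f L by (simp add: L'_def linear_subspace_image)
  have Q': "f ` Q \<in> sym_convex_bodies L'"
    unfolding L'_def by (rule sym_convex_bodies_linear_image[OF L Q f])
  let ?N = "{x. \<forall>y\<in>L. y \<bullet> x = 0}" and ?N' = "{x. \<forall>y\<in>L'. y \<bullet> x = 0}"
  have N: "subspace ?N" "subspace ?N'"
    by (auto simp: subspace_def inner_add_right)
  have "dim ?N + dim L = CARD('m)" "dim ?N' + dim L' = CARD('m)"
    using dim_subspace_orthogonal_to_vectors[OF L subspace_UNIV] dim_subspace_orthogonal_to_vectors[OF L' subspace_UNIV]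
    by (auto simp: orthogonal_def)
  moreover have "dim L' = dim L"
    unfolding L'_def using f L by (intro dim_image_eq) (auto simp: span_eq_iff[THEN iffD2])
  ultimately have dimN: "dim ?N = dim ?N'" by simp
  obtain g where g: "linear g" "g ` ?N = ?N'" "\<And>x. x \<in> ?N \<Longrightarrow> norm (g x) = norm x"
    by (rule isometries_subspaces[OF N dimN], rule that)
  have ginj: "inj_on g ?N"
  proof (rule inj_onI)
    fix x y assume xy: "x \<in> ?N" "y \<in> ?N" "g x = g y"
    then have "norm (g (x - y)) = norm (x - y)" using N by (intro g) (rule subspace_diff)
    then show "x = y" using xy by (simp add: linear_diff[OF g(1)])
  qed
  have orth: "f x \<bullet> g y = 0" if "x \<in> L" "\<forall>z\<in>L. z \<bullet> y = 0" for x y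
    using g(2) that unfolding L'_def by blast
  obtain A where A: "linear A" "inj A" "\<And>x. x \<in> L \<Longrightarrow> A x = f x"
    "\<And>x. \<forall>y\<in>L. y \<bullet> x = 0 \<Longrightarrow> A x = g x"
    by (rule linear_extension_orthogonal[OF L f g(1) ginj orth], assumption+, rule that)
  define S where "S = adjoint A"
  have S: "x \<bullet> S y = A x \<bullet> y" for x y unfolding S_def by (rule adjoint_works[OF A(1)])
  have lS: "linear S" unfolding S_def by (rule adjoint_linear[OF A(1)])
  have "inj S" unfolding S_def using A(1,2) by (simp add: linear_injective_imp_surjective)
  then have "surj S" using lS linear_injective_imp_surjective by blast
  have mem: "y \<in> thick_polar (f ` Q) \<longleftrightarrow> S y \<in> thick_polar Q" for y
  proof -
    have QL: "Q \<subseteq> L" using Q by (simp add: sym_convex_bodies_def)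
    have "{x. norm x \<le> 1 \<and> (\<forall>q\<in>f ` Q. q \<bullet> x = 0)} = {x \<in> ?N'. norm x \<le> 1}"
      using body_perp_iff[OF L' Q'] by blast
    also have "\<dots> = g ` {x \<in> ?N. norm x \<le> 1}"
      unfolding g(2)[symmetric] using g(3) by auto
    also have "\<dots> = A ` {x \<in> ?N. norm x \<le> 1}" using A(4) by (intro image_cong) auto
    also have "{x \<in> ?N. norm x \<le> 1} = {x. norm x \<le> 1 \<and> (\<forall>q\<in>Q. q \<bullet> x = 0)}"
      using body_perp_iff[OF L Q] by blast
    finally have 1: "{x. norm x \<le> 1 \<and> (\<forall>q\<in>f ` Q. q \<bullet> x = 0)} =
        A ` {x. norm x \<le> 1 \<and> (\<forall>q\<in>Q. q \<bullet> x = 0)}" .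
    have 2: "f ` Q = A ` Q" using A(3) QL by (intro image_cong) auto
    show ?thesis unfolding thick_polar_def 1 unfolding 2 image_Un[symmetric] by (simp add: S)
  qed
  have im: "thick_polar Q = S ` thick_polar (f ` Q)"
    using mem \<open>surj S\<close> by (auto simp: image_iff) (metis surjD)
  have I: "integral (thick_polar Q) h = \<bar>det (matrix S)\<bar> * integral (thick_polar (f ` Q)) (\<lambda>y. h (S y))"
    if "continuous_on UNIV h" for h :: "_ \<Rightarrow> real"
    unfolding im
    by (rule integral_linear_image[OF lS]) (use thick_polar_integrable[OF L Q that] im in simp)
  have "det (matrix S) \<noteq> 0" using \<open>inj S\<close> lS by (simp add: det_nz_iff_inj)
  moreover have "integral (thick_polar Q) (\<lambda>y. (u \<bullet> y) * (v \<bullet> y)) =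
      \<bar>det (matrix S)\<bar> * integral (thick_polar (f ` Q)) (\<lambda>y. (f u \<bullet> y) * (f v \<bullet> y))"
    using uv by (subst I) (auto intro!: continuous_intros simp: S A(3))
  moreover have "integral (thick_polar Q) (\<lambda>y. 1) =
      \<bar>det (matrix S)\<bar> * integral (thick_polar (f ` Q)) (\<lambda>y. 1)"
    by (subst I) auto
  ultimately show ?thesis by (simp add: moment_form_def)
qed

text \<open>Polarity reverses inclusions: the thick polar of \<open>Q\<close> lies in that of
  \<open>P\<close> and contains its copy scaled by \<open>1 / c\<close>. The scaling contributes
  \<open>CARD('m)\<close> powers of \<open>c\<close> through the volume and 2 through the quadratic
  integrand. Since the form is a quotient, numerator and denominator are estimated
  separately.\<close>

lemma moment_form_mono:
  fixes P Q :: "(real^'m::{finite,wellorder}) set"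
  assumes L: "subspace L" and P: "P \<in> sym_convex_bodies L" and Q: "Q \<in> sym_convex_bodies L"
    and c: "c \<ge> 1" and sub: "P \<subseteq> Q" "Q \<subseteq> (\<lambda>x. c *\<^sub>R x) ` P"
  shows "moment_form P u u \<le> c ^ (CARD('m) + 2) * moment_form Q u u"
    and "moment_form Q u u \<le> c ^ (CARD('m) + 2) * moment_form P u u"
proof -
  let ?D = "thick_polar P" and ?E = "thick_polar Q" and ?n = "CARD('m)"
  let ?h = "\<lambda>y. (u \<bullet> y) * (u \<bullet> y)"
  have perp: "(\<forall>q\<in>P. q \<bullet> x = 0) \<longleftrightarrow> (\<forall>q\<in>Q. q \<bullet> x = 0)" for x
    using body_perp_iff[OF L P] body_perp_iff[OF L Q] by simp
  have ED: "?E \<subseteq> ?D" using sub(1) unfolding thick_polar_def perp by blast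
  let ?s = "\<lambda>y. (1 / c) *\<^sub>R y :: real^'m::_"
  have sD: "?s ` ?D \<subseteq> ?E"
  proof clarify
    fix y assume y: "y \<in> ?D"
    show "?s y \<in> ?E" unfolding thick_polar_def
    proof (intro CollectI ballI)
      fix x assume "x \<in> Q \<union> {x. norm x \<le> 1 \<and> (\<forall>q\<in>Q. q \<bullet> x = 0)}"
      then show "x \<bullet> ?s y \<le> 1"
      proof
        assume "x \<in> Q"
        then obtain p where "p \<in> P" "x = c *\<^sub>R p" using sub(2) by blast
        with y c show ?thesis by (auto simp: thick_polar_def)
      next
        assume "x \<in> {x. norm x \<le> 1 \<and> (\<forall>q\<in>Q. q \<bullet> x = 0)}"
        then have "x \<bullet> y \<le> 1" using y perp by (auto simp: thick_polar_def)
        then show ?thesis using c by simp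
      qed
    qed
  qed
  have ls: "linear ?s" by (rule linearI) (auto simp: scaleR_add_right)
  have sint: "integral (?s ` ?D) h = (1 / c) ^ ?n * integral ?D (\<lambda>y. h (?s y))"
    and sabs: "h integrable_on (?s ` ?D)"
    if h: "continuous_on UNIV h" for h :: "_ \<Rightarrow> real"
  proof -
    have "compact (?s ` ?D)"
      by (intro compact_continuous_image continuous_intros compact_thick_polar[OF L P])
    then have a: "h absolutely_integrable_on (?s ` ?D)"
      using h by (intro absolutely_integrable_continuous_compact) (auto intro: continuous_on_subset)
    then show "h integrable_on (?s ` ?D)" by (simp add: absolutely_integrable_on_def)
    have "det (matrix ?s) = (1 / c) ^ ?n" by (rule det_matrix_scaleR)
    then show "integral (?s ` ?D) h = (1 / c) ^ ?n * integral ?D (\<lambda>y. h (?s y))"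
      using integral_linear_image[OF ls a] c by simp
  qed
  have ch: "continuous_on UNIV ?h" by (intro continuous_intros)
  note iE = thick_polar_integrable'[OF L Q] and iD = thick_polar_integrable'[OF L P]
  have vol: "(1 / c) ^ ?n * integral ?D (\<lambda>y. 1) \<le> integral ?E (\<lambda>y. 1 :: real)"
    "integral ?E (\<lambda>y. 1 :: real) \<le> integral ?D (\<lambda>y. 1)"
    using integral_subset_le[OF sD sabs iE, of "\<lambda>y. 1"] integral_subset_le[OF ED iE iD, of "\<lambda>y. 1"]
      sint[of "\<lambda>y. 1"] by auto
  have m: "(1 / c) ^ ?n * ((1 / c)\<^sup>2 * integral ?D ?h) \<le> integral ?E ?h"
    "integral ?E ?h \<le> integral ?D ?h"
  proof -
    have "integral ?D (\<lambda>y. ?h (?s y)) = integral ?D (\<lambda>y. (1 / c)\<^sup>2 * ?h y)"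
      by (rule integral_cong) (simp add: power2_eq_square)
    then show "(1 / c) ^ ?n * ((1 / c)\<^sup>2 * integral ?D ?h) \<le> integral ?E ?h"
      using integral_subset_le[OF sD sabs[OF ch] iE[OF ch]] sint[OF ch] by simp
    show "integral ?E ?h \<le> integral ?D ?h"
      using integral_subset_le[OF ED iE[OF ch] iD[OF ch]] by simp
  qed
  define vD vE mD mE where v: "vD = integral ?D (\<lambda>y. 1::real)" "vE = integral ?E (\<lambda>y. 1::real)"
    "mD = integral ?D ?h" "mE = integral ?E ?h"
  have pos: "vD > 0" "vE > 0"
    using thick_polar_volume_pos[OF L P] thick_polar_volume_pos[OF L Q] by (auto simp: v)
  have nn: "mD \<ge> 0" "mE \<ge> 0"
    unfolding v by (auto intro!: integral_nonneg iD iE ch)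
  have gen: "x \<le> c ^ k * y" if "(1 / c) ^ k * x \<le> y" for x y k
    using that c by (simp add: power_divide field_simps)
  have vol': "vD \<le> c ^ ?n * vE" "vE \<le> vD"
    using vol unfolding v[symmetric] by (auto intro: gen)
  have m0: "(1 / c) ^ (?n + 2) * mD \<le> mE"
    using m(1) unfolding v[symmetric] power_add mult.assoc .
  note m' = gen[OF m0] m(2)[folded v]
  have "mD / vD \<le> c ^ (?n + 2) * mE / vE"
    using vol' m' pos nn c by (intro frac_le) auto
  then show "moment_form P u u \<le> c ^ (?n + 2) * moment_form Q u u"
    by (simp add: moment_form_def v)
  have "vD \<le> c ^ (?n + 2) * vE"
  proof -
    have "c ^ ?n * vE \<le> c ^ (?n + 2) * vE"
      using pos c by (intro mult_right_mono power_increasing) auto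
    with vol' show ?thesis by linarith
  qed
  then have "mE * vD \<le> mD * (c ^ (?n + 2) * vE)"
    using m' nn pos by (intro mult_mono) auto
  then have "mE / vE \<le> c ^ (?n + 2) * (mD / vD)"
    using pos by (simp add: field_simps)
  then show "moment_form Q u u \<le> c ^ (?n + 2) * moment_form P u u"
    by (simp add: moment_form_def v)
qed

subsection \<open>The moment norm\<close>

text \<open>The linear change of variables formula is only available for a well-ordered index type.
  The index type \<open>'n bit0\<close> is well-ordered and large enough to embed \<open>real ^ 'n\<close>.\<close>

definition emb :: "real^'n::finite \<Rightarrow> real^('n bit0)" where
  "emb = (SOME f. linear f \<and> inj f)"

lemma linear_emb: "linear (emb :: real^'n::finite \<Rightarrow> _)" and inj_emb: "inj (emb :: real^'n::finite \<Rightarrow> _)"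
proof -
  have "dim (UNIV :: (real^'n) set) \<le> dim (UNIV :: (real^('n bit0)) set)" by simp
  then obtain f :: "real^'n \<Rightarrow> real^('n bit0)" where "linear f" "\<And>x. norm (f x) = norm x"
    using isometry_subset_subspace[OF subspace_UNIV subspace_UNIV] by (metis UNIV_I)
  then have "linear f \<and> inj f" by (metis linear_injective_0 norm_eq_zero)
  then have "linear (emb :: real^'n::finite \<Rightarrow> _) \<and> inj (emb :: real^'n::finite \<Rightarrow> _)"
    unfolding emb_def by (rule someI[where P = "\<lambda>f. linear f \<and> inj f"])
  then show "linear (emb :: real^'n::finite \<Rightarrow> _)" "inj (emb :: real^'n::finite \<Rightarrow> _)" by auto
qed

text \<open>On the span of \<open>Q\<close> the value is independent of the chosen embedding, by
  \<open>moment_form_linear_image\<close>. The root makes it homogeneous of degree one.\<close>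

definition moment_norm :: "(real^'n::finite) set \<Rightarrow> real^'n \<Rightarrow> real" where
  "moment_norm Q u = sqrt (moment_form (emb ` Q) (emb u) (emb u))"

lemma emb_body:
  "subspace L \<Longrightarrow> Q \<in> sym_convex_bodies L \<Longrightarrow> emb ` Q \<in> sym_convex_bodies (emb ` L)"
  by (intro sym_convex_bodies_linear_image linear_emb inj_on_subset[OF inj_emb]) auto

lemma moment_norm_pos:
  assumes "subspace L" "Q \<in> sym_convex_bodies L" "u \<noteq> 0"
  shows "moment_norm Q u > 0"
proof -
  have "emb u \<noteq> 0" using assms(3) inj_emb linear_emb by (metis linear_injective_0)
  then show ?thesis
    unfolding moment_norm_def
    using moment_form_pos[OF linear_subspace_image[OF linear_emb assms(1)] emb_body[OF assms(1,2)]]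
    by simp
qed

lemma moment_norm_linear_image:
  fixes f :: "real^'n::finite \<Rightarrow> real^'n"
  assumes L: "subspace L" and Q: "Q \<in> sym_convex_bodies L" and f: "linear f" "inj_on f L"
    and u: "u \<in> L"
  shows "moment_norm (f ` Q) (f u) = moment_norm Q u"
proof -
  obtain p where p: "linear p" "\<And>x :: real^'n. p (emb x) = x"
    using linear_injective_left_inverse[OF linear_emb inj_emb] by (metis comp_apply id_apply)
  \<comment> \<open>The conjugate of \<open>f\<close> under the embedding; \<open>p\<close> extends
    the inverse of \<open>emb\<close> linearly to the larger space.\<close>
  define h where "h = emb \<circ> f \<circ> p"
  have h: "h (emb x) = emb (f x)" for x by (simp add: h_def p)
  have "linear h" unfolding h_def by (intro linear_compose p f linear_emb)
  moreover have "inj_on h (emb ` L)"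
    using f(2) inj_emb by (auto simp: inj_on_def h)
  moreover have "h ` emb ` Q = emb ` f ` Q" by (simp add: image_comp h o_def)
  ultimately show ?thesis
    unfolding moment_norm_def
    using moment_form_linear_image[OF linear_subspace_image[OF linear_emb L] emb_body[OF L Q], of h "emb u" "emb u"] u
    by (simp add: h)
qed

lemma moment_norm_mono:
  fixes P Q :: "(real^'n::finite) set"
  assumes L: "subspace L" and P: "P \<in> sym_convex_bodies L" and Q: "Q \<in> sym_convex_bodies L"
    and c: "c \<ge> 1" and sub: "P \<subseteq> Q" "Q \<subseteq> (\<lambda>x. c *\<^sub>R x) ` P"
  shows "moment_norm P u \<le> c ^ (2 * CARD('n) + 2) * moment_norm Q u"
    and "moment_norm Q u \<le> c ^ (2 * CARD('n) + 2) * moment_norm P u"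
proof -
  let ?m = "2 * CARD('n) + 2"
  have "emb ` (\<lambda>x. c *\<^sub>R x) ` P = (\<lambda>x. c *\<^sub>R x) ` emb ` P"
    by (simp add: image_comp o_def linear_scale[OF linear_emb])
  then have sub': "emb ` P \<subseteq> emb ` Q" "emb ` Q \<subseteq> (\<lambda>x. c *\<^sub>R x) ` emb ` P"
    using sub by (auto simp: image_mono) (metis image_mono subsetD imageI)
  note mono = moment_form_mono[OF linear_subspace_image[OF linear_emb L] emb_body[OF L P] emb_body[OF L Q] c sub',
      of "emb u", unfolded card_bit0]
  \<comment> \<open>The root would halve the exponent, but the cruder \<open>sqrt y \<le> y\<close>
    for \<open>y \<ge> 1\<close> is enough and keeps it an integer.\<close>
  have sq: "sqrt (c ^ ?m * x) \<le> c ^ ?m * sqrt x" if "x \<ge> 0" for x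
  proof -
    define y where "y = c ^ ?m"
    have y: "y \<ge> 1" unfolding y_def using c by (rule one_le_power)
    then have "y * 1 \<le> y * y" by (intro mult_left_mono) auto
    then have "sqrt y \<le> sqrt (y * y)" by (intro real_sqrt_le_mono) simp
    then have "sqrt y \<le> y" using y by simp
    then show ?thesis using that unfolding y_def[symmetric] by (simp add: real_sqrt_mult mult_right_mono)
  qed
  have nn: "moment_form (emb ` P) (emb u) (emb u) \<ge> 0" "moment_form (emb ` Q) (emb u) (emb u) \<ge> 0"
    using moment_form_nonneg emb_body L P Q linear_subspace_image[OF linear_emb L] by metis+
  show "moment_norm P u \<le> c ^ ?m * moment_norm Q u" "moment_norm Q u \<le> c ^ ?m * moment_norm P u"
    unfolding moment_norm_def using mono sq nn by (meson order_trans real_sqrt_le_mono)+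
qed

subsection \<open>Linear subspaces of decomposable tensors\<close>

lemma inner_tens_remove:
  "tens x \<bullet> tens y = (x i \<bullet> y i) * (\<Prod>k\<in>UNIV - {i}. x k \<bullet> y k)"
  unfolding inner_tens by (rule prod.remove) auto

lemma inner_tens_upd:
  "tens (x(i := a)) \<bullet> tens y = (a \<bullet> y i) * (\<Prod>k\<in>UNIV - {i}. x k \<bullet> y k)"
proof -
  have "(\<Prod>k\<in>UNIV - {i}. (x(i := a)) k \<bullet> y k) = (\<Prod>k\<in>UNIV - {i}. x k \<bullet> y k)"
    by (rule prod.cong) auto
  then show ?thesis unfolding inner_tens_remove[of _ _ i] by simp
qed

text \<open>The minors of \<open>decomposables_minor\<close> with coordinate functionals replaced by
  arbitrary product functionals, which can be adapted to given vectors.\<close>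

lemma decomposables_tens_minor:
  assumes "z \<in> decomposables K"
  shows "(tens \<phi> \<bullet> z) * (tens \<psi> \<bullet> z) = (tens (\<phi>(i := \<psi> i)) \<bullet> z) * (tens (\<psi>(i := \<phi> i)) \<bullet> z)"
proof -
  obtain x where z: "z = tens x" using assms by (auto simp: decomposables_def)
  show ?thesis
    unfolding z inner_tens_upd inner_tens_remove[of \<phi> x i] inner_tens_remove[of \<psi> x i] by simp
qed

lemma exists_common_nonorthogonal:
  fixes x y :: "'a::real_inner"
  assumes "x \<noteq> 0" "y \<noteq> 0"
  obtains p where "p \<bullet> x \<noteq> 0" "p \<bullet> y \<noteq> 0"
proof (cases "x \<bullet> y = 0")
  case True
  then have "(x + y) \<bullet> x \<noteq> 0" "(x + y) \<bullet> y \<noteq> 0"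
    using assms by (auto simp: inner_add_left inner_commute[of y x])
  then show ?thesis by (rule that)
next
  case False
  with assms show ?thesis by (intro that[of x]) auto
qed

lemma exists_orthogonal_to_one:
  fixes x y :: "'a::real_inner"
  assumes "x \<noteq> 0" "\<And>c. y \<noteq> c *\<^sub>R x"
  obtains p where "p \<bullet> x = 0" "p \<bullet> y \<noteq> 0"
proof -
  define c where "c = (y \<bullet> x) / (x \<bullet> x)"
  define p where "p = y - c *\<^sub>R x"
  have px: "p \<bullet> x = 0" using assms(1) by (simp add: p_def c_def inner_diff_left)
  have "p \<noteq> 0" using assms(2)[of c] by (simp add: p_def)
  moreover have "p \<bullet> y = p \<bullet> p"
  proof -
    have "y = p + c *\<^sub>R x" by (simp add: p_def)
    then have "p \<bullet> y = p \<bullet> (p + c *\<^sub>R x)" by simp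
    then show ?thesis using px by (simp add: inner_add_right)
  qed
  ultimately show ?thesis using px by (intro that[of p]) auto
qed

lemma parallel_sym:
  fixes x y :: "'a::real_vector"
  assumes "x \<noteq> 0" "\<And>c. y \<noteq> c *\<^sub>R x" shows "x \<noteq> c *\<^sub>R y"
proof
  assume x: "x = c *\<^sub>R y"
  then have "c \<noteq> 0" using assms(1) by auto
  then have "y = inverse c *\<^sub>R x" using x by simp
  with assms(2) show False by blast
qed

text \<open>A nonvanishing minor is exhibited: \<open>\<phi>\<close> detects \<open>tens x\<close>
  and kills \<open>tens y\<close>, \<open>\<psi>\<close> does the opposite. After the exchange in
  place \<open>i\<close>, the functional kills \<open>x\<close> through its \<open>i\<close>-th and
  \<open>y\<close> through its \<open>j\<close>-th place, so the right-hand side is 0 while the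
  left-hand side is not.\<close>

lemma tens_add_not_decomposable:
  assumes nz: "\<And>k. x k \<noteq> 0" "\<And>k. y k \<noteq> 0" and ij: "i \<noteq> j"
    and i: "\<And>c. y i \<noteq> c *\<^sub>R x i" and j: "\<And>c. y j \<noteq> c *\<^sub>R x j"
  shows "tens x + tens y \<notin> decomposables K"
proof
  assume z: "tens x + tens y \<in> decomposables K"
  have i': "x i \<noteq> c *\<^sub>R y i" and j': "x j \<noteq> c *\<^sub>R y j" for c
    using parallel_sym[OF nz(1) i] parallel_sym[OF nz(1) j] by auto
  have "\<exists>q. q \<bullet> x k \<noteq> 0 \<and> q \<bullet> y k \<noteq> 0" for k
    using exists_common_nonorthogonal[OF nz(1)[of k] nz(2)[of k]] by metis
  then obtain p where p: "\<And>k. p k \<bullet> x k \<noteq> 0" "\<And>k. p k \<bullet> y k \<noteq> 0" by metis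
  obtain a where a: "a \<bullet> y i = 0" "a \<bullet> x i \<noteq> 0"
    using exists_orthogonal_to_one[OF nz(2)[of i] i'] by metis
  obtain a' where a': "a' \<bullet> x i = 0" "a' \<bullet> y i \<noteq> 0"
    using exists_orthogonal_to_one[OF nz(1)[of i] i] by metis
  obtain b where b: "b \<bullet> y j = 0" "b \<bullet> x j \<noteq> 0"
    using exists_orthogonal_to_one[OF nz(2)[of j] j'] by metis
  obtain b' where b': "b' \<bullet> x j = 0" "b' \<bullet> y j \<noteq> 0"
    using exists_orthogonal_to_one[OF nz(1)[of j] j] by metis
  define \<phi> where "\<phi> = p(i := a, j := b)"
  define \<psi> where "\<psi> = p(i := a', j := b')"
  have z0: "tens v \<bullet> tens w = 0" if "v k \<bullet> w k = 0" for v w :: "'a \<Rightarrow> real ^ 'b" and k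
    unfolding inner_tens using that by (intro prod_zero) auto
  have nz': "tens v \<bullet> tens w \<noteq> 0" if "\<And>k. v k \<bullet> w k \<noteq> 0" for v w :: "'a \<Rightarrow> real ^ 'b"
    unfolding inner_tens using that by (simp add: prod_zero_iff)
  have "tens \<phi> \<bullet> tens x \<noteq> 0" using p a b by (intro nz') (auto simp: \<phi>_def)
  moreover have "tens \<phi> \<bullet> tens y = 0" using a ij by (intro z0[of _ i]) (auto simp: \<phi>_def)
  moreover have "tens \<psi> \<bullet> tens y \<noteq> 0" using p a' b' by (intro nz') (auto simp: \<psi>_def)
  moreover have "tens \<psi> \<bullet> tens x = 0" using a' ij by (intro z0[of _ i]) (auto simp: \<psi>_def)
  moreover have "tens (\<phi>(i := \<psi> i)) \<bullet> tens x = 0"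
    using a' ij by (intro z0[of _ i]) (auto simp: \<psi>_def)
  moreover have "tens (\<phi>(i := \<psi> i)) \<bullet> tens y = 0"
    using b ij by (intro z0[of _ j]) (auto simp: \<phi>_def)
  ultimately show False
    using decomposables_tens_minor[OF z, of \<phi> \<psi> i] by (simp add: inner_add_right)
qed

definition nonzero_factors :: "('l::finite \<Rightarrow> 'k::finite set) \<Rightarrow> ('l \<Rightarrow> real ^ 'k) \<Rightarrow> bool" where
  "nonzero_factors K x \<longleftrightarrow> (\<forall>i. x i \<in> coord_space (K i) \<and> x i \<noteq> 0)"

lemma decomposable_cases:
  assumes "z \<in> decomposables K" "z \<noteq> 0"
  obtains x where "nonzero_factors K x" "z = tens x"
proof -
  obtain x where x: "z = tens x" "\<forall>i. x i \<in> coord_space (K i)"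
    using assms by (auto simp: decomposables_def)
  then have "nonzero_factors K x" using assms(2) by (auto simp: nonzero_factors_def tens_eq_0_iff)
  with x show ?thesis by (intro that)
qed

lemma nonzero_factors_tens:
  "nonzero_factors K x \<Longrightarrow> tens x \<in> decomposables K" "nonzero_factors K x \<Longrightarrow> tens x \<noteq> 0"
  by (auto simp: nonzero_factors_def tens_eq_0_iff intro: tens_in_decomposables)

definition slice :: "('l::finite \<Rightarrow> 'k::finite set) \<Rightarrow> ('l \<Rightarrow> real ^ 'k) \<Rightarrow> 'l \<Rightarrow> (real ^ ('l \<Rightarrow> 'k)) set" where
  "slice K x i = (\<lambda>y. tens (x(i := y))) ` coord_space (K i)"

lemma subspace_slice: "subspace (slice K x i)"
  unfolding slice_def by (rule linear_subspace_image[OF linear_tens_upd subspace_coord_space])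

lemma slice_subset: "nonzero_factors K x \<Longrightarrow> slice K x i \<subseteq> decomposables K"
  unfolding slice_def nonzero_factors_def by (auto intro: tens_in_decomposables)

lemma tens_in_slice: "nonzero_factors K x \<Longrightarrow> tens x \<in> slice K x i"
  unfolding slice_def nonzero_factors_def by (auto intro!: image_eqI[of _ _ "x i"])

lemma inj_tens_upd: "nonzero_factors K x \<Longrightarrow> inj (\<lambda>y. tens (x(i := y)))"
  unfolding linear_injective_0[OF linear_tens_upd]
  by (auto simp: nonzero_factors_def tens_eq_0_iff split: if_splits)

text \<open>By \<open>tens_add_not_decomposable\<close> the factors of \<open>x\<close> and
  \<open>y\<close> are parallel in all places but one, and the scalars of the other places can be
  moved into that one.\<close>

lemma tens_adjacent:
  assumes x: "nonzero_factors K x" and y: "nonzero_factors K y"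
    and z: "tens x + tens y \<in> decomposables K"
  obtains i where "tens y \<in> slice K x i"
proof -
  have "\<exists>i. \<forall>k. k \<noteq> i \<longrightarrow> (\<exists>c. y k = c *\<^sub>R x k)"
    using tens_add_not_decomposable[of x y _ _ K] x y z unfolding nonzero_factors_def by metis
  then obtain i c where c: "\<And>k. k \<noteq> i \<Longrightarrow> y k = c k *\<^sub>R x k" by metis
  define c' where "c' = c(i := 1)"
  have "y = (\<lambda>k. c' k *\<^sub>R (x(i := y i)) k)" using c by (auto simp: c'_def)
  then have "tens y = (\<Prod>k\<in>UNIV. c' k) *\<^sub>R tens (x(i := y i))" by (metis tens_scale)
  also have "\<dots> = tens (x(i := (\<Prod>k\<in>UNIV. c' k) *\<^sub>R y i))" by (rule tens_upd_scale[symmetric])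
  finally have "tens y \<in> slice K x i"
    using y unfolding slice_def nonzero_factors_def
    by (auto intro!: imageI subspace_scale subspace_coord_space)
  then show ?thesis by (rule that)
qed

text \<open>Each element of \<open>L\<close> outside the line of \<open>tens x\<close> differs from
  it in the direction of a single factor. Two elements with different directions \<open>i\<close>
  and \<open>j\<close> would have a sum that is not decomposable, so one direction serves all of
  \<open>L\<close>.\<close>

lemma subspace_subset_slice:
  assumes L: "subspace L" "L \<subseteq> decomposables K" and x: "nonzero_factors K x" "tens x \<in> L"
  obtains i where "L \<subseteq> slice K x i"
proof -
  have sp: "c *\<^sub>R tens x \<in> slice K x i" for c i
    using subspace_scale[OF subspace_slice tens_in_slice[OF x(1)]] .
  have adj: "\<exists>i a. w = tens (x(i := a)) \<and> a \<in> coord_space (K i) \<and> (\<forall>c. a \<noteq> c *\<^sub>R x i) \<and> a \<noteq> 0"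
    if w: "w \<in> L" "\<And>c. w \<noteq> c *\<^sub>R tens x" for w
  proof -
    have "w \<noteq> 0" using w(2)[of 0] by auto
    then obtain y where y: "nonzero_factors K y" "w = tens y"
      using decomposable_cases w(1) L(2) by blast
    have "tens x + tens y \<in> decomposables K" using L w(1) x(2) y(2) subspace_add by blast
    then obtain i where "w \<in> slice K x i" using tens_adjacent[OF x(1) y(1)] y(2) by metis
    then obtain a where a: "w = tens (x(i := a))" "a \<in> coord_space (K i)" by (auto simp: slice_def)
    have "a \<noteq> c *\<^sub>R x i" for c
      using w(2)[of c] tens_upd_scale[of x i c "x i"] a(1) by auto
    moreover have "a \<noteq> 0" using calculation[of 0] by simp
    ultimately show ?thesis using a by blast
  qed
  show ?thesis
  proof (cases "\<forall>w\<in>L. \<exists>c. w = c *\<^sub>R tens x")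
    case True
    \<comment> \<open>\<open>L\<close> lies in the line of \<open>tens x\<close>, which every slice
      contains, so any index will do.\<close>
    then have "L \<subseteq> slice K x undefined" using sp by auto
    then show ?thesis by (rule that)
  next
    case False
    then obtain v where v: "v \<in> L" "\<And>c. v \<noteq> c *\<^sub>R tens x" by blast
    from adj[OF this] obtain i a where a: "v = tens (x(i := a))" "a \<in> coord_space (K i)"
      "\<And>c. a \<noteq> c *\<^sub>R x i" "a \<noteq> 0" by blast
    have "w \<in> slice K x i" if w: "w \<in> L" for w
    proof (cases "\<exists>c. w = c *\<^sub>R tens x")
      case True then show ?thesis using sp by auto
    next
      case False
      with adj[OF w] obtain j b where b: "w = tens (x(j := b))" "b \<in> coord_space (K j)"
        "\<And>c. b \<noteq> c *\<^sub>R x j" "b \<noteq> 0" by blast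
      have "j = i"
      proof (rule ccontr)
        assume ji: "j \<noteq> i"
        have xn: "x k \<noteq> 0" for k using x by (simp add: nonzero_factors_def)
        have "w + v \<notin> decomposables K"
          unfolding a(1) b(1)
        proof (rule tens_add_not_decomposable[of _ _ i j])
          show "(x(i := a)) j \<noteq> c *\<^sub>R (x(j := b)) j" for c
            using parallel_sym[OF xn b(3)] ji by auto
        qed (use ji xn a b in auto)
        moreover have "w + v \<in> decomposables K" using L w v subspace_add by blast
        ultimately show False by blast
      qed
      then show ?thesis using b by (auto simp: slice_def)
    qed
    then show ?thesis using that by blast
  qed
qed

definition max_subspaces :: "('l::finite \<Rightarrow> 'k::finite set) \<Rightarrow> (real ^ ('l \<Rightarrow> 'k)) set set" where
  "max_subspaces K = {L. subspace L \<and> L \<subseteq> decomposables K \<and>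
     (\<forall>M. subspace M \<and> M \<subseteq> decomposables K \<and> L \<subseteq> M \<longrightarrow> M = L)}"

lemma coord_space_not_line:
  assumes "card S \<ge> 2"
  obtains a where "a \<in> coord_space S" "\<And>c. a \<noteq> c *\<^sub>R x"
proof -
  have "\<not> coord_space S \<subseteq> span {x}"
  proof
    assume "coord_space S \<subseteq> span {x}"
    then have "dim (coord_space S) \<le> dim (span {x})" by (rule dim_subset)
    also have "\<dots> \<le> card {x}" by (subst dim_span) (rule dim_le_card', simp)
    finally show False using assms by (simp add: dim_coord_space)
  qed
  then obtain a where "a \<in> coord_space S" "a \<notin> span {x}" by blast
  then show ?thesis by (intro that[of a]) (auto simp: span_singleton)
qed

text \<open>Here dimension at least 2 is essential: a one-dimensional factor would give the line of
  \<open>tens x\<close>, which lies in every slice. A functional that kills \<open>x i\<close> but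
  not \<open>a\<close> tells the slices apart.\<close>

lemma slice_subset_iff:
  fixes K :: "'l::finite \<Rightarrow> 'k::finite set"
  assumes K: "\<And>i. card (K i) \<ge> 2" and x: "nonzero_factors K x" and sub: "slice K x i \<subseteq> slice K x j"
  shows "i = j"
proof (rule ccontr)
  assume ij: "i \<noteq> j"
  have xn: "x k \<noteq> 0" for k using x by (simp add: nonzero_factors_def)
  obtain a where a: "a \<in> coord_space (K i)" "\<And>c. a \<noteq> c *\<^sub>R x i"
    using coord_space_not_line[OF K] by metis
  obtain p where p: "p \<bullet> x i = 0" "p \<bullet> a \<noteq> 0"
    using exists_orthogonal_to_one[OF xn a(2)] by metis
  have "tens (x(i := a)) \<in> slice K x j" using a(1) sub by (auto simp: slice_def)
  then obtain b where b: "tens (x(i := a)) = tens (x(j := b))" by (auto simp: slice_def)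
  have "tens (x(i := p)) \<bullet> tens (x(i := a)) \<noteq> 0"
    unfolding inner_tens using p xn by (auto simp: prod_zero_iff)
  moreover have "tens (x(i := p)) \<bullet> tens (x(j := b)) = 0"
    unfolding inner_tens using p ij by (intro prod_zero) (auto intro!: bexI[of _ i])
  ultimately show False using b by simp
qed

text \<open>Together with injectivity this identifies the factors with the maximal subspaces through
  a point, so that a product over factors can be written without naming them.\<close>

lemma max_subspaces_through:
  fixes K :: "'l::finite \<Rightarrow> 'k::finite set"
  assumes K: "\<And>i. card (K i) \<ge> 2" and x: "nonzero_factors K x"
  shows "{L \<in> max_subspaces K. tens x \<in> L} = range (slice K x)" and "inj (slice K x)"
proof -
  show "inj (slice K x)" using slice_subset_iff[OF K x] by (intro injI) blast
  show "{L \<in> max_subspaces K. tens x \<in> L} = range (slice K x)"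
  proof (intro equalityI subsetI)
    fix L assume "L \<in> {L \<in> max_subspaces K. tens x \<in> L}"
    then have L: "subspace L" "L \<subseteq> decomposables K" "tens x \<in> L"
      and m: "\<And>M. subspace M \<Longrightarrow> M \<subseteq> decomposables K \<Longrightarrow> L \<subseteq> M \<Longrightarrow> M = L"
      by (auto simp: max_subspaces_def)
    obtain i where "L \<subseteq> slice K x i" using subspace_subset_slice[OF L(1,2) x L(3)] by metis
    then show "L \<in> range (slice K x)"
      using m[OF subspace_slice slice_subset[OF x]] by blast
  next
    fix L assume "L \<in> range (slice K x)"
    then obtain i where i: "L = slice K x i" by blast
    have "M = L" if M: "subspace M" "M \<subseteq> decomposables K" "L \<subseteq> M" for M
    proof -
      have "tens x \<in> M" using M(3) tens_in_slice[OF x] i by blast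
      then obtain j where "M \<subseteq> slice K x j" using subspace_subset_slice[OF M(1,2) x] by metis
      moreover have "i = j" using slice_subset_iff[OF K x] M(3) i calculation by blast
      ultimately show ?thesis using M(3) i by blast
    qed
    then show "L \<in> {L \<in> max_subspaces K. tens x \<in> L}"
      using slice_subset[OF x] tens_in_slice[OF x] subspace_slice i by (auto simp: max_subspaces_def)
  qed
qed

lemma GL_tensor_max_subspaces:
  assumes T: "T \<in> GL_tensor K" and L: "L \<in> max_subspaces K"
  shows "T ` L \<in> max_subspaces K"
proof -
  obtain S where S: "S \<in> GL_tensor K" "\<And>x. x \<in> tensor_space K \<Longrightarrow> S (T x) = x"
    "\<And>x. x \<in> tensor_space K \<Longrightarrow> T (S x) = x"
    using GL_tensor_inverse[OF T] by metis
  have lin: "linear T" "linear S" using T S(1) by (auto simp: GL_tensor_def)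
  have dec: "T ` decomposables K = decomposables K" "S ` decomposables K = decomposables K"
    using GL_tensor_image_decomposables T S(1) by auto
  have L': "subspace L" "L \<subseteq> decomposables K"
    and m: "\<And>M. subspace M \<Longrightarrow> M \<subseteq> decomposables K \<Longrightarrow> L \<subseteq> M \<Longrightarrow> M = L"
    using L by (auto simp: max_subspaces_def)
  have "M = T ` L" if M: "subspace M" "M \<subseteq> decomposables K" "T ` L \<subseteq> M" for M
  proof -
    have LV: "L \<subseteq> tensor_space K" and MV: "M \<subseteq> tensor_space K"
      using L'(2) M(2) decomposables_subset by blast+
    have "S ` T ` L = L" using S(2) LV by (force simp: image_comp)
    then have "L \<subseteq> S ` M" using image_mono[OF M(3), of S] by simp
    moreover have "S ` M \<subseteq> decomposables K" using image_mono[OF M(2), of S] dec by simp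
    ultimately have "S ` M = L" using m linear_subspace_image[OF lin(2) M(1)] by blast
    moreover have "T ` S ` M = M" using S(3) MV by (force simp: image_comp)
    ultimately show ?thesis by simp
  qed
  moreover have "T ` L \<subseteq> decomposables K" using image_mono[OF L'(2), of T] dec by simp
  ultimately show ?thesis
    using linear_subspace_image[OF lin(1) L'(1)] by (simp add: max_subspaces_def)
qed

subsection \<open>Tensorial bodies and their factors\<close>

lemma body_Int_subspace:
  fixes V :: "'a::euclidean_space set"
  assumes "subspace V" "subspace L" "L \<subseteq> V" "P \<in> sym_convex_bodies V"
  shows "P \<inter> L \<in> sym_convex_bodies L"
proof -
  obtain r where "r > 0" "\<And>x. x \<in> V \<Longrightarrow> norm x \<le> r \<Longrightarrow> x \<in> P"
    using sym_convex_bodies_inner[OF assms(1,4)] by metis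
  then show ?thesis
    using assms unfolding sym_convex_bodies_iff[OF assms(1)] sym_convex_bodies_iff[OF assms(2)]
    by (auto simp: compact_Int_closed closed_subspace convex_Int subspace_imp_convex subspace_neg intro!: exI[of _ r])
qed

text \<open>Hahn-Banach separation of \<open>x /\<^sub>R s\<close> from \<open>P\<close>, with the
  normal projected to \<open>V\<close> because the polar is taken there. As 0 lies in
  \<open>P\<close>, the level \<open>b\<close> is negative, and dividing by it reverses the
  inequalities.\<close>

lemma mgauge_support:
  fixes V :: "'a::euclidean_space set"
  assumes V: "subspace V" and P: "P \<in> sym_convex_bodies V" and x: "x \<in> V" "x \<noteq> 0" and s: "0 < s" "s < mgauge P x"
  obtains \<phi> where "\<phi> \<in> polar_in V P" "\<phi> \<bullet> x > s"
proof -
  have nin: "x /\<^sub>R s \<notin> P" using mgauge_le_iff[OF V P x(1) s(1)] s by simp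
  have P': "convex P" "closed P" "P \<subseteq> V" "0 \<in> P"
    using P sym_convex_bodies_zero[OF V P] by (auto simp: sym_convex_bodies_iff[OF V] compact_imp_closed)
  obtain a b where ab: "a \<bullet> (x /\<^sub>R s) < b" "\<And>y. y \<in> P \<Longrightarrow> a \<bullet> y > b"
    using separating_hyperplane_closed_point[OF P'(1,2) nin] by metis
  have b: "b < 0" using ab(2)[OF P'(4)] by simp
  obtain p q where pq: "p \<in> span V" "\<And>w. w \<in> span V \<Longrightarrow> orthogonal q w" "a = p + q"
    using orthogonal_subspace_decomp_exists[of V a] by metis
  have pV: "p \<in> V" using pq V by (metis span_eq_iff)
  have ay: "a \<bullet> y = p \<bullet> y" if "y \<in> V" for y
    using pq(2)[OF span_base[OF that]] by (simp add: pq(3) inner_add_left orthogonal_def)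
  define \<phi> where "\<phi> = (1 / b) *\<^sub>R p"
  have "y \<bullet> \<phi> \<le> 1" if "y \<in> P" for y
  proof -
    have "p \<bullet> y > b" using ab(2)[OF that] ay P'(3) that by auto
    then show ?thesis using b by (simp add: \<phi>_def inner_commute[of y] field_simps)
  qed
  then have "\<phi> \<in> polar_in V P" using pV V by (auto simp: polar_in_def \<phi>_def subspace_scale)
  moreover have "p \<bullet> x < b * s"
    using ab(1) ay[OF subspace_scale[OF V x(1)], of "inverse s"] s by (simp add: field_simps)
  then have "\<phi> \<bullet> x > s" using b by (simp add: \<phi>_def field_simps)
  ultimately show ?thesis by (rule that)
qed


text \<open>\<open>mgauge_support\<close> approximates a gauge only strictly from below. Here all
  factors are shrunk by \<open>1 - 1 / (n + 2)\<close>, which lies strictly between 0 and 1 for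
  every \<open>n\<close>, and \<open>n\<close> tends to infinity.\<close>

lemma prod_le_if_pointwise_approx:
  fixes f g :: "'a \<Rightarrow> real"
  assumes "finite I" "\<And>i. i \<in> I \<Longrightarrow> f i > 0" "c \<ge> 0"
    and le: "\<And>s. (\<And>i. i \<in> I \<Longrightarrow> 0 < s i \<and> s i < f i) \<Longrightarrow> (\<Prod>i\<in>I. s i) \<le> c"
  shows "(\<Prod>i\<in>I. f i) \<le> c"
proof -
  have "(1 - 1 / real (n + 2)) ^ card I * (\<Prod>i\<in>I. f i) \<le> c" for n
  proof -
    have q: "0 < 1 - 1 / real (n + 2)" "1 - 1 / real (n + 2) < 1" by (auto simp: field_simps)
    have "(\<Prod>i\<in>I. (1 - 1 / real (n + 2)) * f i) \<le> c"
      using assms(2) mult_pos_pos[OF q(1)] mult_strict_right_mono[OF q(2)] by (intro le) auto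
    then show ?thesis by (simp add: prod.distrib)
  qed
  moreover have "(\<lambda>n. (1 - 1 / real (n + 2)) ^ card I * (\<Prod>i\<in>I. f i)) \<longlonglongrightarrow> (1 - 0) ^ card I * (\<Prod>i\<in>I. f i)"
    by (intro tendsto_intros LIMSEQ_ignore_initial_segment[OF lim_1_over_n])
  ultimately show ?thesis by (intro LIMSEQ_le_const2[of "\<lambda>n. (1 - 1 / real (n + 2)) ^ card I * (\<Prod>i\<in>I. f i)"]) auto
qed

lemma tens_in_proj_tensor: "(\<And>i. x i \<in> P i) \<Longrightarrow> tens x \<in> proj_tensor P"
  unfolding proj_tensor_def by (intro hull_inc) auto

text \<open>The projective product inside \<open>P\<close> bounds the gauge from above by
  normalising each factor, the injective one bounds it from below by testing with products of
  support functionals. On decomposable tensors the two bounds agree, so there \<open>P\<close> is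
  determined by its factors.\<close>

lemma mgauge_tens:
  fixes K :: "'l::finite \<Rightarrow> 'k::finite set"
  assumes P: "P \<in> sym_convex_bodies (tensor_space K)"
    and Q: "\<And>i. Q i \<in> sym_convex_bodies (coord_space (K i))"
    and sub: "proj_tensor Q \<subseteq> P" "P \<subseteq> inj_tensor K Q" and x: "nonzero_factors K x"
  shows "mgauge P (tens x) = (\<Prod>i\<in>UNIV. mgauge (Q i) (x i))"
proof (rule antisym)
  let ?g = "\<lambda>i. mgauge (Q i) (x i)"
  note V = subspace_tensor_space[of K] and C = subspace_coord_space
  have xi: "x i \<in> coord_space (K i)" "x i \<noteq> 0" for i using x by (auto simp: nonzero_factors_def)
  have xV: "tens x \<in> tensor_space K" using xi by (intro tens_in_tensor_space)
  have g: "?g i > 0" for i using mgauge_pos[OF C Q xi] .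
  show "mgauge P (tens x) \<le> (\<Prod>i\<in>UNIV. ?g i)"
  proof -
    have p: "(\<Prod>i\<in>UNIV. ?g i) > 0" using g by (intro prod_pos) auto
    have "tens (\<lambda>i. inverse (?g i) *\<^sub>R x i) \<in> P"
      using mgauge_normalized[OF C Q xi] sub(1) by (intro subsetD[OF sub(1)] tens_in_proj_tensor)
    then have "tens x /\<^sub>R (\<Prod>i\<in>UNIV. ?g i) \<in> P"
      unfolding tens_scale using prod_inversef[of ?g UNIV] by (simp add: o_def)
    then show ?thesis using mgauge_le_iff[OF V P xV p] by simp
  qed
  show "(\<Prod>i\<in>UNIV. ?g i) \<le> mgauge P (tens x)"
  proof (rule prod_le_if_pointwise_approx)
    fix s assume "\<And>i. i \<in> UNIV \<Longrightarrow> 0 < s i \<and> s i < ?g i"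
    then have s: "0 < s i" "s i < ?g i" for i by auto
    have "\<exists>p. p \<in> polar_in (coord_space (K i)) (Q i) \<and> p \<bullet> x i > s i" for i
      using mgauge_support[OF C Q xi s] by metis
    then obtain \<phi> where \<phi>: "\<And>i. \<phi> i \<in> polar_in (coord_space (K i)) (Q i)" "\<And>i. \<phi> i \<bullet> x i > s i"
      by metis
    have \<phi>P: "tens \<phi> \<in> proj_tensor (\<lambda>i. polar_in (coord_space (K i)) (Q i))"
      using \<phi>(1) by (rule tens_in_proj_tensor)
    have le: "tens \<phi> \<bullet> p \<le> 1" if "p \<in> P" for p
      using that sub(2) \<phi>P unfolding inj_tensor_def polar_in_def[of "tensor_space K"] by blast
    have "(\<Prod>i\<in>UNIV. s i) \<le> (\<Prod>i\<in>UNIV. \<phi> i \<bullet> x i)"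
      using s \<phi>(2) by (intro prod_mono) (auto intro: less_imp_le)
    also have "\<dots> = tens \<phi> \<bullet> tens x" by (simp add: inner_tens)
    also have "\<dots> \<le> mgauge P (tens x)"
    proof -
      have m: "mgauge P (tens x) > 0" using mgauge_pos[OF V P xV] nonzero_factors_tens(2)[OF x] .
      have "tens \<phi> \<bullet> (tens x /\<^sub>R mgauge P (tens x)) \<le> 1"
        by (intro le mgauge_normalized[OF V P xV] nonzero_factors_tens(2)[OF x])
      then show ?thesis using m by (simp add: field_simps)
    qed
    finally show "(\<Prod>i\<in>UNIV. s i) \<le> mgauge P (tens x)" .
  qed (use g mgauge_nonneg[OF V P xV] in auto)
qed

section \<open>The interpolated gauge on decomposable tensors\<close>

text \<open>In terms of the factors this is \<open>\<Prod>i. (1 - t) g\<^sub>i + t e\<^sub>i\<close> with \<open>g\<^sub>i\<close> the gauge of \<open>Q\<^sub>i\<close> and \<open>e\<^sub>i\<close>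
  its moment norm (lemma \<open>deform_gauge_factors\<close>), but the form with maximal linear subspaces is
  visibly equivariant.\<close>

definition deform_gauge ::
  "('l::finite \<Rightarrow> 'k::finite set) \<Rightarrow> real \<Rightarrow> (real ^ ('l \<Rightarrow> 'k)) set \<Rightarrow> real ^ ('l \<Rightarrow> 'k) \<Rightarrow> real" where
  "deform_gauge K t P u = mgauge P u *
     (\<Prod>L\<in>{L \<in> max_subspaces K. u \<in> L}. (1 - t) + t * (moment_norm (P \<inter> L) u / mgauge P u))"

lemma moment_norm_scale:
  assumes "subspace L" "Q \<in> sym_convex_bodies L"
  shows "moment_norm Q (c *\<^sub>R u) = \<bar>c\<bar> * moment_norm Q u"
proof -
  note b = linear_subspace_image[OF linear_emb assms(1)] emb_body[OF assms]
  have 1: "moment_form (emb ` Q) (c *\<^sub>R v) z = c * moment_form (emb ` Q) v z" for v z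
    using linear_scale[OF moment_form_linear[OF b]] by simp
  have "moment_form (emb ` Q) (c *\<^sub>R v) (c *\<^sub>R v) = c\<^sup>2 * moment_form (emb ` Q) v v" for v
    using 1[of v "c *\<^sub>R v"] 1[of v v] moment_form_sym[OF b, of v "c *\<^sub>R v"]
    by (simp add: power2_eq_square)
  then show ?thesis
    by (simp add: moment_norm_def linear_scale[OF linear_emb] real_sqrt_mult)
qed

text \<open>By \<open>mgauge_tens\<close> the section of \<open>P\<close> by a slice is a copy of
  \<open>Q i\<close> scaled by the gauges of the remaining factors. For \<open>w\<close> these
  gauges are 1, so its slices serve as reference copies and linear equivariance transfers the moment
  norm from them.\<close>

lemma moment_norm_slice:
  fixes K :: "'l::finite \<Rightarrow> 'k::finite set"
  assumes P: "P \<in> sym_convex_bodies (tensor_space K)"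
    and Q: "\<And>i. Q i \<in> sym_convex_bodies (coord_space (K i))"
    and sub: "proj_tensor Q \<subseteq> P" "P \<subseteq> inj_tensor K Q"
    and w: "nonzero_factors K w" "\<And>i. mgauge (Q i) (w i) = 1" and x: "nonzero_factors K x"
  shows "moment_norm (P \<inter> slice K x i) (tens x) =
    (\<Prod>j\<in>UNIV - {i}. mgauge (Q j) (x j)) * moment_norm (P \<inter> slice K w i) (tens (w(i := x i)))"
proof -
  let ?C = "coord_space (K i)"
  note V = subspace_tensor_space[of K] and C = subspace_coord_space
  have xi: "x i \<in> coord_space (K i)" "x i \<noteq> 0" for i using x by (auto simp: nonzero_factors_def)
  define c where "c = (\<Prod>j\<in>UNIV - {i}. mgauge (Q j) (x j))"
  have c: "c > 0" unfolding c_def using mgauge_pos[OF C Q xi] by (intro prod_pos) auto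
  have sV: "slice K v i \<subseteq> tensor_space K" if "nonzero_factors K v" for v
    using slice_subset[OF that] decomposables_subset by blast
  obtain h where h: "linear h" "\<And>y. y \<in> ?C \<Longrightarrow> h (tens (w(i := y))) = y"
    using linear_exists_left_inverse_on[OF linear_tens_upd C inj_on_subset[OF inj_tens_upd[OF w(1)]]]
    by (metis subset_UNIV)
  \<comment> \<open>\<open>h\<close> reads off the varying factor in the slice through
    \<open>w\<close>; the division by \<open>c\<close> makes \<open>f\<close> carry one section of
    \<open>P\<close> onto the other.\<close>
  define f where "f = (\<lambda>z. inverse c *\<^sub>R tens (x(i := h z)))"
  have lf: "linear f"
    unfolding f_def by (intro linear_compose_scale_right linear_compose[OF h(1) linear_tens_upd, unfolded o_def])
  have f: "f (tens (w(i := y))) = tens (x(i := inverse c *\<^sub>R y))" if "y \<in> ?C" for y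
    using h(2)[OF that] by (simp add: f_def tens_upd_scale)
  have f_inj: "inj_on f (slice K w i)"
  proof (rule inj_onI)
    fix z z' assume zz: "z \<in> slice K w i" "z' \<in> slice K w i" "f z = f z'"
    then obtain y y' where y: "z = tens (w(i := y))" "y \<in> ?C" "z' = tens (w(i := y'))" "y' \<in> ?C"
      by (auto simp: slice_def)
    then have "tens (x(i := inverse c *\<^sub>R y)) = tens (x(i := inverse c *\<^sub>R y'))"
      using zz(3) f by simp
    then have "inverse c *\<^sub>R y = inverse c *\<^sub>R y'" by (rule injD[OF inj_tens_upd[OF x]])
    then show "z = z'" using c y by simp
  qed
  have mg: "mgauge P (tens (v(i := y))) = (\<Prod>j\<in>UNIV - {i}. mgauge (Q j) (v j)) * mgauge (Q i) y"
    if v: "nonzero_factors K v" and y: "y \<in> ?C" for v y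
  proof (cases "y = 0")
    case True
    then have "tens (v(i := y)) = 0" by (auto simp: tens_eq_0_iff intro: exI[of _ i])
    then show ?thesis using mgauge_0[OF V P] mgauge_0[OF C Q] True by simp
  next
    case False
    then have "nonzero_factors K (v(i := y))" using v y by (auto simp: nonzero_factors_def)
    then have "mgauge P (tens (v(i := y))) = (\<Prod>j\<in>UNIV. mgauge (Q j) ((v(i := y)) j))"
      by (rule mgauge_tens[OF P Q sub])
    also have "\<dots> = mgauge (Q i) ((v(i := y)) i) * (\<Prod>j\<in>UNIV - {i}. mgauge (Q j) ((v(i := y)) j))"
      by (rule prod.remove) auto
    also have "(\<Prod>j\<in>UNIV - {i}. mgauge (Q j) ((v(i := y)) j)) = (\<Prod>j\<in>UNIV - {i}. mgauge (Q j) (v j))"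
      by (rule prod.cong) auto
    finally show ?thesis by (simp only: fun_upd_same mult.commute)
  qed
  have mem: "tens (v(i := y)) \<in> P \<longleftrightarrow> (\<Prod>j\<in>UNIV - {i}. mgauge (Q j) (v j)) * mgauge (Q i) y \<le> 1"
    if v: "nonzero_factors K v" and y: "y \<in> ?C" for v y
  proof -
    have "tens (v(i := y)) \<in> tensor_space K"
      using v y by (intro tens_in_tensor_space) (auto simp: nonzero_factors_def)
    from mgauge_le_1_iff[OF V P this] show ?thesis by (simp only: mg[OF v y])
  qed
  have im: "f ` (P \<inter> slice K w i) = P \<inter> slice K x i"
  proof (intro equalityI subsetI)
    fix z assume "z \<in> f ` (P \<inter> slice K w i)"
    then obtain y where y: "tens (w(i := y)) \<in> P" "y \<in> ?C" "z = f (tens (w(i := y)))"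
      by (auto simp: slice_def)
    have cy: "inverse c *\<^sub>R y \<in> ?C" using y(2) C by (rule subspace_scale[rotated])
    have "mgauge (Q i) y \<le> 1" using mem[OF w(1) y(2)] y(1) w(2) by simp
    then have "c * mgauge (Q i) (inverse c *\<^sub>R y) \<le> 1"
      using mgauge_scale[OF C Q y(2)] c by (simp add: field_simps)
    then show "z \<in> P \<inter> slice K x i"
      using mem[OF x cy] cy y by (auto simp: f c_def slice_def)
  next
    fix z assume "z \<in> P \<inter> slice K x i"
    then obtain y where y: "tens (x(i := y)) \<in> P" "y \<in> ?C" "z = tens (x(i := y))"
      by (auto simp: slice_def)
    have cy: "c *\<^sub>R y \<in> ?C" using y(2) C by (rule subspace_scale[rotated])
    have "c * mgauge (Q i) y \<le> 1" using mem[OF x y(2)] y(1) by (simp add: c_def)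
    then have "tens (w(i := c *\<^sub>R y)) \<in> P"
      using mem[OF w(1) cy] mgauge_scale[OF C Q y(2)] c w(2) by simp
    moreover have "z = f (tens (w(i := c *\<^sub>R y)))" using f[OF cy] c y by simp
    ultimately show "z \<in> f ` (P \<inter> slice K w i)" using cy by (auto simp: slice_def)
  qed
  have bw: "P \<inter> slice K w i \<in> sym_convex_bodies (slice K w i)"
    by (rule body_Int_subspace[OF V subspace_slice sV[OF w(1)] P])
  have bx: "P \<inter> slice K x i \<in> sym_convex_bodies (slice K x i)"
    by (rule body_Int_subspace[OF V subspace_slice sV[OF x] P])
  have "tens (w(i := x i)) \<in> slice K w i" using xi by (auto simp: slice_def)
  then have "moment_norm (f ` (P \<inter> slice K w i)) (f (tens (w(i := x i)))) =
      moment_norm (P \<inter> slice K w i) (tens (w(i := x i)))"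
    by (rule moment_norm_linear_image[OF subspace_slice bw lf f_inj])
  moreover have "f (tens (w(i := x i))) = inverse c *\<^sub>R tens x"
    using f[OF xi(1)] tens_upd_scale[of x i "inverse c" "x i"] by simp
  ultimately have "inverse c * moment_norm (P \<inter> slice K x i) (tens x) =
      moment_norm (P \<inter> slice K w i) (tens (w(i := x i)))"
    using moment_norm_scale[OF subspace_slice bx] c by (simp add: im)
  then show ?thesis using c unfolding c_def[symmetric] by (simp add: field_simps)
qed

text \<open>The moment norm comes from an inner product, pulled back to the factor by
  \<open>J\<close>. The isometry \<open>A\<close> goes from the Euclidean norm to this form, and
  \<open>B\<close> is its inverse on the coordinate space.\<close>

lemma moment_norm_slice_euclidean:
  fixes K :: "'l::finite \<Rightarrow> 'k::finite set"
  assumes P: "P \<in> sym_convex_bodies (tensor_space K)" and w: "nonzero_factors K w"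
  obtains B where "linear B" "B ` coord_space (K i) = coord_space (K i)" "inj_on B (coord_space (K i))"
    "\<And>y. y \<in> coord_space (K i) \<Longrightarrow> moment_norm (P \<inter> slice K w i) (tens (w(i := y))) = norm (B y)"
proof -
  let ?C = "coord_space (K i)"
  let ?S = "emb ` (P \<inter> slice K w i)"
  define J where "J = (\<lambda>y. emb (tens (w(i := y))))"
  have lJ: "linear J" unfolding J_def
    by (rule linear_compose[OF linear_tens_upd linear_emb, unfolded o_def])
  have inJ: "inj J" unfolding J_def
    using inj_compose[OF inj_emb inj_tens_upd[OF w]] by (simp add: o_def)
  have "slice K w i \<subseteq> tensor_space K" using slice_subset[OF w] decomposables_subset by blast
  then have b: "P \<inter> slice K w i \<in> sym_convex_bodies (slice K w i)"
    by (rule body_Int_subspace[OF subspace_tensor_space subspace_slice _ P])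
  note b' = linear_subspace_image[OF linear_emb subspace_slice] emb_body[OF subspace_slice b]
  have lin: "linear (\<lambda>y. moment_form ?S (J y) (J z))" for z
    using linear_compose[OF lJ moment_form_linear[OF b']] by (simp add: o_def)
  have pos: "moment_form ?S (J y) (J y) > 0" if "y \<noteq> 0" for y
    using moment_form_pos[OF b'] that lJ inJ by (metis linear_injective_0)
  obtain A where A: "linear A" "A ` ?C = ?C" "inj_on A ?C"
    "\<And>y. y \<in> ?C \<Longrightarrow> moment_form ?S (J (A y)) (J (A y)) = y \<bullet> y"
    by (rule isometry_for_form[OF lin moment_form_sym[OF b'] subspace_coord_space pos], assumption, rule that)
  obtain B where B: "linear B" "\<And>y. y \<in> ?C \<Longrightarrow> B (A y) = y"
    using linear_exists_left_inverse_on[OF A(1) subspace_coord_space A(3)] by blast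
  have "B ` ?C = ?C" using A(2) B(2) by (metis (no_types, lifting) image_comp image_cong image_ident o_apply)
  moreover have "inj_on B ?C" using A(2) B(2) by (metis (no_types, lifting) imageE inj_onI)
  moreover have "moment_norm (P \<inter> slice K w i) (tens (w(i := y))) = norm (B y)" if y: "y \<in> ?C" for y
  proof -
    obtain z where z: "z \<in> ?C" "y = A z" using y A(2) by blast
    have "moment_norm (P \<inter> slice K w i) (tens (w(i := y))) = sqrt (z \<bullet> z)"
      unfolding moment_norm_def A(4)[OF z(1), symmetric] by (simp add: J_def z(2))
    then show ?thesis using B(2)[OF z(1)] z(2) by (simp add: norm_eq_sqrt_inner)
  qed
  ultimately show ?thesis using that B(1) by metis
qed

lemma prod_max_subspaces_through:
  fixes K :: "'l::finite \<Rightarrow> 'k::finite set"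
  assumes K: "\<And>i. card (K i) \<ge> 2" and x: "nonzero_factors K x"
  shows "(\<Prod>L\<in>{L \<in> max_subspaces K. tens x \<in> L}. F L) = (\<Prod>i\<in>UNIV. F (slice K x i))"
  unfolding max_subspaces_through(1)[OF K x] using prod.reindex[OF max_subspaces_through(2)[OF K x]]
  by (simp add: o_def)

text \<open>The base tensor \<open>w\<close> with unit gauges is fixed before \<open>x\<close> and
  \<open>t\<close>, so that one map \<open>B i\<close> per factor serves all of them.\<close>

lemma deform_gauge_factors:
  fixes K :: "'l::finite \<Rightarrow> 'k::finite set"
  assumes K: "\<And>i. card (K i) \<ge> 2"
    and P: "P \<in> sym_convex_bodies (tensor_space K)"
    and Q: "\<And>i. Q i \<in> sym_convex_bodies (coord_space (K i))"
    and sub: "proj_tensor Q \<subseteq> P" "P \<subseteq> inj_tensor K Q"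
  obtains B where "\<And>i. linear (B i)" "\<And>i. B i ` coord_space (K i) = coord_space (K i)"
    "\<And>i. inj_on (B i) (coord_space (K i))"
    "\<And>t x. nonzero_factors K x \<Longrightarrow>
      deform_gauge K t P (tens x) = (\<Prod>i\<in>UNIV. (1 - t) * mgauge (Q i) (x i) + t * norm (B i (x i)))"
proof -
  note C = subspace_coord_space
  have "\<exists>y. y \<in> coord_space (K i) \<and> y \<noteq> 0 \<and> mgauge (Q i) y = 1" for i
  proof -
    obtain a where a: "a \<in> coord_space (K i)" "\<And>c. a \<noteq> c *\<^sub>R (0 :: real ^ 'k)"
      using coord_space_not_line[OF K, of i "0 :: real ^ 'k"] by metis
    then have a0: "a \<noteq> 0" by auto
    have g: "mgauge (Q i) a > 0" by (rule mgauge_pos[OF C Q a(1) a0])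
    have "mgauge (Q i) (a /\<^sub>R mgauge (Q i) a) = 1"
      using mgauge_scale_pos[OF C Q a(1), of "inverse (mgauge (Q i) a)"] g by simp
    moreover have "a /\<^sub>R mgauge (Q i) a \<in> coord_space (K i)" using a(1) C by (rule subspace_scale[rotated])
    moreover have "a /\<^sub>R mgauge (Q i) a \<noteq> 0" using g a0 by simp
    ultimately show ?thesis by blast
  qed
  then obtain w where w: "\<And>i. w i \<in> coord_space (K i)" "\<And>i. w i \<noteq> 0" "\<And>i. mgauge (Q i) (w i) = 1"
    by metis
  have nw: "nonzero_factors K w" using w by (simp add: nonzero_factors_def)
  have "\<exists>B. linear B \<and> B ` coord_space (K i) = coord_space (K i) \<and> inj_on B (coord_space (K i)) \<and>
    (\<forall>y\<in>coord_space (K i). moment_norm (P \<inter> slice K w i) (tens (w(i := y))) = norm (B y))" for i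
    using moment_norm_slice_euclidean[OF P nw, of i] by metis
  then obtain B where B: "\<And>i. linear (B i)" "\<And>i. B i ` coord_space (K i) = coord_space (K i)"
    "\<And>i. inj_on (B i) (coord_space (K i))"
    and e: "\<And>i y. y \<in> coord_space (K i) \<Longrightarrow> moment_norm (P \<inter> slice K w i) (tens (w(i := y))) = norm (B i y)"
    by metis
  have "deform_gauge K t P (tens x) = (\<Prod>i\<in>UNIV. (1 - t) * mgauge (Q i) (x i) + t * norm (B i (x i)))"
    if x: "nonzero_factors K x" for t x
  proof -
    let ?g = "\<lambda>i. mgauge (Q i) (x i)"
    have xi: "x i \<in> coord_space (K i)" "x i \<noteq> 0" for i using x by (auto simp: nonzero_factors_def)
    have g: "?g i > 0" for i using mgauge_pos[OF C Q xi] .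
    \<comment> \<open>Both terms of the ratio contain the gauges of the factors other than
      \<open>i\<close>; these cancel and leave a quantity of the \<open>i\<close>-th factor
      alone.\<close>
    have r: "moment_norm (P \<inter> slice K x i) (tens x) / mgauge P (tens x) = norm (B i (x i)) / ?g i" for i
    proof -
      have 1: "(\<Prod>j\<in>UNIV. ?g j) = ?g i * (\<Prod>j\<in>UNIV - {i}. ?g j)" by (rule prod.remove) auto
      have 2: "(\<Prod>j\<in>UNIV - {i}. ?g j) > 0" using g by (intro prod_pos) auto
      have 3: "p * a / (b * p) = a / b" if "p > 0" for p a b :: real using that by simp
      show ?thesis
        unfolding moment_norm_slice[OF P Q sub nw w(3) x] mgauge_tens[OF P Q sub x] e[OF xi(1)] 1
        by (rule 3[OF 2])
    qed
    have "deform_gauge K t P (tens x) =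
        (\<Prod>i\<in>UNIV. ?g i) * (\<Prod>i\<in>UNIV. (1 - t) + t * (norm (B i (x i)) / ?g i))"
      unfolding deform_gauge_def prod_max_subspaces_through[OF K x] r
      unfolding mgauge_tens[OF P Q sub x] ..
    also have "\<dots> = (\<Prod>i\<in>UNIV. ?g i * ((1 - t) + t * (norm (B i (x i)) / ?g i)))"
      by (simp add: prod.distrib)
    also have "\<dots> = (\<Prod>i\<in>UNIV. (1 - t) * ?g i + t * norm (B i (x i)))"
    proof (rule prod.cong[OF refl])
      fix i show "?g i * ((1 - t) + t * (norm (B i (x i)) / ?g i)) = (1 - t) * ?g i + t * norm (B i (x i))"
        using g[of i] by (simp add: field_simps)
    qed
    finally show ?thesis .
  qed
  then show ?thesis by (rule that[OF B])
qed

subsection \<open>Projective tensor products are tensorial bodies\<close>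

lemma axis_eq_tens: "axis f 1 = tens (\<lambda>i. axis (f i) 1)"
proof -
  have "(\<Prod>i\<in>UNIV. axis (f i) (1::real) $ g i) = (if g = f then 1 else 0)" for g
  proof (cases "g = f")
    case False
    then obtain i where "g i \<noteq> f i" by auto
    then have "(\<Prod>i\<in>UNIV. axis (f i) (1::real) $ g i) = 0"
      by (intro prod_zero) (auto intro!: bexI[of _ i] simp: axis_def)
    with False show ?thesis by simp
  qed (simp add: axis_def)
  then show ?thesis by (simp add: vec_eq_iff tens_def axis_def)
qed

lemma tensor_space_subset_span:
  "tensor_space K \<subseteq> span {tens x | x. \<forall>i. x i \<in> coord_space (K i)}"
proof
  fix z assume z: "z \<in> tensor_space K"
  have "z = (\<Sum>f\<in>UNIV. z $ f *\<^sub>R axis f 1)"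
    using basis_expansion[of z] by (simp add: scalar_mult_eq_scaleR)
  also have "\<dots> \<in> span {tens x | x. \<forall>i. x i \<in> coord_space (K i)}"
  proof (rule span_sum)
    fix f :: "'a \<Rightarrow> 'b"
    show "z $ f *\<^sub>R axis f 1 \<in> span {tens x | x. \<forall>i. x i \<in> coord_space (K i)}"
    proof (cases "f \<in> Pi UNIV K")
      case True
      then have "axis (f i) 1 \<in> coord_space (K i)" for i by (auto simp: coord_space_def axis_def)
      then show ?thesis unfolding axis_eq_tens by (intro span_scale span_base) auto
    next
      case False
      then have "z $ f = 0" using z unfolding tensor_space_def coord_space_def by blast
      then show ?thesis by (simp add: span_zero)
    qed
  qed
  finally show "z \<in> span {tens x | x. \<forall>i. x i \<in> coord_space (K i)}" .
qed

lemma convex_hull_sym: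
  assumes "\<And>x. x \<in> S \<Longrightarrow> - x \<in> S" "x \<in> convex hull S" shows "- x \<in> convex hull S"
proof -
  have "linear (uminus :: 'a \<Rightarrow> 'a)" by (rule linearI) auto
  from convex_hull_linear_image[OF this, of S] assms(2)
  have "- x \<in> convex hull (uminus ` S)" by (metis imageI)
  also have "\<dots> \<subseteq> convex hull S" using assms(1) by (intro hull_mono) auto
  finally show ?thesis .
qed

text \<open>Tuples of factors are read as vectors of vectors, where the product of the
  \<open>Q i\<close> is closed and bounded, and \<open>tens\<close> is continuous.\<close>

lemma compact_tens_image:
  fixes Q :: "'l::finite \<Rightarrow> (real ^ 'k::finite) set"
  assumes "\<And>i. compact (Q i)"
  shows "compact {tens x | x. \<forall>i. x i \<in> Q i}"
proof -
  define S where "S = {v :: (real ^ 'k) ^ 'l. \<forall>i. v $ i \<in> Q i}"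
  have "S = (\<Inter>i. (\<lambda>v. v $ i) -` Q i)" by (auto simp: S_def)
  then have "closed S"
    using assms by (auto intro!: closed_INT closed_vimage continuous_intros simp: compact_imp_closed)
  moreover have "bounded S"
  proof -
    have "\<exists>b. \<forall>x\<in>Q i. norm x \<le> b" for i
      using compact_imp_bounded[OF assms, of i] by (auto simp: bounded_iff)
    then obtain b where b: "\<And>i x. x \<in> Q i \<Longrightarrow> norm x \<le> b i" by metis
    have "norm v \<le> (\<Sum>i\<in>UNIV. b i)" if "v \<in> S" for v
    proof -
      have "norm v \<le> (\<Sum>i\<in>UNIV. norm (v $ i))"
        unfolding norm_vec_def by (rule L2_set_le_sum) simp
      also have "\<dots> \<le> (\<Sum>i\<in>UNIV. b i)" using that b by (intro sum_mono) (auto simp: S_def)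
      finally show ?thesis .
    qed
    then show ?thesis by (auto simp: bounded_iff)
  qed
  ultimately have "compact S" by (simp add: compact_eq_bounded_closed)
  moreover have "continuous_on S (\<lambda>v. tens (\<lambda>i. v $ i))"
    unfolding tens_def by (intro continuous_intros)
  ultimately have "compact ((\<lambda>v. tens (\<lambda>i. v $ i)) ` S)" by (rule compact_continuous_image[rotated])
  also have "(\<lambda>v. tens (\<lambda>i. v $ i)) ` S = {tens x | x. \<forall>i. x i \<in> Q i}"
  proof (intro equalityI subsetI)
    fix z assume "z \<in> {tens x | x. \<forall>i. x i \<in> Q i}"
    then obtain x where x: "z = tens x" "\<forall>i. x i \<in> Q i" by blast
    then show "z \<in> (\<lambda>v. tens (\<lambda>i. v $ i)) ` S"
      by (intro image_eqI[of _ _ "\<chi> i. x i"]) (auto simp: S_def)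
  qed (auto simp: S_def)
  finally show ?thesis .
qed

lemma proj_tensor_sym_convex:
  fixes K :: "'l::finite \<Rightarrow> 'k::finite set"
  assumes Q: "\<And>i. Q i \<in> sym_convex_bodies (coord_space (K i))"
  shows "proj_tensor Q \<in> sym_convex_bodies (tensor_space K)"
proof -
  note V = subspace_tensor_space[of K] and C = subspace_coord_space
  let ?G = "{tens x | x. \<forall>i. x i \<in> Q i}"
  have Q': "Q i \<subseteq> coord_space (K i)" "compact (Q i)" "\<And>x. x \<in> Q i \<Longrightarrow> - x \<in> Q i" for i
    using Q[of i] by (auto simp: sym_convex_bodies_iff[OF C])
  have cpt: "compact (proj_tensor Q)"
    unfolding proj_tensor_def by (intro compact_convex_hull compact_tens_image Q')
  have cvx: "convex (proj_tensor Q)" unfolding proj_tensor_def by (rule convex_convex_hull)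
  have sub: "proj_tensor Q \<subseteq> tensor_space K"
    unfolding proj_tensor_def using Q'(1)
    by (intro hull_minimal subspace_imp_convex V) (auto intro!: tens_in_tensor_space)
  have symG: "- z \<in> ?G" if z: "z \<in> ?G" for z
  proof -
    obtain x where x: "z = tens x" "\<forall>i. x i \<in> Q i" using z by blast
    fix i
    have "- z = tens (x(i := - x i))" using tens_upd_scale[of x i "-1" "x i"] x(1) by simp
    then show ?thesis using x(2) Q'(3) by auto
  qed
  have sym: "- z \<in> proj_tensor Q" if "z \<in> proj_tensor Q" for z
    using convex_hull_sym[of ?G z] symG that unfolding proj_tensor_def by blast
  have "\<exists>r>0. \<forall>x\<in>coord_space (K i). norm x \<le> r \<longrightarrow> x \<in> Q i" for i
    using sym_convex_bodies_inner[OF C Q] by metis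
  then obtain r where r: "\<And>i. r i > 0" "\<And>i x. x \<in> coord_space (K i) \<Longrightarrow> norm x \<le> r i \<Longrightarrow> x \<in> Q i"
    by metis
  have zero: "0 \<in> proj_tensor Q"
  proof -
    have "tens (\<lambda>i. 0) \<in> proj_tensor Q" using sym_convex_bodies_zero[OF C Q] by (rule tens_in_proj_tensor)
    then show ?thesis by (metis tens_eq_0_iff)
  qed
  define R where "R = (\<Prod>i\<in>UNIV. r i)"
  \<comment> \<open>\<open>N\<close> counts all multi-indices: \<open>z\<close> is the average of
    the vectors \<open>(N * z $ f) *\<^sub>R axis f 1\<close>, and each of them lies in the body
    since its coefficient is at most \<open>R\<close> in modulus.\<close>
  define N where "N = real CARD('l \<Rightarrow> 'k)"
  have R: "R > 0" unfolding R_def using r(1) by (intro prod_pos) auto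
  have N: "N > 0" unfolding N_def by simp
  have ax: "R *\<^sub>R axis f 1 \<in> proj_tensor Q" if f: "f \<in> Pi UNIV K" for f
  proof -
    have "axis (f i) (1::real) \<in> coord_space (K i)" for i using f by (auto simp: coord_space_def axis_def)
    then have "r i *\<^sub>R axis (f i) 1 \<in> Q i" for i
      using r(1)[of i] by (intro r(2) subspace_scale[OF C]) (simp_all add: norm_axis_1)
    then have "tens (\<lambda>i. r i *\<^sub>R axis (f i) 1) \<in> proj_tensor Q" by (rule tens_in_proj_tensor)
    then show ?thesis by (simp add: tens_scale axis_eq_tens R_def)
  qed
  have "z \<in> proj_tensor Q" if z: "z \<in> tensor_space K" "norm z \<le> R / N" for z
  proof -
    have "(N * z $ f) *\<^sub>R axis f 1 \<in> proj_tensor Q" for f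
    proof (cases "f \<in> Pi UNIV K")
      case True
      have "\<bar>z $ f\<bar> \<le> R / N" using component_le_norm_cart[of z f] z(2) by linarith
      then have "\<bar>N * z $ f / R\<bar> \<le> 1" using R N by (simp add: abs_mult field_simps)
      then have "(N * z $ f / R) *\<^sub>R (R *\<^sub>R axis f 1) \<in> proj_tensor Q"
        by (rule convex_sym_scale_mem[OF cvx zero _ ax[OF True], rotated]) (rule sym)
      then show ?thesis using R by simp
    next
      case False
      then have "z $ f = 0" using z(1) unfolding tensor_space_def coord_space_def by blast
      then show ?thesis using zero by simp
    qed
    then have "(\<Sum>f\<in>UNIV. (1 / N) *\<^sub>R ((N * z $ f) *\<^sub>R axis f 1)) \<in> proj_tensor Q"
      using N by (intro convex_sum cvx) (auto simp: N_def)
    also have "(\<Sum>f\<in>UNIV. (1 / N) *\<^sub>R ((N * z $ f) *\<^sub>R axis f 1)) = z"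
      using basis_expansion[of z] N by (simp add: scalar_mult_eq_scaleR)
    finally show ?thesis .
  qed
  then show ?thesis
    using cpt cvx sub sym R N unfolding sym_convex_bodies_iff[OF V] by (intro conjI exI[of _ "R / N"]) auto
qed

lemma proj_tensor_subset_inj_tensor:
  assumes Q: "\<And>i. Q i \<in> sym_convex_bodies (coord_space (K i))"
  shows "proj_tensor Q \<subseteq> inj_tensor K Q"
proof -
  note C = subspace_coord_space
  let ?P = "\<lambda>i. polar_in (coord_space (K i)) (Q i)"
  have Q': "Q i \<subseteq> coord_space (K i)" "\<And>x. x \<in> Q i \<Longrightarrow> - x \<in> Q i" for i
    using Q[of i] by (auto simp: sym_convex_bodies_iff[OF C])
  have gen: "tens p \<bullet> tens x \<le> 1" if p: "\<forall>i. p i \<in> ?P i" and x: "\<forall>i. x i \<in> Q i" for p x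
  proof -
    \<comment> \<open>Symmetry of \<open>Q i\<close> gives the bound for absolute values, without
      which a product of numbers at most 1 could be large.\<close>
    have "\<bar>p i \<bullet> x i\<bar> \<le> 1" for i
    proof -
      have "x i \<bullet> p i \<le> 1" "(- x i) \<bullet> p i \<le> 1"
        using p x Q'(2) unfolding polar_in_def by blast+
      then show ?thesis by (simp add: inner_commute[of "p i"] abs_le_iff)
    qed
    then have "(\<Prod>i\<in>UNIV. \<bar>p i \<bullet> x i\<bar>) \<le> (\<Prod>i\<in>(UNIV::'a set). 1)" by (intro prod_mono) auto
    then show ?thesis by (simp add: inner_tens abs_prod[symmetric])
  qed
  have "proj_tensor Q \<subseteq> {y. p \<bullet> y \<le> 1}" if p: "p \<in> proj_tensor ?P" for p
    unfolding proj_tensor_def[of Q]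
  proof (rule hull_minimal)
    show "convex {y. p \<bullet> y \<le> 1}" by (rule convex_halfspace_le)
    show "{tens x | x. \<forall>i. x i \<in> Q i} \<subseteq> {y. p \<bullet> y \<le> 1}"
    proof clarify
      fix x assume x: "\<forall>i. x i \<in> Q i"
      have "proj_tensor ?P \<subseteq> {q. tens x \<bullet> q \<le> 1}"
        unfolding proj_tensor_def
        by (intro hull_minimal convex_halfspace_le) (use gen x in \<open>auto simp: inner_commute\<close>)
      then show "p \<bullet> tens x \<le> 1" using p by (auto simp: inner_commute)
    qed
  qed
  moreover have "proj_tensor Q \<subseteq> tensor_space K"
    using proj_tensor_sym_convex[of Q K, OF Q] by (simp add: sym_convex_bodies_def)
  ultimately show ?thesis unfolding inj_tensor_def polar_in_def[of "tensor_space K"] by blast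
qed

lemma proj_tensor_tensorial:
  assumes "\<And>i. Q i \<in> sym_convex_bodies (coord_space (K i))"
  shows "proj_tensor Q \<in> tensorial_bodies K"
  using proj_tensor_sym_convex[of Q K, OF assms] proj_tensor_subset_inj_tensor[of Q K, OF assms] assms
  by (auto simp: tensorial_bodies_def intro!: exI[of _ Q])

lemma proj_tensor_mono_scaled:
  fixes Q R :: "'l::finite \<Rightarrow> (real ^ 'k::finite) set"
  assumes "\<And>i. Q i \<subseteq> (\<lambda>x. c *\<^sub>R x) ` R i"
  shows "proj_tensor Q \<subseteq> (\<lambda>x. c ^ CARD('l) *\<^sub>R x) ` proj_tensor R"
  unfolding proj_tensor_def convex_hull_scaling[symmetric]
proof (intro hull_mono subsetI)
  fix z assume "z \<in> {tens x | x. \<forall>i. x i \<in> Q i}"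
  then obtain x where x: "z = tens x" "\<forall>i. x i \<in> Q i" by blast
  then have "\<exists>y. y \<in> R i \<and> x i = c *\<^sub>R y" for i using assms[of i] by blast
  then obtain y where y: "\<And>i. y i \<in> R i" "\<And>i. x i = c *\<^sub>R y i" by metis
  then have "x = (\<lambda>i. c *\<^sub>R y i)" by auto
  then have "z = c ^ CARD('l) *\<^sub>R tens y" unfolding x(1) by (simp add: tens_scale)
  then show "z \<in> (\<lambda>x. c ^ CARD('l) *\<^sub>R x) ` {tens x | x. \<forall>i. x i \<in> R i}" using y(1) by auto
qed

subsection \<open>Deformation to the decomposable hull\<close>

text \<open>The Minkowski combination of \<open>P\<close> with its decomposable hull. No choice of
  factors enters, so it commutes with the group by linearity and invariance of the decomposable
  tensors.\<close>

definition shrink_body ::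
  "('l::finite \<Rightarrow> 'k::finite set) \<Rightarrow> real \<Rightarrow> (real ^ ('l \<Rightarrow> 'k)) set \<Rightarrow> (real ^ ('l \<Rightarrow> 'k)) set" where
  "shrink_body K s P = (\<lambda>(p, q). (1 - s) *\<^sub>R p + s *\<^sub>R q) ` (P \<times> (convex hull (P \<inter> decomposables K)))"

text \<open>The interpolated gauge is evaluated on decomposable tensors only; the hull turns its
  unit ball there into a body. Zero is listed apart because the factorised form of the gauge is
  available at nonzero tensors.\<close>

definition deform_body ::
  "('l::finite \<Rightarrow> 'k::finite set) \<Rightarrow> real \<Rightarrow> (real ^ ('l \<Rightarrow> 'k)) set \<Rightarrow> (real ^ ('l \<Rightarrow> 'k)) set" where
  "deform_body K t P = convex hull {u \<in> decomposables K. u = 0 \<or> deform_gauge K t P u \<le> 1}"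

lemma shrink_body_0:
  assumes "0 \<in> P" shows "shrink_body K 0 P = P"
proof -
  have "0 \<in> convex hull (P \<inter> decomposables K)" using assms zero_in_decomposables by (intro hull_inc) auto
  then show ?thesis unfolding shrink_body_def by force
qed

lemma shrink_body_1:
  assumes "0 \<in> P" shows "shrink_body K 1 P = convex hull (P \<inter> decomposables K)"
  using assms unfolding shrink_body_def by force

lemma deform_body_0:
  assumes P: "P \<in> sym_convex_bodies (tensor_space K)"
  shows "deform_body K 0 P = convex hull (P \<inter> decomposables K)"
proof -
  have "{u \<in> decomposables K. u = 0 \<or> deform_gauge K 0 P u \<le> 1} = P \<inter> decomposables K"
    using mgauge_le_1_iff[OF subspace_tensor_space P] sym_convex_bodies_zero[OF subspace_tensor_space P]
      decomposables_subset[of K]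
    by (auto simp: deform_gauge_def)
  then show ?thesis by (simp add: deform_body_def)
qed

lemma shrink_body_scaled_subset:
  assumes "P \<subseteq> (\<lambda>x. c *\<^sub>R x) ` R" "c > 0"
  shows "shrink_body K s P \<subseteq> (\<lambda>x. c *\<^sub>R x) ` shrink_body K s R"
proof -
  have "P \<inter> decomposables K \<subseteq> (\<lambda>x. c *\<^sub>R x) ` (R \<inter> decomposables K)"
  proof
    fix z assume z: "z \<in> P \<inter> decomposables K"
    then obtain y where y: "y \<in> R" "z = c *\<^sub>R y" using assms by blast
    then have "y = inverse c *\<^sub>R z" using assms(2) by simp
    then have "y \<in> decomposables K" using z decomposables_scale by blast
    with y show "z \<in> (\<lambda>x. c *\<^sub>R x) ` (R \<inter> decomposables K)" by blast
  qed
  then have "convex hull (P \<inter> decomposables K) \<subseteq> (\<lambda>x. c *\<^sub>R x) ` (convex hull (R \<inter> decomposables K))"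
    unfolding convex_hull_scaling[symmetric] by (rule hull_mono)
  note hull = this
  show ?thesis
  proof
    fix z assume "z \<in> shrink_body K s P"
    then obtain p q where pq: "p \<in> P" "q \<in> convex hull (P \<inter> decomposables K)" "z = (1 - s) *\<^sub>R p + s *\<^sub>R q"
      by (auto simp: shrink_body_def)
    obtain p' where p': "p' \<in> R" "p = c *\<^sub>R p'" using pq(1) assms(1) by blast
    obtain q' where q': "q' \<in> convex hull (R \<inter> decomposables K)" "q = c *\<^sub>R q'" using pq(2) hull by blast
    have "z = c *\<^sub>R ((1 - s) *\<^sub>R p' + s *\<^sub>R q')"
      by (simp add: pq(3) p' q' scaleR_add_right mult.commute)
    then show "z \<in> (\<lambda>x. c *\<^sub>R x) ` shrink_body K s R" using p'(1) q'(1) by (auto simp: shrink_body_def)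
  qed
qed

lemma shrink_body_equivariant:
  assumes T: "T \<in> GL_tensor K" and P: "P \<subseteq> tensor_space K"
  shows "shrink_body K s (T ` P) = T ` shrink_body K s P"
proof -
  have lT: "linear T" and bT: "bij_betw T (tensor_space K) (tensor_space K)"
    using T by (auto simp: GL_tensor_def)
  have "T ` P \<inter> decomposables K = T ` (P \<inter> decomposables K)"
    using GL_tensor_mem_decomposables_iff[OF T] P by auto
  then have "convex hull (T ` P \<inter> decomposables K) = T ` (convex hull (P \<inter> decomposables K))"
    by (simp add: convex_hull_linear_image[OF lT])
  note hull = this
  have TX: "T ((1 - s) *\<^sub>R p + s *\<^sub>R q) = (1 - s) *\<^sub>R T p + s *\<^sub>R T q" for p q
    by (simp add: linear_add[OF lT] linear_scale[OF lT])
  show ?thesis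
    unfolding shrink_body_def hull
  proof (intro equalityI subsetI)
    fix z assume "z \<in> (\<lambda>(p, q). (1 - s) *\<^sub>R p + s *\<^sub>R q) ` (T ` P \<times> T ` (convex hull (P \<inter> decomposables K)))"
    then obtain p q where "p \<in> P" "q \<in> convex hull (P \<inter> decomposables K)" "z = (1 - s) *\<^sub>R T p + s *\<^sub>R T q"
      by auto
    then show "z \<in> T ` (\<lambda>(p, q). (1 - s) *\<^sub>R p + s *\<^sub>R q) ` (P \<times> (convex hull (P \<inter> decomposables K)))"
      by (auto simp: TX[symmetric])
  next
    fix z assume "z \<in> T ` (\<lambda>(p, q). (1 - s) *\<^sub>R p + s *\<^sub>R q) ` (P \<times> (convex hull (P \<inter> decomposables K)))"
    then obtain p q where "p \<in> P" "q \<in> convex hull (P \<inter> decomposables K)" "z = T ((1 - s) *\<^sub>R p + s *\<^sub>R q)"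
      by auto
    then show "z \<in> (\<lambda>(p, q). (1 - s) *\<^sub>R p + s *\<^sub>R q) ` (T ` P \<times> T ` (convex hull (P \<inter> decomposables K)))"
      unfolding TX by (intro image_eqI[of _ _ "(T p, T q)"]) auto
  qed
qed

subsection \<open>Deformation of the factors to Euclidean balls\<close>

text \<open>The lower bound is uniform in \<open>t\<close>; it yields both positivity of the
  interpolated norm and its Lipschitz dependence on \<open>t\<close>. The term \<open>1 / m\<close>
  comes from a left inverse of \<open>B\<close>.\<close>

lemma factor_norm_bounds:
  fixes C :: "'a::euclidean_space set" and B :: "'a \<Rightarrow> 'a"
  assumes C: "subspace C" and Q: "Q \<in> sym_convex_bodies C" and B: "linear B" "inj_on B C"
  obtains a b where "a > 0" "b > 0"
    "\<And>t y. t \<in> {0..1} \<Longrightarrow> y \<in> C \<Longrightarrow> a * norm y \<le> (1 - t) * mgauge Q y + t * norm (B y)"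
    "\<And>y. y \<in> C \<Longrightarrow> mgauge Q y + norm (B y) \<le> b * norm y"
proof -
  obtain a b where ab: "a > 0" "b > 0" "\<And>x. x \<in> C \<Longrightarrow> a * norm x \<le> mgauge Q x"
    "\<And>x. x \<in> C \<Longrightarrow> mgauge Q x \<le> b * norm x"
    using mgauge_bounds[OF C Q] by metis
  obtain b' where b': "b' > 0" "\<And>x. norm (B x) \<le> b' * norm x" using linear_bounded_pos[OF B(1)] by metis
  obtain A where A: "linear A" "\<And>y. y \<in> C \<Longrightarrow> A (B y) = y"
    using linear_exists_left_inverse_on[OF B(1) C B(2)] by blast
  obtain m where m: "m > 0" "\<And>x. norm (A x) \<le> m * norm x" using linear_bounded_pos[OF A(1)] by metis
  have "min a (1 / m) * norm y \<le> (1 - t) * mgauge Q y + t * norm (B y)" if t: "t \<in> {0..1}" and y: "y \<in> C" for t y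
  proof -
    have "min a (1 / m) * norm y \<le> a * norm y" by (intro mult_right_mono) auto
    then have 1: "min a (1 / m) * norm y \<le> mgauge Q y" using ab(3)[OF y] by linarith
    have "min a (1 / m) * norm y \<le> 1 / m * norm y" by (intro mult_right_mono) auto
    also have "\<dots> \<le> norm (B y)" using m(2)[of "B y"] A(2)[OF y] m(1) by (simp add: field_simps)
    finally have 2: "min a (1 / m) * norm y \<le> norm (B y)" .
    have "(1 - t) * (min a (1 / m) * norm y) + t * (min a (1 / m) * norm y)
        \<le> (1 - t) * mgauge Q y + t * norm (B y)"
      using 1 2 t by (intro add_mono mult_left_mono) auto
    then show ?thesis by (simp add: algebra_simps)
  qed
  moreover have "mgauge Q y + norm (B y) \<le> (b + b') * norm y" if "y \<in> C" for y
    using ab(4)[OF that] b'(2)[of y] by (simp add: distrib_right)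
  ultimately show ?thesis using that[of "min a (1 / m)" "b + b'"] ab b' m by auto
qed

lemma factor_norm_scale:
  assumes "subspace C" "Q \<in> sym_convex_bodies C" "linear B" "y \<in> (C :: 'a::euclidean_space set)"
  shows "(1 - t) * mgauge Q (c *\<^sub>R y) + t * norm (B (c *\<^sub>R y)) =
    \<bar>c\<bar> * ((1 - t) * mgauge Q y + t * norm (B y))"
  by (simp add: mgauge_scale[OF assms(1,2,4)] linear_scale[OF assms(3)] algebra_simps)

lemma factor_ball_sym_convex:
  fixes C :: "'a::euclidean_space set" and B :: "'a \<Rightarrow> 'a"
  assumes C: "subspace C" and Q: "Q \<in> sym_convex_bodies C" and B: "linear B" "inj_on B C" and t: "t \<in> {0..1}"
  shows "{y \<in> C. (1 - t) * mgauge Q y + t * norm (B y) \<le> 1} \<in> sym_convex_bodies C"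
proof -
  obtain a b where ab: "a > 0" "b > 0"
    "\<And>t y. t \<in> {0..1} \<Longrightarrow> y \<in> C \<Longrightarrow> a * norm y \<le> (1 - t) * mgauge Q y + t * norm (B y)"
    "\<And>y. y \<in> C \<Longrightarrow> mgauge Q y + norm (B y) \<le> b * norm y"
    by (rule factor_norm_bounds[OF C Q B], rule that)
  show ?thesis
  proof (rule norm_ball_sym_convex_body[OF C _ _ ab(1)])
    fix x y assume xy: "x \<in> C" "y \<in> C"
    have "(1 - t) * mgauge Q (x + y) + t * norm (B (x + y)) \<le>
      (1 - t) * (mgauge Q x + mgauge Q y) + t * (norm (B x) + norm (B y))"
      using t mgauge_triangle[OF C Q xy] norm_triangle_ineq[of "B x" "B y"]
      by (intro add_mono mult_left_mono) (auto simp: linear_add[OF B(1)])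
    then show "(1 - t) * mgauge Q (x + y) + t * norm (B (x + y)) \<le>
      (1 - t) * mgauge Q x + t * norm (B x) + ((1 - t) * mgauge Q y + t * norm (B y))"
      by (simp add: algebra_simps)
  next
    fix c x assume "x \<in> C"
    then show "(1 - t) * mgauge Q (c *\<^sub>R x) + t * norm (B (c *\<^sub>R x)) = \<bar>c\<bar> * ((1 - t) * mgauge Q x + t * norm (B x))"
      by (rule factor_norm_scale[OF C Q B(1)])
  next
    fix x assume x: "x \<in> C"
    show "a * norm x \<le> (1 - t) * mgauge Q x + t * norm (B x)" by (rule ab(3)[OF t x])
    have "(1 - t) * mgauge Q x + t * norm (B x) \<le> 1 * mgauge Q x + 1 * norm (B x)"
      using t mgauge_nonneg[OF C Q x] by (intro add_mono mult_right_mono) auto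
    then show "(1 - t) * mgauge Q x + t * norm (B x) \<le> b * norm x" using ab(4)[OF x] by simp
  qed
qed

lemma tens_unit_ball:
  fixes \<nu> :: "'l::finite \<Rightarrow> real ^ 'k::finite \<Rightarrow> real"
  assumes sc: "\<And>i c y. y \<in> coord_space (K i) \<Longrightarrow> \<nu> i (c *\<^sub>R y) = \<bar>c\<bar> * \<nu> i y"
    and pos: "\<And>i y. y \<in> coord_space (K i) \<Longrightarrow> y \<noteq> 0 \<Longrightarrow> \<nu> i y > 0"
    and F: "\<And>x. nonzero_factors K x \<Longrightarrow> F (tens x) = (\<Prod>i\<in>UNIV. \<nu> i (x i))"
  shows "{u \<in> decomposables K. u = 0 \<or> F u \<le> 1} = {tens x | x. \<forall>i. x i \<in> {y \<in> coord_space (K i). \<nu> i y \<le> 1}}"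
proof (intro equalityI subsetI)
  note C = subspace_coord_space
  fix u assume u: "u \<in> {tens x | x. \<forall>i. x i \<in> {y \<in> coord_space (K i). \<nu> i y \<le> 1}}"
  then obtain x where x: "u = tens x" "\<And>i. x i \<in> coord_space (K i)" "\<And>i. \<nu> i (x i) \<le> 1" by blast
  have "F u \<le> 1" if "u \<noteq> 0"
  proof -
    have nz: "nonzero_factors K x" using that x by (auto simp: nonzero_factors_def tens_eq_0_iff)
    then have "\<nu> i (x i) > 0" for i using pos by (auto simp: nonzero_factors_def)
    then have "(\<Prod>i\<in>UNIV. \<nu> i (x i)) \<le> (\<Prod>i\<in>(UNIV :: 'l set). 1)"
      using x(3) by (intro prod_mono) (auto intro: less_imp_le)
    then show ?thesis using F[OF nz] x(1) by simp
  qed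
  then show "u \<in> {u \<in> decomposables K. u = 0 \<or> F u \<le> 1}" using tens_in_decomposables[of x K] x by auto
next
  note C = subspace_coord_space
  fix u assume u: "u \<in> {u \<in> decomposables K. u = 0 \<or> F u \<le> 1}"
  show "u \<in> {tens x | x. \<forall>i. x i \<in> {y \<in> coord_space (K i). \<nu> i y \<le> 1}}"
  proof (cases "u = 0")
    case True
    then have "u = tens (\<lambda>i :: 'l. 0 :: real ^ 'k)" using tens_eq_0_iff by metis
    moreover have "\<nu> i 0 = 0" for i using sc[OF subspace_0[OF C], of i 0] by simp
    ultimately show ?thesis using subspace_0[OF C] by (auto intro!: exI[of _ "\<lambda>i. 0"])
  next
    case False
    then obtain x where x: "nonzero_factors K x" "u = tens x" using u decomposable_cases by blast
    have xi: "x i \<in> coord_space (K i)" "x i \<noteq> 0" for i using x by (auto simp: nonzero_factors_def)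
    define p where "p = (\<Prod>i\<in>UNIV. \<nu> i (x i))"
    have v: "\<nu> i (x i) > 0" for i using pos xi by blast
    have p: "p > 0" unfolding p_def using v by (intro prod_pos) auto
    have p1: "p \<le> 1" using u F[OF x(1)] False x(2) by (simp add: p_def)
    \<comment> \<open>Every factor is rescaled to the same norm \<open>q\<close>. Since
      \<open>q ^ CARD('l)\<close> is the product of the original norms, the scalars multiply to 1
      and the tensor is unchanged.\<close>
    define q where "q = root CARD('l) p"
    have q: "q > 0" "q \<le> 1" "q ^ CARD('l) = p"
      using p p1 by (auto simp: q_def)
    define c where "c = (\<lambda>i. q / \<nu> i (x i))"
    have "(\<Prod>i\<in>UNIV. c i) = 1" using p q(3) by (simp add: c_def prod_dividef p_def[symmetric])
    then have "u = tens (\<lambda>i. c i *\<^sub>R x i)" using x(2) by (simp add: tens_scale)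
    moreover have "\<nu> i (c i *\<^sub>R x i) \<le> 1" for i
      using sc[OF xi(1), of i "c i"] v[of i] q by (simp add: c_def)
    ultimately show ?thesis using subspace_scale[OF C xi(1)] by auto
  qed
qed

text \<open>The bodies \<open>Q i\<close> are factors of \<open>P\<close>, and \<open>norm (B i y)\<close> is the Euclidean norm attached to \<open>Q i\<close>.\<close>

definition factorization ::
  "('l::finite \<Rightarrow> 'k::finite set) \<Rightarrow> (real ^ ('l \<Rightarrow> 'k)) set \<Rightarrow> ('l \<Rightarrow> (real ^ 'k) set) \<Rightarrow>
    ('l \<Rightarrow> real ^ 'k \<Rightarrow> real ^ 'k) \<Rightarrow> bool" where
  "factorization K P Q B \<longleftrightarrow> (\<forall>i. Q i \<in> sym_convex_bodies (coord_space (K i))) \<and>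
    proj_tensor Q \<subseteq> P \<and> P \<subseteq> inj_tensor K Q \<and>
    (\<forall>i. linear (B i)) \<and> (\<forall>i. B i ` coord_space (K i) = coord_space (K i)) \<and>
    (\<forall>i. inj_on (B i) (coord_space (K i))) \<and>
    (\<forall>t\<in>{0..1}. deform_body K t P =
       proj_tensor (\<lambda>i. {y \<in> coord_space (K i). (1 - t) * mgauge (Q i) y + t * norm (B i y) \<le> 1}))"

lemma factorizationD:
  assumes "factorization K P Q B"
  shows "Q i \<in> sym_convex_bodies (coord_space (K i))" "proj_tensor Q \<subseteq> P" "P \<subseteq> inj_tensor K Q"
    "linear (B i)" "B i ` coord_space (K i) = coord_space (K i)" "inj_on (B i) (coord_space (K i))"
    "t \<in> {0..1} \<Longrightarrow> deform_body K t P =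
       proj_tensor (\<lambda>i. {y \<in> coord_space (K i). (1 - t) * mgauge (Q i) y + t * norm (B i y) \<le> 1})"
  using assms unfolding factorization_def by blast+

lemma factorization_exists:
  fixes K :: "'l::finite \<Rightarrow> 'k::finite set"
  assumes K: "\<And>i. card (K i) \<ge> 2" and P: "P \<in> tensorial_bodies K"
  obtains Q B where "factorization K P Q B"
proof -
  note C = subspace_coord_space
  obtain Q where Q: "\<And>i. Q i \<in> sym_convex_bodies (coord_space (K i))"
    and sub: "proj_tensor Q \<subseteq> P" "P \<subseteq> inj_tensor K Q"
    using P unfolding tensorial_bodies_def by blast
  obtain B where B: "\<And>i. linear (B i)" "\<And>i. B i ` coord_space (K i) = coord_space (K i)"
    "\<And>i. inj_on (B i) (coord_space (K i))"
    and F: "\<And>t x. nonzero_factors K x \<Longrightarrow>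
      deform_gauge K t P (tens x) = (\<Prod>i\<in>UNIV. (1 - t) * mgauge (Q i) (x i) + t * norm (B i (x i)))"
    by (rule deform_gauge_factors[OF K tensorial_bodies_sym_convex[OF P] Q sub], rule that)
  have "deform_body K t P =
       proj_tensor (\<lambda>i. {y \<in> coord_space (K i). (1 - t) * mgauge (Q i) y + t * norm (B i y) \<le> 1})"
    if t: "t \<in> {0..1}" for t
  proof -
    have pos: "(1 - t) * mgauge (Q i) y + t * norm (B i y) > 0" if y: "y \<in> coord_space (K i)" "y \<noteq> 0" for i y
    proof -
      obtain a b where ab: "a > 0" "b > 0"
        "\<And>t y. t \<in> {0..1} \<Longrightarrow> y \<in> coord_space (K i) \<Longrightarrow> a * norm y \<le> (1 - t) * mgauge (Q i) y + t * norm (B i y)"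
        "\<And>y. y \<in> coord_space (K i) \<Longrightarrow> mgauge (Q i) y + norm (B i y) \<le> b * norm y"
        by (rule factor_norm_bounds[OF C Q B(1,3)], rule that)
      have "a * norm y > 0" using ab(1) y by simp
      then show ?thesis using ab(3)[OF t y(1)] by linarith
    qed
    show ?thesis
      unfolding deform_body_def proj_tensor_def
      by (subst tens_unit_ball[where \<nu> = "\<lambda>i y. (1 - t) * mgauge (Q i) y + t * norm (B i y)"])
        (use factor_norm_scale[OF C Q B(1)] pos F in auto)
  qed
  then show ?thesis using Q sub B by (intro that[of Q B]) (simp add: factorization_def)
qed

lemma deform_body_tensorial:
  assumes "\<And>i. card (K i) \<ge> 2" "P \<in> tensorial_bodies K" "t \<in> {0..1}"
  shows "deform_body K t P \<in> tensorial_bodies K"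
proof -
  obtain Q B where "factorization K P Q B"
    by (rule factorization_exists[OF assms(1,2)], rule that)
  note f = factorizationD[OF this]
  note Q = f(1-3) and B = f(4-7)
  show ?thesis
    unfolding B(4)[OF assms(3)]
    by (intro proj_tensor_tensorial factor_ball_sym_convex[OF subspace_coord_space Q(1) B(1,3) assms(3)])
qed

section \<open>Continuity of the second deformation in its parameter\<close>

lemma eventually_power_less:
  fixes C e :: real
  assumes "e > 0"
  obtains d where "d > 0" "\<And>h. \<bar>h\<bar> < d \<Longrightarrow> (1 + C * \<bar>h\<bar>) ^ k < 1 + e"
proof -
  have "isCont (\<lambda>h::real. (1 + C * \<bar>h\<bar>) ^ k) 0" by (intro continuous_intros)
  then have "((\<lambda>h::real. (1 + C * \<bar>h\<bar>) ^ k) \<longlongrightarrow> 1) (at 0)" by (simp add: isCont_def)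
  then have "eventually (\<lambda>h. (1 + C * \<bar>h\<bar>) ^ k < 1 + e) (at (0::real))"
    using assms by (intro order_tendstoD(2)) auto
  then obtain d where d: "d > 0" "\<And>h. h \<noteq> 0 \<Longrightarrow> \<bar>h\<bar> < d \<Longrightarrow> (1 + C * \<bar>h\<bar>) ^ k < 1 + e"
    by (auto simp: eventually_at dist_real_def)
  have "(1 + C * \<bar>h\<bar>) ^ k < 1 + e" if "\<bar>h\<bar> < d" for h
    using d(2)[of h] that assms by (cases "h = 0") auto
  then show ?thesis using d(1) that by blast
qed

text \<open>The interpolated norms at \<open>s\<close> and \<open>r\<close> differ by
  \<open>(s - r) * (norm (B i y) - mgauge (Q i) y)\<close>, which is at most
  \<open>\<bar>s - r\<bar> * (b / a)\<close> times the norm at \<open>r\<close>. The projective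
  product raises this comparison of factors to the power \<open>CARD('l)\<close>, and the two
  inclusions double the exponent.\<close>

lemma deform_body_continuous:
  fixes K :: "'l::finite \<Rightarrow> 'k::finite set"
  assumes K: "\<And>i. card (K i) \<ge> 2" and P: "P \<in> tensorial_bodies K" and t: "t \<in> {0..1}" and e: "e > 0"
  shows "\<exists>d>0. \<forall>s\<in>{0..1}. \<bar>s - t\<bar> < d \<longrightarrow> tensor_BM_dist K (deform_body K t P) (deform_body K s P) < 1 + e"
proof -
  note C = subspace_coord_space
  obtain Q B where "factorization K P Q B"
    by (rule factorization_exists[OF K P], rule that)
  note f = factorizationD[OF this]
  note Q = f(1-3) and B = f(4-6) and D = f(7)
  let ?\<nu> = "\<lambda>t i y. (1 - t) * mgauge (Q i) y + t * norm (B i y)"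
  have "\<exists>M\<ge>0. \<forall>s\<in>{0..1}. \<forall>r\<in>{0..1}. \<forall>y\<in>coord_space (K i). ?\<nu> s i y \<le> (1 + M * \<bar>s - r\<bar>) * ?\<nu> r i y" for i
  proof -
    obtain a b where ab: "a > 0" "b > 0"
      "\<And>t y. t \<in> {0..1} \<Longrightarrow> y \<in> coord_space (K i) \<Longrightarrow> a * norm y \<le> (1 - t) * mgauge (Q i) y + t * norm (B i y)"
      "\<And>y. y \<in> coord_space (K i) \<Longrightarrow> mgauge (Q i) y + norm (B i y) \<le> b * norm y"
      by (rule factor_norm_bounds[OF C Q(1) B(1,3)], rule that)
    have "?\<nu> s i y \<le> (1 + (b / a) * \<bar>s - r\<bar>) * ?\<nu> r i y"
      if s: "s \<in> {0..1}" and r: "r \<in> {0..1}" and y: "y \<in> coord_space (K i)" for s r y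
    proof -
      have g: "mgauge (Q i) y \<ge> 0" by (rule mgauge_nonneg[OF C Q(1) y])
      have "(s - r) * (norm (B i y) - mgauge (Q i) y) \<le> \<bar>s - r\<bar> * \<bar>norm (B i y) - mgauge (Q i) y\<bar>"
        by (simp add: abs_mult[symmetric])
      also have "\<dots> \<le> \<bar>s - r\<bar> * (b * norm y)"
      proof (rule mult_left_mono)
        show "\<bar>norm (B i y) - mgauge (Q i) y\<bar> \<le> b * norm y"
          using ab(4)[OF y] g norm_ge_zero[of "B i y"] unfolding abs_le_iff by linarith
      qed simp
      also have "b * norm y = b / a * (a * norm y)" using ab(1) by simp
      also have "\<bar>s - r\<bar> * (b / a * (a * norm y)) \<le> \<bar>s - r\<bar> * (b / a * ?\<nu> r i y)"
        using ab(3)[OF r y] ab(1,2) by (intro mult_left_mono) auto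
      finally show ?thesis by (simp add: algebra_simps)
    qed
    then show ?thesis using ab by (intro exI[of _ "b / a"]) auto
  qed
  then obtain M where M: "\<And>i. M i \<ge> 0" "\<And>i s r y. s \<in> {0..1} \<Longrightarrow> r \<in> {0..1} \<Longrightarrow> y \<in> coord_space (K i) \<Longrightarrow>
      ?\<nu> s i y \<le> (1 + M i * \<bar>s - r\<bar>) * ?\<nu> r i y"
    by metis
  \<comment> \<open>The sum is a common upper bound for the finitely many constants
    \<open>M i\<close>.\<close>
  define N where "N = (\<Sum>i\<in>UNIV. M i)"
  have MN: "M i \<le> N" for i unfolding N_def using M(1) by (intro member_le_sum) auto
  have sub: "deform_body K r P \<subseteq> (\<lambda>x. (1 + N * \<bar>s - r\<bar>) ^ CARD('l) *\<^sub>R x) ` deform_body K s P"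
    if s: "s \<in> {0..1}" and r: "r \<in> {0..1}" for s r
    unfolding D[OF s] D[OF r]
  proof (rule proj_tensor_mono_scaled, rule subsetI)
    fix i y assume y: "y \<in> {y \<in> coord_space (K i). ?\<nu> r i y \<le> 1}"
    define c where "c = 1 + N * \<bar>s - r\<bar>"
    have N0: "N \<ge> 0" using M(1)[of i] MN[of i] by linarith
    have c: "c \<ge> 1" using N0 by (simp add: c_def)
    have nn: "?\<nu> r i y \<ge> 0" using y r mgauge_nonneg[OF C Q(1)] by auto
    have "?\<nu> s i y \<le> (1 + M i * \<bar>s - r\<bar>) * ?\<nu> r i y" using M(2)[OF s r] y by auto
    also have "\<dots> \<le> c * 1"
      using MN[of i] M(1)[of i] y nn c unfolding c_def by (intro mult_mono add_mono mult_right_mono) auto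
    finally have "?\<nu> s i (inverse c *\<^sub>R y) \<le> 1"
      using c y by (subst factor_norm_scale[OF C Q(1) B(1)]) (auto simp: field_simps)
    moreover have "inverse c *\<^sub>R y \<in> coord_space (K i)" using y by (intro subspace_scale[OF C]) auto
    moreover have "y = c *\<^sub>R (inverse c *\<^sub>R y)" using c by simp
    ultimately show "y \<in> (\<lambda>x. (1 + N * \<bar>s - r\<bar>) *\<^sub>R x) ` {y \<in> coord_space (K i). ?\<nu> s i y \<le> 1}"
      unfolding c_def[symmetric] by blast
  qed
  obtain d where d: "d > 0" "\<And>h. \<bar>h\<bar> < d \<Longrightarrow> (1 + N * \<bar>h\<bar>) ^ (CARD('l) + CARD('l)) < 1 + e"
    by (rule eventually_power_less[OF e], rule that)
  have "tensor_BM_dist K (deform_body K t P) (deform_body K s P) < 1 + e"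
    if s: "s \<in> {0..1}" "\<bar>s - t\<bar> < d" for s
  proof -
    let ?c = "(1 + N * \<bar>s - t\<bar>) ^ CARD('l)"
    have "N \<ge> 0" unfolding N_def using M(1) by (intro sum_nonneg)
    then have c: "?c \<ge> 1" by (intro one_le_power) auto
    have "tensor_BM_dist K (deform_body K t P) (deform_body K s P) \<le> ?c * ?c"
      using sub[OF s(1) t] sub[OF t s(1)] c deform_body_tensorial[OF K P] t s
      by (intro tensor_BM_dist_le_if_scaled_subsets tensorial_bodies_sym_convex)
        (auto simp: abs_minus_commute)
    also have "\<dots> < 1 + e" using d(2)[OF s(2)] by (simp only: power_add)
    finally show ?thesis .
  qed
  then show ?thesis using d(1) by blast
qed


section \<open>The first deformation: tensoriality and continuity\<close>

lemma deform_body_0_factors: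
  fixes K :: "'l::finite \<Rightarrow> 'k::finite set"
  assumes P: "P \<in> sym_convex_bodies (tensor_space K)"
    and Q: "\<And>i. Q i \<in> sym_convex_bodies (coord_space (K i))"
    and D: "deform_body K 0 P =
       proj_tensor (\<lambda>i. {y \<in> coord_space (K i). (1 - 0) * mgauge (Q i) y + 0 * norm (B i y) \<le> 1})"
  shows "convex hull (P \<inter> decomposables K) = proj_tensor Q"
proof -
  \<comment> \<open>At \<open>t = 0\<close> the Euclidean term disappears, and the unit ball of the
    gauge of \<open>Q i\<close> is \<open>Q i\<close> itself.\<close>
  have "{y \<in> coord_space (K i). (1 - 0) * mgauge (Q i) y + 0 * norm (B i y) \<le> 1} = Q i" for i
    using mgauge_le_1_iff[OF subspace_coord_space Q] Q[of i] by (auto simp: sym_convex_bodies_def)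
  then show ?thesis using D deform_body_0[OF P] by simp
qed

lemma decomposable_hull_factors:
  fixes K :: "'l::finite \<Rightarrow> 'k::finite set"
  assumes "\<And>i. card (K i) \<ge> 2" "P \<in> tensorial_bodies K"
  obtains Q where "\<And>i. Q i \<in> sym_convex_bodies (coord_space (K i))"
    "proj_tensor Q \<subseteq> P" "P \<subseteq> inj_tensor K Q" "convex hull (P \<inter> decomposables K) = proj_tensor Q"
proof -
  obtain Q B where "factorization K P Q B"
    by (rule factorization_exists[OF assms], rule that)
  note f = factorizationD[OF this]
  note Q = f(1-3) and B = f(4-7)
  have "convex hull (P \<inter> decomposables K) = proj_tensor Q"
    by (rule deform_body_0_factors[OF tensorial_bodies_sym_convex[OF assms(2)] Q(1) B(4)]) simp
  then show ?thesis using that Q by blast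
qed

text \<open>The deformed body stays between its decomposable hull, which is the projective product
  of the \<open>Q i\<close>, and \<open>P\<close>. The same factors therefore witness that it is
  tensorial.\<close>

lemma shrink_body_tensorial:
  assumes K: "\<And>i. card (K i) \<ge> 2" and P: "P \<in> tensorial_bodies K" and s: "s \<in> {0..1}"
  shows "shrink_body K s P \<in> tensorial_bodies K"
proof -
  note V = subspace_tensor_space[of K]
  obtain Q where Q: "\<And>i. Q i \<in> sym_convex_bodies (coord_space (K i))"
    "proj_tensor Q \<subseteq> P" "P \<subseteq> inj_tensor K Q" "convex hull (P \<inter> decomposables K) = proj_tensor Q"
    by (rule decomposable_hull_factors[OF K P], rule that)
  let ?f = "\<lambda>(p, q). (1 - s) *\<^sub>R p + s *\<^sub>R q"
  have S: "shrink_body K s P = ?f ` (P \<times> proj_tensor Q)" by (simp add: shrink_body_def Q(4))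
  have P': "P \<subseteq> tensor_space K" "compact P" "convex P" "\<And>x. x \<in> P \<Longrightarrow> - x \<in> P"
    using tensorial_bodies_sym_convex[OF P] by (auto simp: sym_convex_bodies_iff[OF V])
  have R: "compact (proj_tensor Q)" "convex (proj_tensor Q)" "\<And>x. x \<in> proj_tensor Q \<Longrightarrow> - x \<in> proj_tensor Q"
    using proj_tensor_sym_convex[of Q K, OF Q(1)] by (auto simp: sym_convex_bodies_iff[OF V])
  obtain r where r: "r > 0" "\<And>x. x \<in> tensor_space K \<Longrightarrow> norm x \<le> r \<Longrightarrow> x \<in> proj_tensor Q"
    using sym_convex_bodies_inner[OF V proj_tensor_sym_convex[of Q K, OF Q(1)]] by metis
  have lf: "linear ?f" by (rule linearI) (auto simp: scaleR_add_right algebra_simps)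
  have sub: "shrink_body K s P \<subseteq> P"
    unfolding S using Q(2) s by (auto intro!: convexD[OF P'(3)])
  have sup: "proj_tensor Q \<subseteq> shrink_body K s P"
  proof
    fix z assume z: "z \<in> proj_tensor Q"
    have "z = ?f (z, z)" by (simp add: scaleR_add_left[symmetric])
    moreover have "(z, z) \<in> P \<times> proj_tensor Q" using z Q(2) by auto
    ultimately show "z \<in> shrink_body K s P" unfolding S by (rule image_eqI)
  qed
  have "compact (shrink_body K s P)"
    unfolding S using lf P' R
    by (intro compact_continuous_image compact_Times linear_continuous_on) (auto simp: linear_linear)
  moreover have "convex (shrink_body K s P)"
    unfolding S using P' R by (intro convex_linear_image[OF lf] convex_Times)
  moreover have "- z \<in> shrink_body K s P" if z: "z \<in> shrink_body K s P" for z
  proof -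
    obtain p q where "p \<in> P" "q \<in> proj_tensor Q" "z = ?f (p, q)" using z unfolding S by blast
    moreover from this have "- z = ?f (- p, - q)" by simp
    ultimately show ?thesis unfolding S using P'(4) R(3) by (intro image_eqI[of _ _ "(- p, - q)"]) auto
  qed
  ultimately have "shrink_body K s P \<in> sym_convex_bodies (tensor_space K)"
    using sub P'(1) sup r unfolding sym_convex_bodies_iff[OF V] by blast
  then show ?thesis using Q sub sup unfolding tensorial_bodies_def by blast
qed

text \<open>The triangle inequality for the gauge of \<open>X\<close>, in terms of membership: signs
  are absorbed by symmetry and the remaining coefficients are normalised to convex weights.\<close>

lemma convex_sym_sum_scaled:
  assumes X: "convex X" "\<And>x. x \<in> X \<Longrightarrow> - x \<in> X" and x: "a \<in> X" "b \<in> X" "d \<in> X"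
  shows "a + \<beta> *\<^sub>R b + \<gamma> *\<^sub>R d \<in> (\<lambda>x. (1 + \<bar>\<beta>\<bar> + \<bar>\<gamma>\<bar>) *\<^sub>R x) ` X"
proof -
  let ?c = "1 + \<bar>\<beta>\<bar> + \<bar>\<gamma>\<bar>"
  have 1: "\<exists>b'\<in>X. \<beta> *\<^sub>R b = \<bar>\<beta>\<bar> *\<^sub>R b'" if "b \<in> X" for \<beta> :: real and b
    using that X(2)[OF that] by (cases "\<beta> \<ge> 0") (auto intro: bexI[of _ b] bexI[of _ "- b"])
  obtain b' d' where b': "b' \<in> X" "\<beta> *\<^sub>R b = \<bar>\<beta>\<bar> *\<^sub>R b'" and d': "d' \<in> X" "\<gamma> *\<^sub>R d = \<bar>\<gamma>\<bar> *\<^sub>R d'"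
    using 1[OF x(2)] 1[OF x(3)] by metis
  have c: "?c > 0" by linarith
  let ?u = "(\<bar>\<beta>\<bar> / (\<bar>\<beta>\<bar> + \<bar>\<gamma>\<bar>)) *\<^sub>R b' + (\<bar>\<gamma>\<bar> / (\<bar>\<beta>\<bar> + \<bar>\<gamma>\<bar>)) *\<^sub>R d'"
  show ?thesis
  proof (cases "\<bar>\<beta>\<bar> + \<bar>\<gamma>\<bar> = 0")
    case True
    then have "\<beta> = 0" "\<gamma> = 0" by linarith+
    then show ?thesis using x(1) by auto
  next
    case False
    then have p: "\<bar>\<beta>\<bar> + \<bar>\<gamma>\<bar> > 0" by linarith
    have u: "?u \<in> X"
      using p by (intro convexD[OF X(1) b'(1) d'(1)]) (simp_all add: add_divide_distrib[symmetric])
    have "(1 / ?c) *\<^sub>R a + ((\<bar>\<beta>\<bar> + \<bar>\<gamma>\<bar>) / ?c) *\<^sub>R ?u \<in> X"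
      using c by (intro convexD[OF X(1) x(1) u]) (simp_all add: add_divide_distrib[symmetric] add.assoc)
    moreover have "a + \<beta> *\<^sub>R b + \<gamma> *\<^sub>R d = ?c *\<^sub>R ((1 / ?c) *\<^sub>R a + ((\<bar>\<beta>\<bar> + \<bar>\<gamma>\<bar>) / ?c) *\<^sub>R ?u)"
      using c p unfolding b'(2) d'(2) by (simp add: scaleR_add_right)
    ultimately show ?thesis by (intro image_eqI)
  qed
qed

text \<open>The decomposable hull lies in every \<open>shrink_body K r P\<close>, but a point
  \<open>p\<close> of \<open>P\<close> need not. Choosing \<open>M\<close> with \<open>P\<close>
  inside \<open>M\<close> times the hull, \<open>p\<close> becomes \<open>M\<close> times a point
  \<open>q'\<close> of the hull. In the constant \<open>M + 1\<close>, the 1 comes from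
  \<open>q\<close> and the \<open>M\<close> from \<open>p\<close>.\<close>

lemma shrink_body_continuous:
  assumes K: "\<And>i. card (K i) \<ge> 2" and P: "P \<in> tensorial_bodies K" and t: "t \<in> {0..1}" and e: "e > 0"
  shows "\<exists>d>0. \<forall>s\<in>{0..1}. \<bar>s - t\<bar> < d \<longrightarrow> tensor_BM_dist K (shrink_body K t P) (shrink_body K s P) < 1 + e"
proof -
  note V = subspace_tensor_space[of K] and sc = tensorial_bodies_sym_convex
  let ?C = "convex hull (P \<inter> decomposables K)"
  obtain Q where Q: "\<And>i. Q i \<in> sym_convex_bodies (coord_space (K i))"
    "proj_tensor Q \<subseteq> P" "P \<subseteq> inj_tensor K Q" "?C = proj_tensor Q"
    by (rule decomposable_hull_factors[OF K P], rule that)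
  have C: "?C \<in> sym_convex_bodies (tensor_space K)"
    unfolding Q(4) by (rule proj_tensor_sym_convex[OF Q(1)])
  have CP: "?C \<subseteq> P" using Q by simp
  obtain M where M: "M \<ge> 1" "P \<subseteq> (\<lambda>x. M *\<^sub>R x) ` ?C"
    by (rule body_subset_scaled[OF V C sc[OF P]], rule that)
  have sub: "shrink_body K s P \<subseteq> (\<lambda>x. (1 + (M + 1) * \<bar>s - r\<bar>) *\<^sub>R x) ` shrink_body K r P"
    if s: "s \<in> {0..1}" and r: "r \<in> {0..1}" for s r
  proof
    fix z assume "z \<in> shrink_body K s P"
    then obtain p q where pq: "p \<in> P" "q \<in> ?C" "z = (1 - s) *\<^sub>R p + s *\<^sub>R q" by (auto simp: shrink_body_def)
    obtain q' where q': "q' \<in> ?C" "p = M *\<^sub>R q'" using pq(1) M(2) by blast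
    let ?X = "shrink_body K r P"
    have X: "?X \<in> sym_convex_bodies (tensor_space K)" by (rule sc[OF shrink_body_tensorial[OF K P r]])
    have CX: "c \<in> ?X" if "c \<in> ?C" for c
    proof -
      have "c = (1 - r) *\<^sub>R c + r *\<^sub>R c" by (simp add: scaleR_add_left[symmetric])
      then show ?thesis using that CP unfolding shrink_body_def by (intro image_eqI[of _ _ "(c, c)"]) auto
    qed
    define a where "a = (1 - r) *\<^sub>R p + r *\<^sub>R q"
    have a: "a \<in> ?X" unfolding a_def shrink_body_def using pq by (intro image_eqI[of _ _ "(p, q)"]) auto
    have "z = a + (s - r) *\<^sub>R q + (r - s) *\<^sub>R p" unfolding pq(3) a_def by (simp add: algebra_simps)
    also have "\<dots> = a + (s - r) *\<^sub>R q + ((r - s) * M) *\<^sub>R q'" by (simp add: q'(2))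
    also have "\<dots> \<in> (\<lambda>x. (1 + \<bar>s - r\<bar> + \<bar>(r - s) * M\<bar>) *\<^sub>R x) ` ?X"
      using X a CX[OF pq(2)] CX[OF q'(1)]
      by (intro convex_sym_sum_scaled) (auto simp: sym_convex_bodies_iff[OF V])
    also have "\<bar>(r - s) * M\<bar> = M * \<bar>s - r\<bar>"
      using M(1) by (simp add: abs_mult abs_minus_commute mult.commute)
    also have "1 + \<bar>s - r\<bar> + M * \<bar>s - r\<bar> = 1 + (M + 1) * \<bar>s - r\<bar>" by (simp add: algebra_simps)
    finally show "z \<in> (\<lambda>x. (1 + (M + 1) * \<bar>s - r\<bar>) *\<^sub>R x) ` ?X" .
  qed
  obtain d where d: "d > 0" "\<And>h. \<bar>h\<bar> < d \<Longrightarrow> (1 + (M + 1) * \<bar>h\<bar>) ^ 2 < 1 + e"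
    by (rule eventually_power_less[OF e], rule that)
  have "tensor_BM_dist K (shrink_body K t P) (shrink_body K s P) < 1 + e"
    if s: "s \<in> {0..1}" "\<bar>s - t\<bar> < d" for s
  proof -
    let ?c = "1 + (M + 1) * \<bar>s - t\<bar>"
    have c: "?c \<ge> 1" using M(1) by simp
    have "tensor_BM_dist K (shrink_body K t P) (shrink_body K s P) \<le> ?c * ?c"
      using sub[OF s(1) t] sub[OF t s(1)] c shrink_body_tensorial[OF K P] t s
      by (intro tensor_BM_dist_le_if_scaled_subsets sc) (auto simp: abs_minus_commute)
    also have "\<dots> < 1 + e" using d(2)[OF s(2)] by (simp only: power2_eq_square)
    finally show ?thesis .
  qed
  then show ?thesis using d(1) by blast
qed

subsection \<open>Equivariance and the Lipschitz estimate\<close>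

lemma max_subspaces_subset:
  assumes "L \<in> max_subspaces K" shows "subspace L" "L \<subseteq> tensor_space K"
  using assms decomposables_subset unfolding max_subspaces_def by blast+

text \<open>\<open>T\<close> maps the maximal subspaces through \<open>u\<close> bijectively to
  those through \<open>T u\<close>, so the product is merely reindexed. Gauge and moment norm agree
  on corresponding sections, whichever way \<open>T\<close> permutes the factors.\<close>

lemma deform_gauge_equivariant:
  assumes T: "T \<in> GL_tensor K" and P: "P \<in> sym_convex_bodies (tensor_space K)" and u: "u \<in> tensor_space K"
  shows "deform_gauge K t (T ` P) (T u) = deform_gauge K t P u"
proof -
  note V = subspace_tensor_space[of K]
  have lT: "linear T" and iT: "inj_on T (tensor_space K)"
    using T by (auto simp: GL_tensor_def bij_betw_def)
  have PV: "P \<subseteq> tensor_space K" using P by (simp add: sym_convex_bodies_def)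
  obtain S where S: "S \<in> GL_tensor K" "\<And>x. x \<in> tensor_space K \<Longrightarrow> S (T x) = x"
    "\<And>x. x \<in> tensor_space K \<Longrightarrow> T (S x) = x"
    using GL_tensor_inverse[OF T] by metis
  let ?M = "{L \<in> max_subspaces K. u \<in> L}"
  have im: "{L \<in> max_subspaces K. T u \<in> L} = (`) T ` ?M"
  proof (intro equalityI subsetI)
    fix L assume L: "L \<in> {L \<in> max_subspaces K. T u \<in> L}"
    have LV: "L \<subseteq> tensor_space K" using max_subspaces_subset(2) L by blast
    have "T ` S ` L = L" using S(3) LV by (auto simp: image_comp image_iff subset_iff)
    moreover have "S ` L \<in> ?M"
    proof -
      have "S (T u) \<in> S ` L" using L by blast
      then show ?thesis using GL_tensor_max_subspaces[OF S(1)] L unfolding S(2)[OF u] by blast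
    qed
    ultimately show "L \<in> (`) T ` ?M" by (rule image_eqI[OF sym])
  next
    fix L assume "L \<in> (`) T ` ?M"
    then obtain M where "M \<in> max_subspaces K" "u \<in> M" "L = T ` M" by blast
    then show "L \<in> {L \<in> max_subspaces K. T u \<in> L}" using GL_tensor_max_subspaces[OF T] by blast
  qed
  have inj: "inj_on ((`) T) ?M"
  proof (rule inj_onI)
    fix L M assume "L \<in> ?M" "M \<in> ?M" and eq: "T ` L = T ` M"
    then have "L \<subseteq> tensor_space K" "M \<subseteq> tensor_space K" using max_subspaces_subset(2) by auto
    then show "L = M" using inj_on_image_eq_iff[OF iT] eq by simp
  qed
  have m: "moment_norm (T ` P \<inter> T ` L) (T u) = moment_norm (P \<inter> L) u" if L: "L \<in> ?M" for L
  proof -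
    have "L \<in> max_subspaces K" and uL: "u \<in> L" using L by auto
    note L' = max_subspaces_subset[OF this(1)] uL
    have "T ` P \<inter> T ` L = T ` (P \<inter> L)" using inj_on_image_Int[OF iT PV L'(2)] by simp
    then show ?thesis
      using moment_norm_linear_image[OF L'(1) body_Int_subspace[OF V L'(1,2) P] lT inj_on_subset[OF iT L'(2)] L'(3)]
      by simp
  qed
  show ?thesis
    unfolding deform_gauge_def im prod.reindex[OF inj] o_def mgauge_linear_image[OF lT iT V PV u]
    by (intro arg_cong2[of _ _ _ _ "(*)"] refl prod.cong) (simp add: m)
qed

lemma deform_body_equivariant:
  assumes T: "T \<in> GL_tensor K" and P: "P \<in> sym_convex_bodies (tensor_space K)"
  shows "deform_body K t (T ` P) = T ` deform_body K t P"
proof -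
  have lT: "linear T" using T by (auto simp: GL_tensor_def)
  have iT: "inj_on T (tensor_space K)" using T by (auto simp: GL_tensor_def bij_betw_def)
  have z: "T u = 0 \<longleftrightarrow> u = 0" if "u \<in> tensor_space K" for u
    using inj_onD[OF iT _ that subspace_0[OF subspace_tensor_space]] linear_0[OF lT] by auto
  have V: "u \<in> tensor_space K" if "u \<in> decomposables K" for u using that decomposables_subset by blast
  have "{v \<in> decomposables K. v = 0 \<or> deform_gauge K t (T ` P) v \<le> 1} =
      T ` {u \<in> decomposables K. u = 0 \<or> deform_gauge K t P u \<le> 1}"
  proof (intro equalityI subsetI)
    fix v assume v: "v \<in> {v \<in> decomposables K. v = 0 \<or> deform_gauge K t (T ` P) v \<le> 1}"
    then obtain u where u: "u \<in> decomposables K" "v = T u"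
      using GL_tensor_image_decomposables[OF T] by blast
    with v show "v \<in> T ` {u \<in> decomposables K. u = 0 \<or> deform_gauge K t P u \<le> 1}"
      using z[OF V[OF u(1)]] deform_gauge_equivariant[OF T P V[OF u(1)]] by auto
  next
    fix v assume "v \<in> T ` {u \<in> decomposables K. u = 0 \<or> deform_gauge K t P u \<le> 1}"
    then obtain u where u: "u \<in> decomposables K" "u = 0 \<or> deform_gauge K t P u \<le> 1" "v = T u" by blast
    then show "v \<in> {v \<in> decomposables K. v = 0 \<or> deform_gauge K t (T ` P) v \<le> 1}"
      using z[OF V[OF u(1)]] deform_gauge_equivariant[OF T P V[OF u(1)]] GL_tensor_image_decomposables[OF T]
      by auto
  qed
  then show ?thesis unfolding deform_body_def by (simp add: convex_hull_linear_image[OF lT])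
qed

text \<open>The ratios in the product are homogeneous of degree 0, so only the leading gauge
  scales.\<close>

lemma deform_gauge_scale:
  assumes P: "P \<in> sym_convex_bodies (tensor_space K)" and u: "u \<in> tensor_space K" and c: "c > 0"
  shows "deform_gauge K t P (c *\<^sub>R u) = c * deform_gauge K t P u"
proof -
  note V = subspace_tensor_space[of K]
  have M: "{L \<in> max_subspaces K. c *\<^sub>R u \<in> L} = {L \<in> max_subspaces K. u \<in> L}"
  proof -
    have "c *\<^sub>R u \<in> L \<longleftrightarrow> u \<in> L" if "L \<in> max_subspaces K" for L
      using subspace_scale[OF max_subspaces_subset(1)[OF that], of u c]
        subspace_scale[OF max_subspaces_subset(1)[OF that], of "c *\<^sub>R u" "inverse c"] c by auto
    then show ?thesis by auto
  qed
  have "moment_norm (P \<inter> L) (c *\<^sub>R u) / mgauge P (c *\<^sub>R u) = moment_norm (P \<inter> L) u / mgauge P u"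
    if "L \<in> max_subspaces K" for L
    using moment_norm_scale[OF max_subspaces_subset(1)[OF that] body_Int_subspace[OF V max_subspaces_subset[OF that] P]]
      mgauge_scale_pos[OF V P u c] c by simp
  then have "(\<Prod>L\<in>{L \<in> max_subspaces K. u \<in> L}. (1 - t) + t * (moment_norm (P \<inter> L) (c *\<^sub>R u) / mgauge P (c *\<^sub>R u)))
      = (\<Prod>L\<in>{L \<in> max_subspaces K. u \<in> L}. (1 - t) + t * (moment_norm (P \<inter> L) u / mgauge P u))"
    by (intro prod.cong) auto
  then show ?thesis
    unfolding deform_gauge_def M using mgauge_scale_pos[OF V P u c] by (simp only: mult.assoc)
qed

text \<open>The leading gauge costs one power of \<open>c\<close>. Each of the
  \<open>CARD('l)\<close> ratios costs \<open>n\<close> for its moment norm and 1 for the gauge in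
  its denominator; the summand \<open>1 - t\<close> is absorbed because
  \<open>c \<ge> 1\<close>.\<close>

lemma deform_gauge_le:
  fixes K :: "'l::finite \<Rightarrow> 'k::finite set"
  assumes K: "\<And>i. card (K i) \<ge> 2" and X: "X \<in> sym_convex_bodies (tensor_space K)"
    and Y: "Y \<in> sym_convex_bodies (tensor_space K)" and x: "nonzero_factors K x" and c: "c \<ge> 1" and t: "t \<in> {0..1}"
    and g: "mgauge X (tens x) \<le> c * mgauge Y (tens x)" "mgauge Y (tens x) \<le> c * mgauge X (tens x)"
    and m: "\<And>i. moment_norm (X \<inter> slice K x i) (tens x) \<le> c ^ n * moment_norm (Y \<inter> slice K x i) (tens x)"
  shows "deform_gauge K t X (tens x) \<le> c ^ (1 + (n + 1) * CARD('l)) * deform_gauge K t Y (tens x)"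
proof -
  note V = subspace_tensor_space[of K]
  let ?u = "tens x"
  have u: "?u \<in> tensor_space K" "?u \<noteq> 0"
    using nonzero_factors_tens[OF x] decomposables_subset by blast+
  have gX: "mgauge X ?u > 0" and gY: "mgauge Y ?u > 0" using mgauge_pos[OF V _ u] X Y by auto
  let ?f = "\<lambda>X i. (1 - t) + t * (moment_norm (X \<inter> slice K x i) ?u / mgauge X ?u)"
  have mn: "moment_norm (X \<inter> slice K x i) ?u \<ge> 0" if "X \<in> sym_convex_bodies (tensor_space K)" for X i
    using moment_norm_pos[OF subspace_slice body_Int_subspace[OF V subspace_slice _ that] u(2)]
      slice_subset[OF x] decomposables_subset by (metis less_imp_le order_trans)
  have "?f X i \<le> c ^ (n + 1) * ?f Y i" for i
  proof -
    have "moment_norm (X \<inter> slice K x i) ?u / mgauge X ?u \<le>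
        (c ^ n * moment_norm (Y \<inter> slice K x i) ?u) / (mgauge Y ?u / c)"
      using m[of i] g(2) gX gY c mn[OF X, of i] mn[OF Y, of i]
      by (intro frac_le) (auto simp: field_simps)
    also have "\<dots> = c ^ (n + 1) * (moment_norm (Y \<inter> slice K x i) ?u / mgauge Y ?u)" by simp
    finally have "t * (moment_norm (X \<inter> slice K x i) ?u / mgauge X ?u) \<le>
        t * (c ^ (n + 1) * (moment_norm (Y \<inter> slice K x i) ?u / mgauge Y ?u))"
      using t by (intro mult_left_mono) auto
    moreover have "1 * (1 - t) \<le> c ^ (n + 1) * (1 - t)"
      using t by (intro mult_right_mono one_le_power[OF c]) auto
    ultimately show ?thesis by (simp add: algebra_simps)
  qed
  moreover have "?f X i \<ge> 0" "?f Y i \<ge> 0" for i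
    using t gX gY mn[OF X, of i] mn[OF Y, of i] by auto
  ultimately have "(\<Prod>i\<in>UNIV. ?f X i) \<le> (\<Prod>i\<in>UNIV. c ^ (n + 1) * ?f Y i)"
    and nn: "(\<Prod>i\<in>UNIV. ?f X i) \<ge> 0"
    by (auto intro!: prod_mono prod_nonneg)
  then have "mgauge X ?u * (\<Prod>i\<in>UNIV. ?f X i) \<le> (c * mgauge Y ?u) * (\<Prod>i\<in>UNIV. c ^ (n + 1) * ?f Y i)"
    using g(1) gX gY c by (intro mult_mono) auto
  also have "(\<Prod>i\<in>(UNIV :: 'l set). c ^ (n + 1) * ?f Y i) = c ^ ((n + 1) * CARD('l)) * (\<Prod>i\<in>UNIV. ?f Y i)"
    by (simp only: prod.distrib prod_constant power_mult)
  finally show ?thesis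
    unfolding deform_gauge_def prod_max_subspaces_through[OF K x] by (simp only: power_add power_one_right mult_ac)
qed

lemma deform_body_scaled_subset:
  fixes K :: "'l::finite \<Rightarrow> 'k::finite set"
  assumes X: "X \<in> sym_convex_bodies (tensor_space K)" and c: "c > 0"
    and le: "\<And>x. nonzero_factors K x \<Longrightarrow> deform_gauge K t X (tens x) \<le> c * deform_gauge K t Y (tens x)"
  shows "deform_body K t Y \<subseteq> (\<lambda>x. c *\<^sub>R x) ` deform_body K t X"
  unfolding deform_body_def convex_hull_scaling[symmetric]
proof (intro hull_mono subsetI)
  fix u assume u: "u \<in> {u \<in> decomposables K. u = 0 \<or> deform_gauge K t Y u \<le> 1}"
  have cu: "inverse c *\<^sub>R u \<in> decomposables K" using u by (intro decomposables_scale) auto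
  have "deform_gauge K t X (inverse c *\<^sub>R u) \<le> 1" if "u \<noteq> 0"
  proof -
    obtain x where x: "nonzero_factors K x" "u = tens x" using u \<open>u \<noteq> 0\<close> decomposable_cases by blast
    have "deform_gauge K t Y u \<le> 1" using u that by auto
    then have "c * deform_gauge K t Y u \<le> c * 1" using c by (intro mult_left_mono) auto
    then have "deform_gauge K t X u \<le> c * 1" using le[OF x(1)] x(2) by simp
    moreover have "u \<in> tensor_space K" using u decomposables_subset by blast
    ultimately have "deform_gauge K t X (inverse c *\<^sub>R u) = inverse c * deform_gauge K t X u"
      "deform_gauge K t X u \<le> c" using deform_gauge_scale[OF X, of u "inverse c"] c by auto
    then show ?thesis using c by (simp only:) (simp add: field_simps)
  qed
  then have "inverse c *\<^sub>R u \<in> {u \<in> decomposables K. u = 0 \<or> deform_gauge K t X u \<le> 1}" using cu by auto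
  moreover have "u = c *\<^sub>R (inverse c *\<^sub>R u)" using c by simp
  ultimately show "u \<in> (\<lambda>x. c *\<^sub>R x) ` {u \<in> decomposables K. u = 0 \<or> deform_gauge K t X u \<le> 1}" by blast
qed

text \<open>The number \<open>2 * CARD('l \<Rightarrow> 'k) + 2\<close> is the exponent of
  \<open>moment_norm_mono\<close> in the ambient space; the rest of \<open>k\<close> comes from
  \<open>deform_gauge_le\<close>. The comparison runs through sections by slices instead of factors,
  and so it covers all symmetric convex bodies of the tensor space.\<close>

lemma deform_body_lipschitz:
  fixes K :: "'l::finite \<Rightarrow> 'k::finite set"
  defines "k \<equiv> 1 + (2 * CARD('l \<Rightarrow> 'k) + 2 + 1) * CARD('l)"
  assumes K: "\<And>i. card (K i) \<ge> 2" and R: "R \<in> sym_convex_bodies (tensor_space K)"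
    and S: "S \<in> sym_convex_bodies (tensor_space K)" and c: "c \<ge> 1" and t: "t \<in> {0..1}"
    and sub: "R \<subseteq> S" "S \<subseteq> (\<lambda>x. c *\<^sub>R x) ` R"
  shows "deform_body K t S \<subseteq> (\<lambda>x. c ^ k *\<^sub>R x) ` deform_body K t R \<and>
    deform_body K t R \<subseteq> (\<lambda>x. c ^ k *\<^sub>R x) ` deform_body K t S"
proof -
  note V = subspace_tensor_space[of K]
  have ck: "c ^ k > 0" using c by simp
  have sub': "R \<subseteq> (\<lambda>x. c *\<^sub>R x) ` S" using sub(1) body_scale_subset[OF S V, of 1 c] c by auto
  have g: "mgauge R u \<le> c * mgauge S u" "mgauge S u \<le> c * mgauge R u" if "u \<in> tensor_space K" for u
    using mgauge_antimono[OF V S R sub(2) _ that] mgauge_antimono[OF V R S sub' _ that] c by auto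
  have m: "moment_norm (R \<inter> slice K x i) u \<le> c ^ (2 * CARD('l \<Rightarrow> 'k) + 2) * moment_norm (S \<inter> slice K x i) u"
    "moment_norm (S \<inter> slice K x i) u \<le> c ^ (2 * CARD('l \<Rightarrow> 'k) + 2) * moment_norm (R \<inter> slice K x i) u"
    if x: "nonzero_factors K x" for x i u
  proof -
    let ?L = "slice K x i"
    have L: "subspace ?L" "?L \<subseteq> tensor_space K"
      using subspace_slice slice_subset[OF x] decomposables_subset by blast+
    have "S \<inter> ?L \<subseteq> (\<lambda>x. c *\<^sub>R x) ` (R \<inter> ?L)"
    proof
      fix z assume z: "z \<in> S \<inter> ?L"
      then obtain y where y: "y \<in> R" "z = c *\<^sub>R y" using sub(2) by blast
      then have "y = inverse c *\<^sub>R z" using c by simp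
      then have "y \<in> ?L" using z subspace_scale[OF L(1)] by blast
      with y show "z \<in> (\<lambda>x. c *\<^sub>R x) ` (R \<inter> ?L)" by blast
    qed
    moreover have "R \<inter> ?L \<subseteq> S \<inter> ?L" using sub(1) by blast
    ultimately show "moment_norm (R \<inter> ?L) u \<le> c ^ (2 * CARD('l \<Rightarrow> 'k) + 2) * moment_norm (S \<inter> ?L) u"
      "moment_norm (S \<inter> ?L) u \<le> c ^ (2 * CARD('l \<Rightarrow> 'k) + 2) * moment_norm (R \<inter> ?L) u"
      using moment_norm_mono[OF L(1) body_Int_subspace[OF V L R] body_Int_subspace[OF V L S] c] by blast+
  qed
  have xV: "tens x \<in> tensor_space K" if "nonzero_factors K x" for x
    using nonzero_factors_tens(1)[OF that] decomposables_subset by blast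
  show ?thesis
    unfolding k_def
    by (intro conjI deform_body_scaled_subset[OF R] deform_body_scaled_subset[OF S]
        deform_gauge_le[OF K R S _ c t] deform_gauge_le[OF K S R _ c t] g xV m)
      (use c in auto)
qed

subsection \<open>The endpoint of the deformation\<close>

text \<open>The Kronecker product of the matrices of the \<open>B i\<close>.\<close>

definition tensor_map :: "('l \<Rightarrow> real ^ 'k \<Rightarrow> real ^ 'k) \<Rightarrow> real ^ ('l::finite \<Rightarrow> 'k::finite) \<Rightarrow> real ^ ('l \<Rightarrow> 'k)" where
  "tensor_map B z = (\<chi> f. \<Sum>g\<in>UNIV. (\<Prod>i\<in>UNIV. B i (axis (g i) 1) $ f i) * z $ g)"

lemma linear_tensor_map: "linear (tensor_map B)"
  by (rule linearI)
    (auto simp: tensor_map_def vec_eq_iff distrib_left sum.distrib sum_distrib_left mult.left_commute)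

lemma tensor_map_tens:
  assumes B: "\<And>i. linear (B i)"
  shows "tensor_map B (tens x) = tens (\<lambda>i. B i (x i))"
proof -
  have Bx: "B i (x i) $ a = (\<Sum>j\<in>UNIV. B i (axis j 1) $ a * x i $ j)" for i a
  proof -
    have "B i (x i) = B i (\<Sum>j\<in>UNIV. x i $ j *\<^sub>R axis j 1)"
      using basis_expansion[of "x i"] by (simp add: scalar_mult_eq_scaleR)
    then show ?thesis
      by (simp add: linear_sum[OF B] linear_scale[OF B] sum_component mult.commute)
  qed
  have "(\<Prod>i\<in>UNIV. B i (x i) $ f i) = (\<Sum>g\<in>UNIV. (\<Prod>i\<in>UNIV. B i (axis (g i) 1) $ f i) * (\<Prod>i\<in>UNIV. x i $ g i))" for f
  proof -
    have "(\<Prod>i\<in>UNIV. B i (x i) $ f i) = (\<Sum>g\<in>PiE UNIV (\<lambda>_. UNIV). \<Prod>i\<in>UNIV. B i (axis (g i) 1) $ f i * x i $ g i)"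
      unfolding Bx by (rule prod_sum_PiE) auto
    then show ?thesis by (simp add: prod.distrib PiE_UNIV_domain)
  qed
  then show ?thesis by (simp add: tensor_map_def tens_def vec_eq_iff)
qed

text \<open>Each \<open>B i\<close> is invertible on its coordinate space, so the inverse relation
  is checked on elementary tensors, with left inverses \<open>A i\<close>, and extended to their
  span.\<close>

lemma tensor_map_GL:
  assumes B: "\<And>i. linear (B i)" "\<And>i. B i ` coord_space (K i) = coord_space (K i)"
    "\<And>i. inj_on (B i) (coord_space (K i))"
  shows "tensor_map B \<in> GL_tensor K"
proof -
  note C = subspace_coord_space
  let ?G = "{tens x | x. \<forall>i. x i \<in> coord_space (K i)}"
  have "\<exists>A. linear A \<and> (\<forall>y\<in>coord_space (K i). A (B i y) = y)" for i
    using linear_exists_left_inverse_on[OF B(1) C B(3)] by blast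
  then obtain A where A: "\<And>i. linear (A i)" "\<And>i y. y \<in> coord_space (K i) \<Longrightarrow> A i (B i y) = y" by metis
  have AC: "A i y \<in> coord_space (K i)" "B i (A i y) = y" if y: "y \<in> coord_space (K i)" for i y
  proof -
    have "y \<in> B i ` coord_space (K i)" using B(2) y by simp
    then obtain x where x: "x \<in> coord_space (K i)" "y = B i x" by blast
    have "A i y = x" unfolding x(2) by (rule A(2)[OF x(1)])
    then show "A i y \<in> coord_space (K i)" "B i (A i y) = y" using x by auto
  qed
  have BC: "B i y \<in> coord_space (K i)" if "y \<in> coord_space (K i)" for i y
    using B(2)[of i] that by blast
  have maps: "tensor_map D z \<in> tensor_space K"
    if D: "\<And>i. linear (D i)" "\<And>i y. y \<in> coord_space (K i) \<Longrightarrow> D i y \<in> coord_space (K i)"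
      and z: "z \<in> tensor_space K" for D z
  proof -
    have "tensor_map D ` ?G \<subseteq> tensor_space K"
      using D(2) by (auto simp: tensor_map_tens[OF D(1)] intro!: tens_in_tensor_space)
    then have "tensor_map D ` span ?G \<subseteq> tensor_space K"
      unfolding linear_span_image[OF linear_tensor_map, symmetric]
      by (rule span_minimal[OF _ subspace_tensor_space])
    then show ?thesis using z tensor_space_subset_span by blast
  qed
  have inv: "tensor_map D (tensor_map E z) = z"
    if D: "\<And>i. linear (D i)" "\<And>i. linear (E i)" "\<And>i y. y \<in> coord_space (K i) \<Longrightarrow> D i (E i y) = y"
      and z: "z \<in> tensor_space K" for D E z
  proof -
    have "(tensor_map D \<circ> tensor_map E) z = id z"
    proof (rule linear_eq_on_span[OF linear_compose[OF linear_tensor_map linear_tensor_map] linear_id])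
      show "z \<in> span ?G" using z tensor_space_subset_span by blast
      fix y assume "y \<in> ?G"
      then show "(tensor_map D \<circ> tensor_map E) y = id y"
        using D by (auto simp: tensor_map_tens)
    qed
    then show ?thesis by simp
  qed
  have "bij_betw (tensor_map B) (tensor_space K) (tensor_space K)"
    using maps[OF B(1) BC] maps[OF A(1) AC(1)] inv[OF A(1) B(1) A(2)] inv[OF B(1) A(1) AC(2)]
    by (intro bij_betwI[of _ _ _ "tensor_map A"]) auto
  moreover have "tensor_map B ` decomposables K \<subseteq> decomposables K"
    using BC unfolding decomposables_def by (auto simp: tensor_map_tens[OF B(1)])
  ultimately show ?thesis by (simp add: GL_tensor_def linear_tensor_map)
qed

lemma coord_ball_sym_convex: "{y \<in> coord_space S. norm y \<le> 1} \<in> sym_convex_bodies (coord_space S)"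
  by (rule norm_ball_sym_convex_body[OF subspace_coord_space, of _ _ 1 1])
    (auto simp: norm_triangle_ineq)

text \<open>At time 1 the factors are ellipsoids. \<open>tensor_map B\<close> maps them to Euclidean
  unit balls simultaneously, so the factor 1 is attained.\<close>

lemma deform_body_1_dist:
  fixes K :: "'l::finite \<Rightarrow> 'k::finite set"
  assumes K: "\<And>i. card (K i) \<ge> 2" and P: "P \<in> tensorial_bodies K"
  shows "tensor_BM_dist K (deform_body K 1 P) (proj_tensor (\<lambda>i. {y \<in> coord_space (K i). norm y \<le> 1})) = 1"
proof -
  let ?b = "\<lambda>i. {y \<in> coord_space (K i). norm y \<le> 1}"
  obtain Q B where "factorization K P Q B"
    by (rule factorization_exists[OF K P], rule that)
  note f = factorizationD[OF this]
  note Q = f(1-3) and B = f(4-6) and D = f(7)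
  have D1: "deform_body K 1 P = proj_tensor (\<lambda>i. {y \<in> coord_space (K i). norm (B i y) \<le> 1})"
    using D[of 1] by simp
  have "tensor_map B ` {tens x | x. \<forall>i. x i \<in> {y \<in> coord_space (K i). norm (B i y) \<le> 1}} =
    {tens x | x. \<forall>i. x i \<in> ?b i}"
  proof (intro equalityI subsetI)
    fix z assume "z \<in> {tens x | x. \<forall>i. x i \<in> ?b i}"
    then obtain x where x: "z = tens x" "\<And>i. x i \<in> coord_space (K i)" "\<And>i. norm (x i) \<le> 1" by blast
    have "\<exists>y. y \<in> coord_space (K i) \<and> x i = B i y" for i using B(2)[of i] x(2)[of i] by blast
    then obtain y where y: "\<And>i. y i \<in> coord_space (K i)" "\<And>i. x i = B i (y i)" by metis
    have "z = tensor_map B (tens y)" unfolding x(1) tensor_map_tens[OF B(1)] y(2)[symmetric] ..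
    moreover have "\<forall>i. y i \<in> {y \<in> coord_space (K i). norm (B i y) \<le> 1}" using y x(3) by auto
    ultimately show "z \<in> tensor_map B ` {tens x | x. \<forall>i. x i \<in> {y \<in> coord_space (K i). norm (B i y) \<le> 1}}"
      by blast
  next
    fix z assume "z \<in> tensor_map B ` {tens x | x. \<forall>i. x i \<in> {y \<in> coord_space (K i). norm (B i y) \<le> 1}}"
    then obtain x where x: "z = tensor_map B (tens x)" "\<And>i. x i \<in> coord_space (K i)" "\<And>i. norm (B i (x i)) \<le> 1"
      by blast
    then have "\<forall>i. B i (x i) \<in> ?b i" using B(2) by blast
    then show "z \<in> {tens x | x. \<forall>i. x i \<in> ?b i}" using x(1) by (auto simp: tensor_map_tens[OF B(1)])
  qed
  then have im: "tensor_map B ` deform_body K 1 P = proj_tensor ?b"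
    unfolding D1 proj_tensor_def convex_hull_linear_image[OF linear_tensor_map] by simp
  have "1 * 1 \<in> bm_factors K (deform_body K 1 P) (proj_tensor ?b)"
    by (rule bm_factors_scaled[OF tensor_map_GL[OF B]]) (auto simp: im)
  then have "tensor_BM_dist K (deform_body K 1 P) (proj_tensor ?b) \<le> 1"
    using tensor_BM_dist_le by fastforce
  moreover have "tensor_BM_dist K (deform_body K 1 P) (proj_tensor ?b) \<ge> 1"
    by (intro tensor_BM_dist_ge_1 tensorial_bodies_sym_convex deform_body_tensorial[OF K P]
        proj_tensor_sym_convex coord_ball_sym_convex) simp
  ultimately show ?thesis by simp
qed

section \<open>The two homotopies and their concatenation\<close>

lemma homotopic_shrink_body:
  fixes K :: "'l::finite \<Rightarrow> 'k::finite set"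
  assumes K: "\<And>i. card (K i) \<ge> 2"
  shows "homotopic_with (\<lambda>_. True) (BM_tensor_top K) (BM_tensor_top K)
    (\<lambda>C. bm_class K (shrink_body K 0 (bm_rep C))) (\<lambda>C. bm_class K (shrink_body K 1 (bm_rep C)))"
proof (rule homotopic_BM_tensor_maps[where k = "2 * 1"])
  note V = subspace_tensor_space[of K] and sc = tensorial_bodies_sym_convex
  fix t :: real and P R assume t: "t \<in> {0..1}" and PR: "P \<in> tensorial_bodies K" "R \<in> tensorial_bodies K"
  show "tensor_BM_dist K (shrink_body K t P) (shrink_body K t R) \<le> tensor_BM_dist K P R ^ (2 * 1)"
  proof (rule tensor_BM_dist_map_le_power[OF _ _ _ PR])
    show "shrink_body K t P \<in> tensorial_bodies K" if "P \<in> tensorial_bodies K" for P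
      by (rule shrink_body_tensorial[OF K that t])
    show "shrink_body K t (T ` P) = T ` shrink_body K t P" if "P \<in> tensorial_bodies K" "T \<in> GL_tensor K" for P T
      using sc[OF that(1)] by (intro shrink_body_equivariant that) (simp add: sym_convex_bodies_def)
    fix R S c
    assume RS: "R \<in> sym_convex_bodies (tensor_space K)" "S \<in> sym_convex_bodies (tensor_space K)" "c \<ge> 1"
      "R \<subseteq> S" "S \<subseteq> (\<lambda>x. c *\<^sub>R x) ` R"
    have "R \<subseteq> (\<lambda>x. c *\<^sub>R x) ` S" using RS(3,4) body_scale_subset[OF RS(2) V, of 1 c] by auto
    then show "shrink_body K t S \<subseteq> (\<lambda>x. (c ^ 1) *\<^sub>R x) ` shrink_body K t R \<and>
       shrink_body K t R \<subseteq> (\<lambda>x. (c ^ 1) *\<^sub>R x) ` shrink_body K t S"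
      using RS shrink_body_scaled_subset[of S c R] shrink_body_scaled_subset[of R c S] by simp
  qed
qed (rule shrink_body_tensorial[OF K] shrink_body_continuous[OF K], assumption+)+

lemma homotopic_deform_body:
  fixes K :: "'l::finite \<Rightarrow> 'k::finite set"
  assumes K: "\<And>i. card (K i) \<ge> 2"
  shows "homotopic_with (\<lambda>_. True) (BM_tensor_top K) (BM_tensor_top K)
    (\<lambda>C. bm_class K (deform_body K 0 (bm_rep C))) (\<lambda>C. bm_class K (deform_body K 1 (bm_rep C)))"
proof (rule homotopic_BM_tensor_maps[where k = "2 * (1 + (2 * CARD('l \<Rightarrow> 'k) + 2 + 1) * CARD('l))"])
  note sc = tensorial_bodies_sym_convex
  fix t :: real and P R assume t: "t \<in> {0..1}" and PR: "P \<in> tensorial_bodies K" "R \<in> tensorial_bodies K"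
  show "tensor_BM_dist K (deform_body K t P) (deform_body K t R) \<le>
      tensor_BM_dist K P R ^ (2 * (1 + (2 * CARD('l \<Rightarrow> 'k) + 2 + 1) * CARD('l)))"
  proof (rule tensor_BM_dist_map_le_power[OF _ _ _ PR])
    show "deform_body K t P \<in> tensorial_bodies K" if "P \<in> tensorial_bodies K" for P
      by (rule deform_body_tensorial[OF K that t])
    show "deform_body K t (T ` P) = T ` deform_body K t P" if "P \<in> tensorial_bodies K" "T \<in> GL_tensor K" for P T
      by (rule deform_body_equivariant[OF that(2) sc[OF that(1)]])
  qed (rule deform_body_lipschitz[OF K _ _ _ t])
qed (rule deform_body_tensorial[OF K] deform_body_continuous[OF K], assumption+)+

theorem proposition6p1:
  fixes d :: "'l::finite \<Rightarrow> nat" and K :: "'l \<Rightarrow> 'k::finite set"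
  assumes "\<And>i. card (K i) = d i"
    and "\<And>i. d i \<ge> 2"
  shows "contractible_space (BM_tensor_top K)"
proof -
  note sc = tensorial_bodies_sym_convex
  have K: "card (K i) \<ge> 2" for i using assms by simp
  let ?X = "BM_tensor_top K"
  let ?b = "proj_tensor (\<lambda>i. {y \<in> coord_space (K i). norm y \<le> 1})"
  have b: "?b \<in> tensorial_bodies K" by (rule proj_tensor_tensorial[OF coord_ball_sym_convex])
  have rep: "bm_rep C \<in> tensorial_bodies K" "bm_class K (bm_rep C) = C" if "C \<in> topspace ?X" for C
    using that unfolding topspace_BM_tensor_top by (fact bm_rep)+
  have zero: "0 \<in> bm_rep C" if "C \<in> topspace ?X" for C
    using sym_convex_bodies_zero[OF subspace_tensor_space sc[OF rep(1)[OF that]]] .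
  \<comment> \<open>The class on the right does not depend on \<open>P\<close>, which makes the end
    of the second homotopy a constant map.\<close>
  have endpoint: "bm_class K (deform_body K 1 P) = bm_class K ?b" if "P \<in> tensorial_bodies K" for P
    using bm_class_eq_iff[OF deform_body_tensorial[OF K that, of 1] b] deform_body_1_dist[OF K that] by simp
  \<comment> \<open>The homotopies fit together because \<open>shrink_body K 1 P\<close> and
    \<open>deform_body K 0 P\<close> are both the decomposable hull of \<open>P\<close>.\<close>
  have "homotopic_with (\<lambda>_. True) ?X ?X id (\<lambda>C. bm_class K (deform_body K 0 (bm_rep C)))"
    by (rule homotopic_with_eq[OF homotopic_shrink_body[OF K]])
      (simp_all add: rep zero shrink_body_0 shrink_body_1 deform_body_0 sc)
  moreover have "homotopic_with (\<lambda>_. True) ?X ?X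
      (\<lambda>C. bm_class K (deform_body K 0 (bm_rep C))) (\<lambda>C. bm_class K ?b)"
    by (rule homotopic_with_eq[OF homotopic_deform_body[OF K]])
      (simp_all add: rep endpoint)
  ultimately show ?thesis
    unfolding contractible_space_def by (blast intro: homotopic_with_trans)
qed

end
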